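(* Let $\mathcal T$ be a simplicial triangulation of a bounded polyhedral domain $\Omega\subset\mathbb R^n$, let $r\ge1$ and $0\le k\le n$. For $f\in\Delta(\mathcal T)$, a multi-index $\alpha=(\alpha_i)_{i\in\mathcal I(f)}$ of nonnegative integers with $|\alpha|=r-1$, and an increasing map $\sigma:\{0,\dots,k\}\to\mathcal I(f)$, such that $\{i\mid\alpha_i>0\}\cup\sigma(\{0,\dots,k\})=\mathcal I(f)$, let $\omega_{f,\alpha,\sigma}$ be the piecewise polynomial $k$-form given by $\omega_{f,\alpha,\sigma}|_T=(\lambda^T)^\alpha\phi^T_\sigma$ for $T\in\mathcal T$ containing $f$ and $\omega_{f,\alpha,\sigma}|_T=0$ for all other $T\in\mathcal T$. Then the forms $\omega_{f,\alpha,\sigma}$, over all such $(f,\alpha,\sigma)$, belong to and span $\mathcal P^-_r\Lambda^k(\mathcal T)$, and those $\omega_{f,\alpha,\sigma}$ for which in addition $\alpha_i=0$ whenever $i<\min\sigma(\{0,\dots,k\})$ form a basis of $\mathcal P^-_r\Lambda^k(\mathcal T)$.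
   Context: A simplicial triangulation $\mathcal T$ of $\Omega$ is a finite set of closed $n$-simplices whose union is the closure of $\Omega$ and such that the intersection of any two is either empty or a common subsimplex of each. $\Delta(T)$ is the set of all nonempty faces of $T$ of all dimensions (including $T$), $\Delta(\mathcal T)=\bigcup_{T\in\mathcal T}\Delta(T)$. The vertices of $\mathcal T$ are numbered, $x_0,\dots,x_N$, and $\mathcal I(f)$ is the set of indices of the vertices of the simplex $f$. For $i\in\mathcal I(T)$, $\lambda_i^T$ is the affine function on $T$ with $\lambda_i^T(x_j)=\delta_{ij}$, $j\in\mathcal I(T)$; $(\lambda^T)^\alpha=\prod_i(\lambda_i^T)^{\alpha_i}$. The Whitney form is $$\phi^T_\sigma=\sum_{i=0}^k(-1)^i\lambda^T_{\sigma(i)}\,d\lambda^T_{\sigma(0)}\wedge\cdots\wedge\widehat{d\lambda^T_{\sigma(i)}}\wedge\cdots\wedge d\lambda^T_{\sigma(k)}.$$ $\mathcal P_r\Lambda^k(T)$ is the space of differential $k$-forms on $T$ with coefficients polynomials of degree at most $r$ ($\{0\}$ if $k>n$). With the Koszul operator $(\kappa\omega)_x(v_1,\dots,v_{k-1})=\omega_x(x-o,v_1,\dots,v_{k-1})$ for any fixed origin $o\in\mathbb R^n$, $\mathcal P^-_r\Lambda^k(T)=\mathcal P_{r-1}\Lambda^k(T)+\kappa\mathcal P_{r-1}\Lambda^{k+1}(T)$ (independent of $o$). $\mathcal P^-_r\Lambda^k(\mathcal T)$ is the space of $\omega\in L^2\Lambda^k(\Omega)$ with $\omega|_T\in\mathcal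 P^-_r\Lambda^k(T)$ for all $T\in\mathcal T$ and such that for each $f\in\Delta(\mathcal T)$ with $k\le\dim f\le n-1$, $\operatorname{tr}_f\omega$ is single-valued, i.e. the pullback of $\omega|_T$ to $f$ is the same for all $T\in\mathcal T$ containing $f$. *)

theory Defs
  imports "HOL-Analysis.Analysis"
begin

section \<open>Alternating forms and polynomial differential forms\<close>

text \<open>A \<open>k\<close>-linear form is a function on lists of vectors that vanishes on lists whose length
  is not \<open>k\<close>; \<open>\<omega> x [v1, ..., vk]\<close> is the value of a differential form \<open>\<omega>\<close> at the point \<open>x\<close>.\<close>

type_synonym 'n multi_form = "(real ^ 'n) list \<Rightarrow> real"
type_synonym 'n diff_form = "real ^ 'n \<Rightarrow> 'n multi_form"

definition alt_form :: "nat \<Rightarrow> ('n::finite) multi_form \<Rightarrow> bool" where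
  "alt_form k a \<longleftrightarrow>
     (\<forall>vs. length vs \<noteq> k \<longrightarrow> a vs = 0) \<and>
     (\<forall>vs i. length vs = k \<and> i < k \<longrightarrow> linear (\<lambda>v. a (vs[i := v]))) \<and>
     (\<forall>vs i j. length vs = k \<and> i < j \<and> j < k \<and> vs ! i = vs ! j \<longrightarrow> a vs = 0)"

text \<open>The wedge product of covectors, normalised so that
  \<open>(l1 \<and> ... \<and> lk) (v1, ..., vk) = det (li vj)\<close>.\<close>

definition wedge :: "(real ^ 'n \<Rightarrow> real) list \<Rightarrow> ('n::finite) multi_form" where
  "wedge ls vs =
     (if length vs = length ls
      then \<Sum>p | p permutes {..<length ls}. of_int (sign p) * (\<Prod>i<length ls. (ls ! i) (vs ! p i))
      else 0)"

definition poly_deg_le :: "nat \<Rightarrow> (real ^ ('n::finite) \<Rightarrow> real) \<Rightarrow> bool" where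
  "poly_deg_le r p \<longleftrightarrow>
     (\<exists>c :: ('n \<Rightarrow> nat) \<Rightarrow> real.
        \<forall>x. p x = (\<Sum>a | (\<Sum>i\<in>UNIV. a i) \<le> r. c a * (\<Prod>i\<in>UNIV. (x $ i) ^ a i)))"

text \<open>Polynomial forms on an \<open>n\<close>-simplex are identified with their unique polynomial extensions
  to the whole space, so the spaces below carry no reference to the simplex.\<close>

definition poly_forms :: "nat \<Rightarrow> nat \<Rightarrow> ('n::finite) diff_form set" where
  "poly_forms r k =
     {\<omega>. (\<forall>x. alt_form k (\<omega> x)) \<and> (\<forall>vs. poly_deg_le r (\<lambda>x. \<omega> x vs))}"

definition koszul :: "real ^ 'n \<Rightarrow> ('n::finite) diff_form \<Rightarrow> 'n diff_form" where
  "koszul org \<omega> x vs = \<omega> x ((x - org) # vs)"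

definition trimmed_forms :: "real ^ 'n \<Rightarrow> nat \<Rightarrow> nat \<Rightarrow> ('n::finite) diff_form set" where
  "trimmed_forms org r k =
     {\<lambda>x vs. \<omega> x vs + koszul org \<eta> x vs | \<omega> \<eta>.
        \<omega> \<in> poly_forms (r - 1) k \<and> \<eta> \<in> poly_forms (r - 1) (k + 1)}"


section \<open>Square-integrable forms up to equality almost everywhere\<close>

quotient_type (overloaded) 'n ae_form =
  "(real ^ ('n::finite)) \<Rightarrow> (real ^ 'n) list \<Rightarrow> real" /
  "\<lambda>\<omega> \<eta>. AE x in lebesgue. \<omega> x = \<eta> x"
proof (rule equivpI)
  show "reflp (\<lambda>(\<omega> :: 'n diff_form) \<eta>. AE x in lebesgue. \<omega> x = \<eta> x)"
    by (auto intro!: reflpI)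
  show "symp (\<lambda>(\<omega> :: 'n diff_form) \<eta>. AE x in lebesgue. \<omega> x = \<eta> x)"
    by (auto intro!: sympI elim: eventually_mono)
  show "transp (\<lambda>(\<omega> :: 'n diff_form) \<eta>. AE x in lebesgue. \<omega> x = \<eta> x)"
    by (rule transpI) (erule (1) eventually_elim2, simp)
qed

instantiation ae_form :: (finite) real_vector
begin

lift_definition zero_ae_form :: "'a ae_form" is "\<lambda>x vs. 0" .

lift_definition plus_ae_form :: "'a ae_form \<Rightarrow> 'a ae_form \<Rightarrow> 'a ae_form"
  is "\<lambda>\<omega> \<eta> x vs. \<omega> x vs + \<eta> x vs"
  by (erule (1) eventually_elim2) simp

lift_definition minus_ae_form :: "'a ae_form \<Rightarrow> 'a ae_form \<Rightarrow> 'a ae_form"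
  is "\<lambda>\<omega> \<eta> x vs. \<omega> x vs - \<eta> x vs"
  by (erule (1) eventually_elim2) simp

lift_definition uminus_ae_form :: "'a ae_form \<Rightarrow> 'a ae_form"
  is "\<lambda>\<omega> x vs. - \<omega> x vs"
  by (erule eventually_mono) simp

lift_definition scaleR_ae_form :: "real \<Rightarrow> 'a ae_form \<Rightarrow> 'a ae_form"
  is "\<lambda>c \<omega> x vs. c * \<omega> x vs"
  by (erule eventually_mono) simp

instance
  by standard (transfer, simp add: algebra_simps)+

end

text \<open>Agreement of a class with a form \<open>p\<close> on a set \<open>T\<close>, that is, \<open>\<omega>|T = p\<close> in the sense of
  classes on \<open>T\<close>.\<close>

lift_definition restricts_to :: "('n::finite) ae_form \<Rightarrow> (real ^ 'n) set \<Rightarrow> 'n diff_form \<Rightarrow> bool"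
  is "\<lambda>\<omega> T p. AE x in lebesgue. x \<in> T \<longrightarrow> \<omega> x = p x"
  by (intro ext iffI; erule (1) eventually_elim2, simp)

text \<open>The \<open>L\<^sup>2\<close> forms on \<open>\<Omega>\<close> are extended by zero to the whole space, which makes the forms on
  all domains subspaces of the single vector space of almost-everywhere classes.\<close>

definition L2_forms :: "(real ^ 'n) set \<Rightarrow> nat \<Rightarrow> ('n::finite) ae_form set" where
  "L2_forms \<Omega> k = abs_ae_form `
     {\<omega>. (\<forall>x. alt_form k (\<omega> x)) \<and>
         (\<forall>x. x \<notin> \<Omega> \<longrightarrow> \<omega> x = (\<lambda>vs. 0)) \<and>
         (\<forall>vs. (\<lambda>x. \<omega> x vs) \<in> borel_measurable lebesgue \<and>
               integrable lebesgue (\<lambda>x. (\<omega> x vs)\<^sup>2))}"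


section \<open>Polyhedral domains and simplicial triangulations\<close>

definition bounded_polyhedral_domain :: "(real ^ 'n::finite) set \<Rightarrow> bool" where
  "bounded_polyhedral_domain \<Omega> \<longleftrightarrow>
     open \<Omega> \<and> connected \<Omega> \<and> \<Omega> \<noteq> {} \<and> bounded \<Omega> \<and>
     (\<exists>\<F>. finite \<F> \<and> (\<forall>P\<in>\<F>. polytope P) \<and> frontier \<Omega> = \<Union>\<F>)"

text \<open>In the library's \<^const>\<open>triangulation\<close> the empty set counts as a face, so disjoint simplices
  are allowed.\<close>

definition simplicial_triangulation ::
    "(real ^ 'n::finite) set set \<Rightarrow> (real ^ 'n) set \<Rightarrow> bool" where
  "simplicial_triangulation \<T> \<Omega> \<longleftrightarrow>
     triangulation \<T> \<and> (\<forall>T\<in>\<T>. int CARD('n) simplex T) \<and> \<Union>\<T> = closure \<Omega>"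

definition mesh_faces :: "(real ^ 'n::finite) set set \<Rightarrow> (real ^ 'n) set set" where
  "mesh_faces \<T> = {f. f \<noteq> {} \<and> (\<exists>T\<in>\<T>. f face_of T)}"

definition mesh_vertices :: "(real ^ 'n::finite) set set \<Rightarrow> (real ^ 'n) set" where
  "mesh_vertices \<T> = {v. \<exists>T\<in>\<T>. v extreme_point_of T}"

definition vertex_indices ::
    "(nat \<Rightarrow> real ^ 'n::finite) \<Rightarrow> nat \<Rightarrow> (real ^ 'n) set \<Rightarrow> nat set" where
  "vertex_indices x N f = {i. i \<le> N \<and> x i extreme_point_of f}"

definition tangent_space :: "(real ^ 'n::finite) set \<Rightarrow> (real ^ 'n) set" where
  "tangent_space f = span {y - z | y z. y \<in> f \<and> z \<in> f}"


section \<open>The trimmed finite element space\<close>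

text \<open>Two forms have the same pullback to \<open>f\<close>.\<close>

definition same_trace ::
    "nat \<Rightarrow> (real ^ 'n) set \<Rightarrow> ('n::finite) diff_form \<Rightarrow> 'n diff_form \<Rightarrow> bool" where
  "same_trace k f \<omega> \<eta> \<longleftrightarrow>
     (\<forall>y\<in>f. \<forall>vs. length vs = k \<and> set vs \<subseteq> tangent_space f \<longrightarrow> \<omega> y vs = \<eta> y vs)"

definition trimmed_space ::
    "real ^ 'n \<Rightarrow> (real ^ 'n) set \<Rightarrow> (real ^ 'n) set set \<Rightarrow> nat \<Rightarrow> nat \<Rightarrow> ('n::finite) ae_form set" where
  "trimmed_space org \<Omega> \<T> r k =
     {W \<in> L2_forms \<Omega> k.
        \<exists>p. (\<forall>T\<in>\<T>. p T \<in> trimmed_forms org r k \<and> restricts_to W T (p T)) \<and>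
            (\<forall>f\<in>mesh_faces \<T>. int k \<le> aff_dim f \<and> aff_dim f \<le> int CARD('n) - 1 \<longrightarrow>
               (\<forall>T\<in>\<T>. \<forall>T'\<in>\<T>. f \<subseteq> T \<and> f \<subseteq> T' \<longrightarrow> same_trace k f (p T) (p T')))}"


section \<open>Barycentric coordinates, Whitney forms and the spanning family\<close>

definition barycentric ::
    "(nat \<Rightarrow> real ^ 'n::finite) \<Rightarrow> nat \<Rightarrow> (real ^ 'n) set \<Rightarrow> nat \<Rightarrow> real ^ 'n \<Rightarrow> real" where
  "barycentric x N T i =
     (THE g. (\<exists>l c. linear l \<and> g = (\<lambda>y. l y + c)) \<and>
             (\<forall>j\<in>vertex_indices x N T. g (x j) = (if i = j then 1 else 0)))"

definition whitney_form ::
    "(nat \<Rightarrow> real ^ 'n) \<Rightarrow> nat \<Rightarrow> (real ^ 'n) set \<Rightarrow> nat \<Rightarrow> (nat \<Rightarrow> nat) \<Rightarrow> ('n::finite) diff_form" where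
  "whitney_form x N T k \<sigma> y vs =
     (\<Sum>i=0..k. (- 1) ^ i * barycentric x N T (\<sigma> i) y *
        wedge (map (\<lambda>j. frechet_derivative (barycentric x N T (\<sigma> j)) (at y))
                 (filter (\<lambda>j. j \<noteq> i) [0..<Suc k])) vs)"

text \<open>The class of the piecewise form that equals \<open>p T\<close> on each \<open>T \<in> \<T>\<close>. Interiors of distinct
  simplices are disjoint, so the sum has at most one term; the boundaries of the simplices form
  a null set.\<close>

definition piecewise_form ::
    "(real ^ 'n) set set \<Rightarrow> ((real ^ 'n) set \<Rightarrow> 'n diff_form) \<Rightarrow> ('n::finite) ae_form" where
  "piecewise_form \<T> p = abs_ae_form (\<lambda>y vs. \<Sum>T | T \<in> \<T> \<and> y \<in> interior T. p T y vs)"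

definition omega_form ::
    "(nat \<Rightarrow> real ^ 'n) \<Rightarrow> nat \<Rightarrow> (real ^ 'n) set set \<Rightarrow> nat \<Rightarrow>
     (real ^ 'n) set \<times> (nat \<Rightarrow> nat) \<times> (nat \<Rightarrow> nat) \<Rightarrow> ('n::finite) ae_form" where
  "omega_form x N \<T> k = (\<lambda>(f, \<alpha>, \<sigma>). piecewise_form \<T>
     (\<lambda>T y vs. if f \<subseteq> T
               then (\<Prod>i\<in>vertex_indices x N f. barycentric x N T i y ^ \<alpha> i) * whitney_form x N T k \<sigma> y vs
               else 0))"

definition omega_indices ::
    "(nat \<Rightarrow> real ^ 'n::finite) \<Rightarrow> nat \<Rightarrow> (real ^ 'n) set set \<Rightarrow> nat \<Rightarrow> nat \<Rightarrow>
     ((real ^ 'n) set \<times> (nat \<Rightarrow> nat) \<times> (nat \<Rightarrow> nat)) set" where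
  "omega_indices x N \<T> r k =
     {(f, \<alpha>, \<sigma>). f \<in> mesh_faces \<T> \<and>
        \<alpha> \<in> vertex_indices x N f \<rightarrow>\<^sub>E UNIV \<and> (\<Sum>i\<in>vertex_indices x N f. \<alpha> i) = r - 1 \<and>
        \<sigma> \<in> {0..k} \<rightarrow>\<^sub>E vertex_indices x N f \<and> strict_mono_on {0..k} \<sigma> \<and>
        {i \<in> vertex_indices x N f. \<alpha> i > 0} \<union> \<sigma> ` {0..k} = vertex_indices x N f}"

definition basis_indices ::
    "(nat \<Rightarrow> real ^ 'n::finite) \<Rightarrow> nat \<Rightarrow> (real ^ 'n) set set \<Rightarrow> nat \<Rightarrow> nat \<Rightarrow>
     ((real ^ 'n) set \<times> (nat \<Rightarrow> nat) \<times> (nat \<Rightarrow> nat)) set" where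
  "basis_indices x N \<T> r k =
     {(f, \<alpha>, \<sigma>) \<in> omega_indices x N \<T> r k.
        \<forall>i\<in>vertex_indices x N f. i < Min (\<sigma> ` {0..k}) \<longrightarrow> \<alpha> i = 0}"

end

theory Submission
  imports Defs "Jordan_Normal_Form.Determinant"
begin

text \<open>In homogeneous coordinates on a simplex, \<open>\<phi>\<^sub>\<sigma>\<close> is the contraction of
  \<open>d\<lambda>\<^sub>\<sigma>\<^sub>0 \<and> \<dots> \<and> d\<lambda>\<^sub>\<sigma>\<^sub>k\<close> with the position vector, that is, a determinant whose first column
  holds the barycentric coordinates of the point. Repeating that column gives the linear relations
  between the \<open>\<lambda>\<^sub>i \<phi>\<^sub>\<sigma>\<close>, which reduce every \<open>\<lambda>\<^sup>\<alpha> \<phi>\<^sub>\<sigma>\<close> to those with \<open>\<alpha>\<^sub>i = 0\<close> for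
  \<open>i < min \<sigma>\<close>; expanding alternating forms in the edge vectors at a vertex then shows that these
  span the trimmed space of the simplex. Evaluated at the vectors pointing from \<open>y\<close> to the
  vertices \<open>\<tau>\<close>, a vanishing combination becomes a system of polynomial identities in the
  barycentric coordinates. With \<open>s\<close> the smallest occurring value of \<open>min \<sigma>\<close> and \<open>\<tau> = \<sigma> - {s}\<close>,
  all terms except \<open>\<lambda>\<^sub>s\<close> times the coefficient of \<open>\<phi>\<^sub>\<sigma>\<close> are free of \<open>\<lambda>\<^sub>s\<close>, so that coefficient
  vanishes.

  The reduced forms on a face are traces of the reduced forms on the simplices around it, and the
  remaining ones have trace zero. Hence independence on the faces forces the local coefficients of
  an element of the global space to agree on common faces, which yields the global expansion.\<close>

no_notation Matrix.vec_index (infixl "$" 100)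

section \<open>Determinants with labelled rows\<close>

text \<open>The vectors from \<open>y\<close> to the vertices are chosen because d\<lambda>_i takes
  the value \<delta>_ij - \<lambda>_i(y) on \<open>X j - y\<close>. The subtracted column is the
  leading one, so only unit columns remain beside it; moreover these vectors are tangent to every
  face containing \<open>y\<close> and the vertex. One obstacle remains: the barycentric coordinates
  sum to 1, so \<lambda>_s cannot be set to 0 while the others stay fixed. All terms are homogeneous
  of degree r in them, and scaling removes the constraint. A term with set \<open>S'\<close> other
  than \<sigma> is free of \<lambda>_s for one of two reasons: if s lies in \<open>S'\<close>, then
  \<open>S'\<close> misses a label of \<tau> and the determinant is zero; otherwise s is below min
  \<open>S'\<close>, and the condition on \<alpha> excludes the factor \<lambda>_s. Globally, traces
  are prescribed only on faces of dimension k to n - 1. If a reduced pair occurs on two distinct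
  simplices, their common face has at least k + 1 and at most n vertices, which is exactly this
  range.\<close>

definition omit :: "nat \<Rightarrow> 'a list \<Rightarrow> 'a list" where
  "omit i xs = take i xs @ drop (Suc i) xs"

lemma length_omit: "i < length xs \<Longrightarrow> length (omit i xs) = length xs - 1"
  by (simp add: omit_def)

lemma nth_omit:
  "i < length xs \<Longrightarrow> j < length xs - 1 \<Longrightarrow> omit i xs ! j = xs ! (if j < i then j else Suc j)"
  by (auto simp: omit_def nth_append min_def)

lemma map_omit: "map f (omit i xs) = omit i (map f xs)"
  by (simp add: omit_def take_map drop_map)

lemma set_omit: "set (omit i xs) \<subseteq> set xs"
  by (auto simp: omit_def dest: in_set_takeD in_set_dropD)

lemma omit_Cons_Suc: "omit (Suc i) (x # xs) = x # omit i xs"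
  by (simp add: omit_def)

lemma omit_Cons_0: "omit 0 (x # xs) = xs"
  by (simp add: omit_def)

text \<open>The rows are labelled by a list of vertex indices, and a column is a function on all indices, so
  that the same columns serve for every choice of rows.\<close>

definition idet :: "nat list \<Rightarrow> (nat \<Rightarrow> real) list \<Rightarrow> real" where
  "idet s cs =
     (if length s = length cs
      then Determinant.det (mat (length cs) (length cs) (\<lambda>(i, j). (cs ! j) (s ! i))) else 0)"

lemma idet_cong:
  assumes "length cs = length ds" "\<And>i j. i \<in> set s \<Longrightarrow> j < length cs \<Longrightarrow> (cs ! j) i = (ds ! j) i"
  shows "idet s cs = idet s ds"
proof (cases "length s = length cs")
  case True
  have "mat (length cs) (length cs) (\<lambda>(i, j). (cs ! j) (s ! i)) =
        mat (length ds) (length ds) (\<lambda>(i, j). (ds ! j) (s ! i))"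
    using assms True by (intro eq_matI) auto
  then show ?thesis using assms(1) by (simp add: idet_def)
qed (use assms in \<open>simp add: idet_def\<close>)

lemma idet_col_expand:
  assumes "j < length cs" "length s = length cs"
  shows "idet s cs = (\<Sum>i<length s. (-1) ^ (i + j) * (cs ! j) (s ! i) * idet (omit i s) (omit j cs))"
proof -
  define n where "n = length cs"
  define A where "A = mat n n (\<lambda>(i, j). (cs ! j) (s ! i))"
  have A: "A \<in> carrier_mat n n" by (simp add: A_def)
  have "Determinant.det A = (\<Sum>i<n. A $$ (i, j) * cofactor A i j)"
    by (rule laplace_expansion_column[OF A]) (use assms n_def in simp)
  also have "\<dots> = (\<Sum>i<n. (-1) ^ (i + j) * (cs ! j) (s ! i) * idet (omit i s) (omit j cs))"
  proof (rule sum.cong[OF refl])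
    fix i assume i: "i \<in> {..<n}"
    have "mat_delete A i j = mat (n - 1) (n - 1) (\<lambda>(i', j'). (omit j cs ! j') (omit i s ! i'))"
      using i assms by (intro eq_matI) (auto simp: mat_delete_def A_def nth_omit n_def)
    then have "Determinant.det (mat_delete A i j) = idet (omit i s) (omit j cs)"
      using i assms by (simp add: idet_def length_omit n_def)
    then show "A $$ (i, j) * cofactor A i j
        = (-1) ^ (i + j) * (cs ! j) (s ! i) * idet (omit i s) (omit j cs)"
      using i assms by (simp add: cofactor_def A_def n_def)
  qed
  finally show ?thesis using assms by (simp add: idet_def A_def n_def)
qed

lemma idet_row_expand:
  assumes "i < length cs" "length s = length cs"
  shows "idet s cs = (\<Sum>j<length cs. (-1) ^ (i + j) * (cs ! j) (s ! i) * idet (omit i s) (omit j cs))"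
proof -
  define n where "n = length cs"
  define A where "A = mat n n (\<lambda>(i, j). (cs ! j) (s ! i))"
  have A: "A \<in> carrier_mat n n" by (simp add: A_def)
  have "Determinant.det A = (\<Sum>j<n. A $$ (i, j) * cofactor A i j)"
    by (rule laplace_expansion_row[OF A]) (use assms n_def in simp)
  also have "\<dots> = (\<Sum>j<n. (-1) ^ (i + j) * (cs ! j) (s ! i) * idet (omit i s) (omit j cs))"
  proof (rule sum.cong[OF refl])
    fix j assume j: "j \<in> {..<n}"
    have "mat_delete A i j = mat (n - 1) (n - 1) (\<lambda>(i', j'). (omit j cs ! j') (omit i s ! i'))"
      using j assms by (intro eq_matI) (auto simp: mat_delete_def A_def nth_omit n_def)
    then have "Determinant.det (mat_delete A i j) = idet (omit i s) (omit j cs)"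
      using j assms by (simp add: idet_def length_omit n_def)
    then show "A $$ (i, j) * cofactor A i j
        = (-1) ^ (i + j) * (cs ! j) (s ! i) * idet (omit i s) (omit j cs)"
      using j assms by (simp add: cofactor_def A_def n_def)
  qed
  finally show ?thesis using assms by (simp add: idet_def A_def n_def)
qed

lemma idet_laplace_col:
  assumes "length s = Suc (length cs)"
  shows "idet s (c # cs) = (\<Sum>i<length s. (-1) ^ i * c (s ! i) * idet (omit i s) cs)"
  using idet_col_expand[of 0 "c # cs" s] assms by (simp add: omit_Cons_0)

lemma idet_laplace_row:
  assumes "length cs = Suc (length s)"
  shows "idet (i # s) cs = (\<Sum>j<length cs. (-1) ^ j * (cs ! j) i * idet s (omit j cs))"
  using idet_row_expand[of 0 cs "i # s"] assms by (simp add: omit_Cons_0)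

lemma omit_list_update: "omit j (cs[j := c]) = omit j cs"
  by (simp add: omit_def)

lemma idet_update_expand:
  assumes "j < length cs" "length s = length cs"
  shows "idet s (cs[j := c]) = (\<Sum>i<length s. (-1) ^ (i + j) * c (s ! i) * idet (omit i s) (omit j cs))"
  using idet_col_expand[of j "cs[j := c]" s] assms by (simp add: omit_list_update)

lemma idet_update_add:
  assumes "j < length cs"
  shows "idet s (cs[j := \<lambda>i. c i + d i]) = idet s (cs[j := c]) + idet s (cs[j := d])"
proof (cases "length s = length cs")
  case True
  then show ?thesis using assms
    by (simp add: idet_update_expand sum.distrib[symmetric] algebra_simps)
qed (simp add: idet_def)

lemma idet_update_scale:
  assumes "j < length cs"
  shows "idet s (cs[j := \<lambda>i. a * c i]) = a * idet s (cs[j := c])"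
proof (cases "length s = length cs")
  case True
  then show ?thesis using assms
    by (simp add: idet_update_expand sum_distrib_left algebra_simps)
qed (simp add: idet_def)

lemma idet_zero_col:
  assumes "j < length cs" "\<And>i. i \<in> set s \<Longrightarrow> (cs ! j) i = 0"
  shows "idet s cs = 0"
proof (cases "length s = length cs")
  case True
  then show ?thesis using assms by (subst idet_col_expand[of j]) auto
qed (simp add: idet_def)

lemma idet_zero_row:
  assumes "i \<in> set s" "\<And>c. c \<in> set cs \<Longrightarrow> c i = 0"
  shows "idet s cs = 0"
proof (cases "length s = length cs")
  case True
  obtain m where "m < length s" "s ! m = i" using assms(1) by (auto simp: in_set_conv_nth)
  then show ?thesis using True assms(2)[OF nth_mem] by (subst idet_row_expand[of m]) (auto intro!: sum.neutral)
qed (simp add: idet_def)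

lemma idet_equal_cols:
  assumes "i < length cs" "j < length cs" "i \<noteq> j" "cs ! i = cs ! j"
  shows "idet s cs = 0"
proof (cases "length s = length cs")
  case True
  then show ?thesis using assms
    by (auto simp: idet_def intro!: det_identical_columns[of _ "length cs" i j])
qed (simp add: idet_def)

lemma idet_not_distinct:
  assumes "\<not> distinct s"
  shows "idet s cs = 0"
proof (cases "length s = length cs")
  case True
  obtain i j where "i < length s" "j < length s" "i \<noteq> j" "s ! i = s ! j"
    using assms distinct_conv_nth by blast
  then show ?thesis using True
    by (auto simp: idet_def intro!: det_identical_rows[of _ "length cs" i j])
qed (simp add: idet_def)

lemma idet_swap_rows: "idet (p @ u # v # q) cs = - idet (p @ v # u # q) cs"
proof (cases "length (p @ u # v # q) = length cs")
  case True
  define n k where "n = length cs" and "k = length p"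
  define A where "A = mat n n (\<lambda>(i, j). (cs ! j) ((p @ v # u # q) ! i))"
  have k: "k < n" "Suc k < n" using True by (auto simp: n_def k_def)
  have "mat n n (\<lambda>(i, j). (cs ! j) ((p @ u # v # q) ! i)) = swaprows k (Suc k) A"
    using k by (intro eq_matI) (auto simp: A_def nth_append k_def nth_Cons' )
  moreover have "Determinant.det (swaprows k (Suc k) A) = - Determinant.det A"
    by (rule det_swaprows[of _ n]) (use k in \<open>auto simp: A_def\<close>)
  ultimately show ?thesis using True by (simp add: idet_def A_def n_def)
qed (simp add: idet_def)

text \<open>These are column operations. The list \<open>ds\<close> collects the columns already
  restored, so that the induction on \<open>es\<close> can move past each column it has
  treated.\<close>

lemma idet_sub_col:
  "idet s (c # ds @ map (\<lambda>d i. d i - c i) es) = idet s (c # ds @ es)"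
proof (induction es arbitrary: ds)
  case (Cons e es)
  let ?m = "map (\<lambda>d i. d i - c i) es"
  let ?cs = "c # ds @ e # ?m"
  let ?j = "Suc (length ds)"
  have "idet s (c # ds @ (\<lambda>i. e i - c i) # ?m) = idet s (?cs[?j := \<lambda>i. e i + (-1) * c i])"
    by (simp add: list_update_append)
  also have "\<dots> = idet s (?cs[?j := e]) + idet s (?cs[?j := \<lambda>i. (-1) * c i])"
    by (rule idet_update_add) simp
  also have "idet s (?cs[?j := \<lambda>i. (-1) * c i]) = (-1) * idet s (?cs[?j := c])"
    by (rule idet_update_scale) simp
  also have "idet s (?cs[?j := c]) = 0"
    by (rule idet_equal_cols[of 0 _ ?j]) (auto simp: list_update_append nth_append)
  also have "idet s (?cs[?j := e]) = idet s (c # (ds @ [e]) @ ?m)"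
    by (simp add: list_update_append)
  also have "\<dots> = idet s (c # ds @ e # es)"
    using Cons[of "ds @ [e]"] by simp
  finally show ?case by simp
qed simp

section \<open>Determinants with unit columns\<close>

definition unit_col :: "nat \<Rightarrow> nat \<Rightarrow> real" where
  "unit_col j i = (if i = j then 1 else 0)"

lemma idet_unit_cols_self:
  assumes "distinct s"
  shows "idet s (map unit_col s) = 1"
proof -
  have "mat (length s) (length s) (\<lambda>(i, j). (map unit_col s ! j) (s ! i)) = 1\<^sub>m (length s)"
    using assms by (intro eq_matI) (auto simp: unit_col_def nth_eq_iff_index_eq)
  then show ?thesis by (simp add: idet_def)
qed

lemma idet_unit_cols_neq:
  assumes "\<not> set t \<subseteq> set s"
  shows "idet s (map unit_col t) = 0"
proof -
  obtain j where "j < length t" "t ! j \<notin> set s" using assms unfolding subset_iff by (metis in_set_conv_nth)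
  then show ?thesis by (intro idet_zero_col[of j]) (auto simp: unit_col_def)
qed

text \<open>In row \<open>i\<close> only the leading column can be nonzero, since \<open>i\<close>
  does not occur in \<open>t\<close>. In the independence proof this isolates the factor
  \<lambda>_s.\<close>

lemma idet_cons_unit_cols:
  assumes "distinct (i # t)"
  shows "idet (i # t) (c # map unit_col t) = c i"
proof -
  have "idet (i # t) (c # map unit_col t) =
      (\<Sum>j<Suc (length t). (-1) ^ j * ((c # map unit_col t) ! j) i * idet t (omit j (c # map unit_col t)))"
    by (subst idet_laplace_row) auto
  also have "\<dots> = (\<Sum>j\<in>{0}. (-1) ^ j * ((c # map unit_col t) ! j) i * idet t (omit j (c # map unit_col t)))"
    using assms by (intro sum.mono_neutral_right) (auto simp: unit_col_def nth_Cons' split: if_splits)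
  also have "\<dots> = c i" using assms by (simp add: omit_Cons_0 idet_unit_cols_self)
  finally show ?thesis .
qed

text \<open>By linearity in the first row, the sum has the row (1, 0, ..., 0) there. With
  \<Sum>\<lambda>_i = 1 and \<Sum>d\<lambda>_i = 0 this writes a wedge product of the d\<lambda>_i
  as a sum of Whitney forms.\<close>

lemma idet_sum_first_row:
  assumes "finite I" "(\<Sum>i\<in>I. c i) = 1" "\<And>d. d \<in> set cs \<Longrightarrow> (\<Sum>i\<in>I. d i) = 0"
  shows "(\<Sum>i\<in>I. idet (i # t) (c # cs)) = idet t cs"
proof (cases "length cs = length t")
  case True
  have "(\<Sum>i\<in>I. idet (i # t) (c # cs)) =
      (\<Sum>i\<in>I. \<Sum>j<Suc (length t). (-1) ^ j * ((c # cs) ! j) i * idet t (omit j (c # cs)))"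
    using True by (subst idet_laplace_row) auto
  also have "\<dots> = (\<Sum>j<Suc (length t). (-1) ^ j * (\<Sum>i\<in>I. ((c # cs) ! j) i) * idet t (omit j (c # cs)))"
    by (subst sum.swap) (simp add: sum_distrib_left sum_distrib_right)
  also have "\<dots> = (\<Sum>j\<in>{0}. (-1) ^ j * (\<Sum>i\<in>I. ((c # cs) ! j) i) * idet t (omit j (c # cs)))"
    using True assms(3) by (intro sum.mono_neutral_right) (auto simp: nth_Cons')
  also have "\<dots> = idet t cs" using assms(2) by (simp add: omit_Cons_0)
  finally show ?thesis .
qed (simp add: idet_def)

lemma wedge_conv_idet:
  assumes "length vs = length s"
  shows "wedge (map l s) vs = idet s (map (\<lambda>v i. l i v) vs)"
proof -
  have "(\<Prod>i<length s. (map l s ! i) (vs ! p i)) =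
      (\<Prod>i<length s. mat (length s) (length s) (\<lambda>(i, j). (map (\<lambda>v i. l i v) vs ! j) (s ! i)) $$ (i, p i))"
    if "p permutes {..<length s}" for p
    using that assms by (intro prod.cong) (auto dest: permutes_in_image[of p _, THEN iffD2])
  then show ?thesis
    using assms
    by (simp add: wedge_def idet_def Determinant.det_def lessThan_atLeast0)
qed

text \<open>Insertion sort consists of adjacent transpositions, and these can be undone one at a
  time. This passes from increasing label lists to arbitrary ones without any bookkeeping of
  permutation signs.\<close>

lemma adjacent_swap_invariant_sort:
  fixes P :: "nat list \<Rightarrow> bool"
  assumes swap: "\<And>p u v q. P (p @ u # v # q) \<Longrightarrow> P (p @ v # u # q)"
  assumes "P (p @ sort xs)"
  shows "P (p @ xs)"
proof -
  \<comment> \<open>Undoes a single \<open>insort\<close>: \<open>x\<close> is carried back to the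
    front past each smaller entry.\<close>
  have ins: "P (p @ x # ys @ q)" if "P (p @ insort x ys @ q)" for p x ys q
    using that
  proof (induction ys arbitrary: p)
    case (Cons y ys)
    show ?case
    proof (cases "x \<le> y")
      case False
      then have "P ((p @ [y]) @ x # ys @ q)" using Cons.prems by (intro Cons.IH) simp
      then show ?thesis using swap[of p y x "ys @ q"] by simp
    qed (use Cons.prems in simp)
  qed simp
  show ?thesis using assms(2)
  proof (induction xs arbitrary: p)
    case (Cons x xs)
    have "P (p @ x # sort xs)" using ins[of p x "sort xs" "[]"] Cons.prems by simp
    then show ?case using Cons.IH[of "p @ [x]"] by simp
  qed simp
qed

section \<open>Alternating forms\<close>

lemma alt_form_length: "alt_form k a \<Longrightarrow> length vs \<noteq> k \<Longrightarrow> a vs = 0"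
  by (simp add: alt_form_def)

lemma alt_form_linear:
  assumes "alt_form k a" "length p + Suc (length q) = k"
  shows "linear (\<lambda>v. a (p @ v # q))"
proof -
  have "linear (\<lambda>v. a ((p @ undefined # q)[length p := v]))"
    using assms unfolding alt_form_def by (metis length_Cons length_append less_add_Suc1 add_Suc_right)
  then show ?thesis by simp
qed

lemma alt_form_not_distinct:
  assumes "alt_form k a" "\<not> distinct vs"
  shows "a vs = 0"
proof (cases "length vs = k")
  case True
  obtain i j where "i < length vs" "j < length vs" "i \<noteq> j" "vs ! i = vs ! j"
    using assms distinct_conv_nth by blast
  then obtain i j where "i < j" "j < length vs" "vs ! i = vs ! j"
    by (metis linorder_neqE_nat)
  then show ?thesis using assms True unfolding alt_form_def by blast
qed (use assms alt_form_length in auto)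

lemma alt_form_swap:
  assumes "alt_form k a"
  shows "a (p @ u # v # q) = - a (p @ v # u # q)"
proof (cases "length (p @ u # v # q) = k")
  case True
  have 1: "a (p @ (u + v) # w # q) = a (p @ u # w # q) + a (p @ v # w # q)" for w
    using linear_add[OF alt_form_linear[OF assms, of p "w # q"], of u v] True by simp
  have 2: "a (p @ w # (u + v) # q) = a (p @ w # u # q) + a (p @ w # v # q)" for w
    using linear_add[OF alt_form_linear[OF assms, of "p @ [w]" q], of u v] True by simp
  have 3: "a (p @ w # w # q) = 0" for w
    by (rule alt_form_not_distinct[OF assms]) simp
  show ?thesis using 1[of "u + v"] 2[of u] 2[of v] 3[of "u + v"] 3[of u] 3[of v] by simp
qed (use assms in \<open>simp add: alt_form_length\<close>)

lemma alt_form_add: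
  "alt_form k a \<Longrightarrow> alt_form k b \<Longrightarrow> alt_form k (\<lambda>vs. a vs + b vs)"
  unfolding alt_form_def by (auto intro: linear_compose_add)

lemma linear_mult_left: "linear f \<Longrightarrow> linear (\<lambda>v. (c::real) * f v)"
  using linear_compose_scale_right[of f c] by simp

lemma alt_form_scale:
  "alt_form k a \<Longrightarrow> alt_form k (\<lambda>vs. c * a vs)"
  unfolding alt_form_def by (auto intro: linear_mult_left)

lemma alt_form_zero: "alt_form k (\<lambda>vs. 0)"
  unfolding alt_form_def by (auto intro: linear_zero)

lemma alt_form_sum:
  assumes "\<And>i. i \<in> A \<Longrightarrow> alt_form k (f i)"
  shows "alt_form k (\<lambda>vs. \<Sum>i\<in>A. f i vs)"
  using assms
  by (induction A rule: infinite_finite_induct) (auto intro: alt_form_zero alt_form_add)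

text \<open>By multilinearity the arguments may be taken from the spanning vectors. A repeated label
  then gives zero, and distinct labels are brought into increasing order by swaps that only change
  the sign.\<close>

lemma alt_form_eq_zero:
  fixes J :: "nat set"
  assumes a: "alt_form k a" and span: "span (b ` J) = UNIV" and J: "finite J"
    and 0: "\<And>S. S \<subseteq> J \<Longrightarrow> card S = k \<Longrightarrow> a (map b (sorted_list_of_set S)) = 0"
  shows "a vs = 0"
proof -
  have base: "a (map b js) = 0" if js: "set js \<subseteq> J" for js :: "nat list"
  proof (cases "distinct js \<and> length js = k")
    case True
    have "a (map b ([] @ js)) = 0"
    proof (rule adjacent_swap_invariant_sort)
      have "sort js = sorted_list_of_set (set js)"
        using True sorted_list_of_set_sort_remdups[of js] by (simp add: distinct_remdups_id)
      then show "a (map b ([] @ sort js)) = 0"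
        using 0[of "set js"] True js by (simp add: distinct_card)
    next
      show "a (map b (p @ v # u # q)) = 0" if "a (map b (p @ u # v # q)) = 0" for p u v q
        using that alt_form_swap[OF a, of "map b p" "b v" "b u" "map b q"] by simp
    qed
    then show ?thesis by simp
  next
    case False
    then show ?thesis using alt_form_not_distinct[OF a, of "map b js"] alt_form_length[OF a, of "map b js"]
      by (auto simp: distinct_map)
  qed
  \<comment> \<open>The suffix \<open>js\<close> holds the arguments already replaced by spanning
    vectors; the last free argument is moved into it at each step.\<close>
  have "a (vs @ map b js) = 0" if "set js \<subseteq> J" "length vs + length js = k" for js vs
    using that
  proof (induction vs arbitrary: js rule: rev_induct)
    case (snoc v vs)
    have lin: "linear (\<lambda>v. a (vs @ v # map b js))"
      by (rule alt_form_linear[OF a]) (use snoc.prems in simp)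
    have "a (vs @ v # map b js) = 0"
    proof (rule linear_eq_0_on_span[OF lin])
      show "a (vs @ w # map b js) = 0" if "w \<in> b ` J" for w
        using that snoc.IH[of "_ # js"] snoc.prems by auto
    qed (use span in simp)
    then show ?case by simp
  qed (use base in simp)
  from this[of "[]" vs] show ?thesis using alt_form_length[OF a] by auto
qed

section \<open>Polynomials of bounded degree\<close>

lemma finite_exponents: "finite {a :: 'n::finite \<Rightarrow> nat. (\<Sum>i\<in>UNIV. a i) \<le> r}"
proof (rule finite_subset)
  show "{a :: 'n \<Rightarrow> nat. (\<Sum>i\<in>UNIV. a i) \<le> r} \<subseteq> UNIV \<rightarrow>\<^sub>E {..r}"
    by (auto simp: PiE_UNIV_domain intro: order_trans[OF member_le_sum[of _ UNIV]])
qed (auto intro: finite_PiE)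

lemma poly_deg_le_add:
  assumes "poly_deg_le r p" "poly_deg_le r q"
  shows "poly_deg_le r (\<lambda>x. p x + q x)"
proof -
  obtain c d where "\<And>x. p x = (\<Sum>a | (\<Sum>i\<in>UNIV. a i) \<le> r. c a * (\<Prod>i\<in>UNIV. (x $ i) ^ a i))"
    "\<And>x. q x = (\<Sum>a | (\<Sum>i\<in>UNIV. a i) \<le> r. d a * (\<Prod>i\<in>UNIV. (x $ i) ^ a i))"
    using assms unfolding poly_deg_le_def by blast
  then show ?thesis unfolding poly_deg_le_def
    by (intro exI[of _ "\<lambda>a. c a + d a"]) (simp add: sum.distrib algebra_simps)
qed

lemma poly_deg_le_scale:
  assumes "poly_deg_le r p"
  shows "poly_deg_le r (\<lambda>x. s * p x)"
proof -
  obtain c where "\<And>x. p x = (\<Sum>a | (\<Sum>i\<in>UNIV. a i) \<le> r. c a * (\<Prod>i\<in>UNIV. (x $ i) ^ a i))"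
    using assms unfolding poly_deg_le_def by blast
  then show ?thesis unfolding poly_deg_le_def
    by (intro exI[of _ "\<lambda>a. s * c a"]) (simp add: sum_distrib_left algebra_simps)
qed

lemma poly_deg_le_zero: "poly_deg_le r (\<lambda>x. 0)"
  unfolding poly_deg_le_def by (intro exI[of _ "\<lambda>a. 0"]) simp

lemma poly_deg_le_sum:
  assumes "\<And>i. i \<in> A \<Longrightarrow> poly_deg_le r (f i)"
  shows "poly_deg_le r (\<lambda>x. \<Sum>i\<in>A. f i x)"
  using assms
  by (induction A rule: infinite_finite_induct) (auto intro: poly_deg_le_zero poly_deg_le_add)

lemma poly_deg_le_monomial:
  assumes "(\<Sum>i\<in>UNIV. a i) \<le> r"
  shows "poly_deg_le r (\<lambda>x. \<Prod>i\<in>UNIV. (x $ i) ^ a i)"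
  unfolding poly_deg_le_def
proof (intro exI[of _ "\<lambda>b. if b = a then 1 else 0"] allI)
  fix x :: "real ^ 'a"
  show "(\<Prod>i\<in>UNIV. (x $ i) ^ a i) =
    (\<Sum>b | (\<Sum>i\<in>UNIV. b i) \<le> r. (if b = a then 1 else 0) * (\<Prod>i\<in>UNIV. (x $ i) ^ b i))"
    using assms by (simp add: finite_exponents if_distrib[of "\<lambda>z. z * _"] sum.delta' cong: if_cong)
qed

lemma poly_deg_le_const: "poly_deg_le r (\<lambda>x. c)"
  using poly_deg_le_scale[OF poly_deg_le_monomial[of "\<lambda>_. 0" r], of c] by simp

lemma poly_deg_le_mono:
  assumes "poly_deg_le r p" "r \<le> r'"
  shows "poly_deg_le r' p"
proof -
  obtain c where c: "p = (\<lambda>x. \<Sum>a | (\<Sum>i\<in>UNIV. a i) \<le> r. c a * (\<Prod>i\<in>UNIV. (x $ i) ^ a i))"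
    using assms unfolding poly_deg_le_def by blast
  show ?thesis unfolding c
    by (intro poly_deg_le_sum poly_deg_le_scale poly_deg_le_monomial) (use assms in auto)
qed

lemma poly_deg_le_coord_mult:
  assumes "poly_deg_le r p"
  shows "poly_deg_le (Suc r) (\<lambda>x. x $ l * p x)"
proof -
  obtain c where c: "\<And>x. p x = (\<Sum>a | (\<Sum>i\<in>UNIV. a i) \<le> r. c a * (\<Prod>i\<in>UNIV. (x $ i) ^ a i))"
    using assms unfolding poly_deg_le_def by blast
  have upd: "(\<Prod>i\<in>UNIV. (x $ i) ^ (a(l := Suc (a l))) i) = x $ l * (\<Prod>i\<in>UNIV. (x $ i) ^ a i)"
    for x :: "real ^ 'a" and a
    by (subst (1 2) prod.remove[of _ l]) (auto simp: algebra_simps intro!: prod.cong)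
  have deg: "(\<Sum>i\<in>UNIV. (a(l := Suc (a l))) i) = Suc (\<Sum>i\<in>UNIV. a i)" for a :: "'a \<Rightarrow> nat"
    by (subst (1 2) sum.remove[of _ l]) (auto intro!: sum.cong)
  have eq: "(\<lambda>x. x $ l * p x) =
    (\<lambda>x. \<Sum>a | (\<Sum>i\<in>UNIV. a i) \<le> r. c a * (\<Prod>i\<in>UNIV. (x $ i) ^ (a(l := Suc (a l))) i))"
    unfolding upd c by (simp add: sum_distrib_left algebra_simps)
  show ?thesis unfolding eq
    by (intro poly_deg_le_sum poly_deg_le_scale poly_deg_le_monomial)
      (use deg in \<open>simp del: fun_upd_apply\<close>)
qed

lemma linear_coord_expand:
  fixes l :: "real ^ 'n::finite \<Rightarrow> real"
  assumes "linear l"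
  shows "l x = (\<Sum>i\<in>UNIV. x $ i * l (axis i 1))"
proof -
  have "l x = l (\<Sum>i\<in>UNIV. x $ i *\<^sub>R axis i 1)"
    using basis_expansion[of x] by (simp add: scalar_mult_eq_scaleR)
  then show ?thesis using assms by (simp add: linear_sum linear_cmul)
qed

lemma poly_deg_le_affine_mult:
  assumes "poly_deg_le r p" "linear l"
  shows "poly_deg_le (Suc r) (\<lambda>x. (l x + c) * p x)"
proof -
  have eq: "(\<lambda>x. (l x + c) * p x) = (\<lambda>x. (\<Sum>i\<in>UNIV. l (axis i 1) * (x $ i * p x)) + c * p x)"
    by (subst linear_coord_expand[OF assms(2)]) (simp add: algebra_simps sum_distrib_left)
  show ?thesis unfolding eq using assms(1)
    by (intro poly_deg_le_add poly_deg_le_sum poly_deg_le_scale poly_deg_le_coord_mult)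
      (auto intro: poly_deg_le_mono)
qed

section \<open>Independence in homogeneous coordinates\<close>

definition multi_indices :: "nat \<Rightarrow> nat set \<Rightarrow> (nat \<Rightarrow> nat) set" where
  "multi_indices d I = {a. (\<forall>i. i \<notin> I \<longrightarrow> a i = 0) \<and> (\<Sum>i\<in>I. a i) = d}"

text \<open>The pairs \<open>(\<alpha>, \<sigma>)\<close> of the basis with support in the vertex set \<open>I\<close>; \<open>\<alpha>\<close> is extended by zero
  and the increasing map \<open>\<sigma>\<close> is replaced by its range.\<close>

definition whitney_indices :: "nat \<Rightarrow> nat \<Rightarrow> nat set \<Rightarrow> ((nat \<Rightarrow> nat) \<times> nat set) set" where
  "whitney_indices d k I =
     {(a, S). a \<in> multi_indices d I \<and> S \<subseteq> I \<and> card S = Suc k \<and> (\<forall>i<Min S. a i = 0)}"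

lemma finite_multi_indices:
  assumes "finite I"
  shows "finite (multi_indices d I)"
proof (rule inj_on_finite)
  show "inj_on (\<lambda>a. restrict a I) (multi_indices d I)"
  proof (rule inj_onI, rule ext)
    fix a b i
    assume "a \<in> multi_indices d I" "b \<in> multi_indices d I" "restrict a I = restrict b I"
    then show "a i = b i"
      by (cases "i \<in> I") (auto simp: multi_indices_def dest: fun_cong[of _ _ i])
  qed
  show "(\<lambda>a. restrict a I) ` multi_indices d I \<subseteq> I \<rightarrow>\<^sub>E {..d}"
    using assms by (auto simp: multi_indices_def intro: member_le_sum)
qed (use assms in \<open>auto intro: finite_PiE\<close>)

lemma finite_whitney_indices:
  assumes "finite I"
  shows "finite (whitney_indices d k I)"
  by (rule finite_subset[of _ "multi_indices d I \<times> Pow I"])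
    (use assms finite_multi_indices in \<open>auto simp: whitney_indices_def\<close>)

text \<open>One variable is removed at a time. With the others fixed, the sum is a univariate
  polynomial with infinitely many zeros, so each of its coefficients vanishes. Monomials are indexed
  by abstract labels with distinct exponents on \<open>J\<close>, a property that survives when only
  the labels with a given exponent of \<open>j\<close> are kept.\<close>

lemma monomials_independent:
  fixes c :: "'q \<Rightarrow> real" and e :: "'q \<Rightarrow> nat \<Rightarrow> nat"
  assumes "finite J" "finite A"
    and "\<And>q q'. q \<in> A \<Longrightarrow> q' \<in> A \<Longrightarrow> (\<And>i. i \<in> J \<Longrightarrow> e q i = e q' i) \<Longrightarrow> q = q'"
    and "\<And>t. (\<And>i. i \<in> J \<Longrightarrow> t i > 0) \<Longrightarrow> (\<Sum>q\<in>A. c q * (\<Prod>i\<in>J. t i ^ e q i)) = 0"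
    and "q \<in> A"
  shows "c q = 0"
  using assms
proof (induction J arbitrary: A q rule: finite_induct)
  case empty
  have "q' = q" if "q' \<in> A" for q'
    by (rule empty.prems(2)) (use that empty.prems(4) in auto)
  then have "A = {q}" using empty.prems(4) by blast
  then show ?case using empty.prems(3)[of "\<lambda>_. 1"] by simp
next
  case (insert j J)
  let ?A = "{q'\<in>A. e q' j = e q j}"
  show ?case
  proof (rule insert.IH[of ?A])
    show "q' = q''" if "q' \<in> ?A" "q'' \<in> ?A" "\<And>i. i \<in> J \<Longrightarrow> e q' i = e q'' i" for q' q''
      by (rule insert.prems(2)) (use that in auto)
    show "(\<Sum>q'\<in>?A. c q' * (\<Prod>i\<in>J. t i ^ e q' i)) = 0" if t: "\<And>i. i \<in> J \<Longrightarrow> t i > 0" for t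
    proof -
      \<comment> \<open>The sum as a polynomial in the variable \<open>j\<close> alone; its
        coefficient at \<open>e q j\<close> collects exactly the labels in
        \<open>?A\<close>.\<close>
      define p where "p = (\<Sum>q\<in>A. monom (c q * (\<Prod>i\<in>J. t i ^ e q i)) (e q j))"
      have "poly p u = 0" if "u > 0" for u
      proof -
        have "(\<Sum>q\<in>A. c q * (\<Prod>i\<in>insert j J. (t(j := u)) i ^ e q i)) = 0"
          by (rule insert.prems(3)) (use t that in auto)
        moreover have "(\<Prod>i\<in>insert j J. (t(j := u)) i ^ e q i) = u ^ e q j * (\<Prod>i\<in>J. t i ^ e q i)" for q
        proof -
          have "(\<Prod>i\<in>J. (t(j := u)) i ^ e q i) = (\<Prod>i\<in>J. t i ^ e q i)"
            using insert.hyps by (intro prod.cong) auto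
          then show ?thesis using insert.hyps by simp
        qed
        ultimately show ?thesis by (simp add: p_def poly_sum poly_monom algebra_simps)
      qed
      then have "{0<..} \<subseteq> {u. poly p u = 0}" by auto
      then have "infinite {u. poly p u = 0}"
        using infinite_Ioi[of "0::real"] finite_subset by blast
      then have "p = 0" using poly_roots_finite by blast
      then have "coeff p (e q j) = 0" by simp
      then show ?thesis using insert.prems(1)
        by (simp add: p_def coeff_sum sum.inter_filter)
    qed
  qed (use insert.prems in auto)
qed

text \<open>The purely algebraic core of independence: \<open>t\<close> stands for the barycentric
  coordinates of a point of a simplex with vertex set \<open>J\<close>, and \<open>js\<close> for
  the vertices toward which the evaluation vectors point.\<close>

lemma whitney_independent_unit_cols:
  fixes c :: "(nat \<Rightarrow> nat) \<times> nat set \<Rightarrow> real"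
  assumes J: "finite J"
    and sum0: "\<And>t js. (\<And>i. i \<in> J \<Longrightarrow> 0 \<le> t i) \<Longrightarrow> (\<Sum>i\<in>J. t i) = 1 \<Longrightarrow> set js \<subseteq> J \<Longrightarrow> length js = k \<Longrightarrow>
      (\<Sum>q\<in>whitney_indices d k J. c q *
        ((\<Prod>i\<in>J. t i ^ fst q i) * idet (sorted_list_of_set (snd q)) (t # map unit_col js))) = 0"
    and "q \<in> whitney_indices d k J"
  shows "c q = 0"
proof (rule ccontr)
  assume "c q \<noteq> 0"
  let ?W = "whitney_indices d k J"
  define F where "F q js t =
    c q * ((\<Prod>i\<in>J. t i ^ fst q i) * idet (sorted_list_of_set (snd q)) (t # map unit_col js))"
    for q js t
  note finW = finite_whitney_indices[OF J, of d k]
  have W: "S \<subseteq> J" "finite S" "card S = Suc k" "a \<in> multi_indices d J" "Min S \<in> S"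
    if "(a, S) \<in> ?W" for a S
  proof -
    show S: "S \<subseteq> J" "card S = Suc k" "a \<in> multi_indices d J"
      using that by (auto simp: whitney_indices_def)
    then show "finite S" using J finite_subset by blast
    then show "Min S \<in> S" using S by (intro Min_in) auto
  qed
  \<comment> \<open>Each term is homogeneous of degree d + 1 in \<open>t\<close>, d from the
    monomial and one from the leading column. Hence the identity extends from the standard simplex
    to all nonnegative \<open>t\<close>; at \<open>t = 0\<close> the leading column is zero.\<close>
  have hom: "(\<Sum>q\<in>?W. F q js t) = 0"
    if t: "\<And>i. i \<in> J \<Longrightarrow> 0 \<le> t i" and js: "set js \<subseteq> J" "length js = k" for t js
  proof (cases "(\<Sum>i\<in>J. t i) = 0")
    case True
    then have "t i = 0" if "i \<in> J" for i
      using sum_nonneg_eq_0_iff[OF J, of t] t that by auto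
    then have "idet (sorted_list_of_set (snd q)) (t # map unit_col js) = 0" if "q \<in> ?W" for q
      using that W(1,2)[of "fst q" "snd q"] by (intro idet_zero_col[of 0]) auto
    then have "F q js t = 0" if "q \<in> ?W" for q
      using that by (simp add: F_def)
    then show ?thesis by simp
  next
    case False
    define u where "u = (\<Sum>i\<in>J. t i)"
    have u: "u > 0" using False t sum_nonneg[of J t] by (auto simp: u_def less_le)
    have "(\<Sum>i\<in>J. inverse u * t i) = 1"
      using u by (simp only: sum_distrib_left[symmetric] u_def[symmetric]) simp
    then have "0 = (\<Sum>q\<in>?W. F q js (\<lambda>i. inverse u * t i))"
      unfolding F_def using t js u by (intro sum0[symmetric]) auto
    also have "\<dots> = (\<Sum>q\<in>?W. inverse u ^ Suc d * F q js t)"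
    proof (rule sum.cong[OF refl])
      fix q assume "q \<in> ?W"
      then have d: "(\<Sum>i\<in>J. fst q i) = d" by (auto simp: whitney_indices_def multi_indices_def)
      have "(\<Prod>i\<in>J. (inverse u * t i) ^ fst q i) = inverse u ^ d * (\<Prod>i\<in>J. t i ^ fst q i)"
        unfolding power_mult_distrib prod.distrib by (simp add: power_sum[symmetric] d)
      moreover have "idet s ((\<lambda>i. inverse u * t i) # map unit_col js) =
          inverse u * idet s (t # map unit_col js)" for s
        using idet_update_scale[of 0 "t # map unit_col js" s "inverse u" t] by simp
      ultimately show "F q js (\<lambda>i. inverse u * t i) = inverse u ^ Suc d * F q js t"
        by (simp add: F_def)
    qed
    also have "\<dots> = inverse u ^ Suc d * (\<Sum>q\<in>?W. F q js t)" by (simp add: sum_distrib_left)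
    finally show ?thesis using u by simp
  qed
  \<comment> \<open>Among the pairs with nonzero coefficient, one whose set has the least
    minimum.\<close>
  obtain q0 where q0: "q0 \<in> ?W" "c q0 \<noteq> 0"
    and min: "\<And>q. q \<in> ?W \<Longrightarrow> c q \<noteq> 0 \<Longrightarrow> Min (snd q0) \<le> Min (snd q)"
    using ex_has_least_nat[of "\<lambda>q. q \<in> ?W \<and> c q \<noteq> 0" q "\<lambda>q. Min (snd q)"] \<open>c q \<noteq> 0\<close> assms(3) by auto
  define S where "S = snd q0"
  define s where "s = Min S"
  define js where "js = sorted_list_of_set (S - {s})"
  have S: "S \<subseteq> J" "finite S" "card S = Suc k" "s \<in> S"
    using W[of "fst q0" "snd q0"] q0(1) by (auto simp: S_def s_def)
  have js: "set js \<subseteq> J" "length js = k" "distinct js" "s \<notin> set js" "set js = S - {s}"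
    using S by (auto simp: js_def)
  have "s # js = sorted_list_of_set S"
    unfolding js_def s_def by (rule sorted_list_of_set_nonempty[symmetric]) (use S in auto)
  then have FS: "F (a, S) js t = t s * (c (a, S) * (\<Prod>i\<in>J. t i ^ a i))" for a t
    using idet_cons_unit_cols[of s js t] js by (simp add: F_def)
  \<comment> \<open>The contribution of the sets other than \<open>S\<close>. It is shown to be
    unaffected by setting \<open>t s\<close> to 0.\<close>
  define G where "G t = (\<Sum>q | q \<in> ?W \<and> snd q \<noteq> S. F q js t)" for t
  have G: "G t = G (t(s := 0))" for t
    unfolding G_def
  proof (rule sum.cong[OF refl])
    fix q assume "q \<in> {q. q \<in> ?W \<and> snd q \<noteq> S}"
    then obtain a S' where q: "q = (a, S')" "(a, S') \<in> ?W" "S' \<noteq> S" by (cases q) auto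
    note S' = W[OF q(2)]
    have le: "s \<le> Min S'" if "c q \<noteq> 0" using min[of q] q that by (auto simp: s_def S_def)
    consider "c q = 0" | "c q \<noteq> 0" "s \<in> S'" | "c q \<noteq> 0" "s \<notin> S'" by blast
    then show "F q js t = F q js (t(s := 0))"
    proof cases
      case 2
      \<comment> \<open>Together with \<open>s\<close> the list \<open>js\<close> exhausts
        \<open>S\<close>, and \<open>S'\<close> has the same cardinality, so containing both would
        force \<open>S' = S\<close>.\<close>
      have "\<not> set js \<subseteq> S'"
      proof
        assume "set js \<subseteq> S'"
        then have "S \<subseteq> S'" using js(5) 2 by auto
        then show False using card_subset_eq[of S' S] S S' q by simp
      qed
      then obtain m where m: "m < length js" "js ! m \<notin> S'" unfolding subset_iff by (metis in_set_conv_nth)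
      have "idet (sorted_list_of_set S') (t' # map unit_col js) = 0" for t'
        by (rule idet_zero_col[of "Suc m"]) (use m S' in \<open>auto simp: unit_col_def\<close>)
      then show ?thesis by (simp add: F_def q)
    next
      case 3
      then have "s < Min S'" using le S'(5) by (metis le_neq_implies_less)
      then have "a s = 0" using q by (auto simp: whitney_indices_def)
      then have "(\<Prod>i\<in>J. t i ^ a i) = (\<Prod>i\<in>J. (t(s := 0)) i ^ a i)"
        by (intro prod.cong) auto
      moreover have "idet (sorted_list_of_set S') (t # map unit_col js) =
          idet (sorted_list_of_set S') (t(s := 0) # map unit_col js)"
        by (rule idet_cong) (use 3 S' in \<open>auto simp: nth_Cons'\<close>)
      ultimately show ?thesis by (simp add: F_def q)
    qed (simp add: F_def)
  qed
  define A where "A = {a. (a, S) \<in> ?W}"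
  have finA: "finite A" and A: "A \<subseteq> multi_indices d J"
    by (auto simp: A_def whitney_indices_def intro!: finite_subset[OF _ finite_multi_indices[OF J, of d]])
  define H where "H t = (\<Sum>a\<in>A. c (a, S) * (\<Prod>i\<in>J. t i ^ a i))" for t :: "nat \<Rightarrow> real"
  have split: "(\<Sum>q\<in>?W. F q js t) = t s * H t + G t" for t
  proof -
    have "(\<Sum>q\<in>?W. F q js t) = (\<Sum>q | q \<in> ?W \<and> snd q = S. F q js t) + G t"
      unfolding G_def using finW
      by (subst sum.union_disjoint[symmetric]) (auto intro!: sum.cong)
    also have "(\<Sum>q | q \<in> ?W \<and> snd q = S. F q js t) = (\<Sum>a\<in>A. F (a, S) js t)"
      by (rule sum.reindex_bij_witness[of _ "\<lambda>a. (a, S)" fst]) (auto simp: A_def)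
    finally show ?thesis by (simp add: FS H_def sum_distrib_left)
  qed
  have "c (fst q0, S) = 0"
  proof (rule monomials_independent[of J A id "\<lambda>a. c (a, S)" "fst q0"])
    show "a = a'" if "a \<in> A" "a' \<in> A" "\<And>i. i \<in> J \<Longrightarrow> id a i = id a' i" for a a'
    proof
      show "a i = a' i" for i
        using that subsetD[OF A, of a] subsetD[OF A, of a']
        by (cases "i \<in> J") (auto simp: multi_indices_def)
    qed
    show "(\<Sum>a\<in>A. c (a, S) * (\<Prod>i\<in>J. t i ^ id a i)) = 0" if t: "\<And>i. i \<in> J \<Longrightarrow> t i > 0" for t
    proof -
      \<comment> \<open>The identity is compared at \<open>t\<close> and at
        \<open>t(s := 0)\<close>. The two \<open>G\<close> parts coincide, which leaves
        \<open>t s * H t = 0\<close>, and \<open>t s\<close> is positive.\<close>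
      have "(\<Sum>q\<in>?W. F q js t) = 0"
        by (rule hom) (use t js in \<open>auto simp: less_imp_le\<close>)
      then have "t s * H t + G t = 0" unfolding split .
      moreover have "(\<Sum>q\<in>?W. F q js (t(s := 0))) = 0"
        by (rule hom) (use t js in \<open>auto simp: less_imp_le\<close>)
      then have "G (t(s := 0)) = 0" unfolding split by simp
      ultimately have "t s * H t = 0" using G[of t] by simp
      moreover have "t s > 0" using t S by auto
      ultimately show ?thesis by (simp add: H_def)
    qed
    show "fst q0 \<in> A" using q0 by (simp add: A_def S_def)
  qed (use J finA in auto)
  then show False using q0 by (simp add: S_def)
qed

section \<open>Whitney forms on one simplex\<close>

text \<open>The points \<open>X i\<close> form an affine basis of the whole space and
  \<open>lam\<close> are the coordinates in it. The simplex is represented only by its index set, so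
  all local arguments are about polynomial forms on the whole space.\<close>

locale barycentric_coords =
  fixes I :: "nat set" and X :: "nat \<Rightarrow> real ^ 'n::finite" and lam :: "nat \<Rightarrow> real ^ 'n \<Rightarrow> real"
  assumes finite_I: "finite I"
    and nonempty_I: "I \<noteq> {}"
    and affine_lam: "i \<in> I \<Longrightarrow> \<exists>l c. linear l \<and> lam i = (\<lambda>y. l y + c)"
    and lam_vertex: "i \<in> I \<Longrightarrow> j \<in> I \<Longrightarrow> lam i (X j) = (if i = j then 1 else 0)"
    and sum_lam: "(\<Sum>i\<in>I. lam i y) = 1"
    and sum_lam_vertex: "(\<Sum>i\<in>I. lam i y *\<^sub>R X i) = y"
begin

text \<open>The linear part of the affine function \<open>lam i\<close>, hence its derivative at
  every point. Writing it as a difference avoids choosing a decomposition.\<close>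

definition dl :: "nat \<Rightarrow> real ^ 'n \<Rightarrow> real" where
  "dl i v = lam i v - lam i 0"

definition dcol :: "real ^ 'n \<Rightarrow> nat \<Rightarrow> real" where
  "dcol v i = dl i v"

text \<open>The labels form an arbitrary list, neither increasing nor free of repetitions. Exchange
  relations can thus be stated before the labels are sorted.\<close>

definition phi :: "nat list \<Rightarrow> 'n diff_form" where
  "phi s y vs = idet s ((\<lambda>i. lam i y) # map dcol vs)"

definition mon :: "(nat \<Rightarrow> nat) \<Rightarrow> real ^ 'n \<Rightarrow> real" where
  "mon a y = (\<Prod>i\<in>I. lam i y ^ a i)"

lemma linear_dl: "i \<in> I \<Longrightarrow> linear (dl i)"
  using affine_lam[of i] by (auto simp: dl_def[abs_def] linear_0)

lemma dl_diff: "i \<in> I \<Longrightarrow> dl i (y - z) = lam i y - lam i z"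
  using linear_diff[OF linear_dl, of i y z] by (simp add: dl_def)

lemma dl_vertex_diff:
  "i \<in> I \<Longrightarrow> j \<in> I \<Longrightarrow> dl i (X j - y) = unit_col j i - lam i y"
  by (simp add: dl_diff lam_vertex unit_col_def)

lemma sum_dl: "(\<Sum>i\<in>I. dl i v) = 0"
  by (simp add: dl_def sum_subtractf sum_lam)

lemma sum_dl_vertex: "(\<Sum>i\<in>I. dl i v *\<^sub>R X i) = v"
  by (simp add: dl_def scaleR_diff_left sum_subtractf sum_lam_vertex)

lemma lam_combination:
  assumes "i \<in> I" "J \<subseteq> I" "(\<Sum>j\<in>J. t j) = 1"
  shows "lam i (\<Sum>j\<in>J. t j *\<^sub>R X j) = (if i \<in> J then t i else 0)"
proof -
  have J: "finite J" using assms(2) finite_I finite_subset by blast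
  obtain l c where l: "linear l" "lam i = (\<lambda>y. l y + c)" using affine_lam assms(1) by blast
  have "lam i (\<Sum>j\<in>J. t j *\<^sub>R X j) = (\<Sum>j\<in>J. t j * l (X j)) + (\<Sum>j\<in>J. t j) * c"
    using assms(3) by (simp add: l linear_sum linear_cmul)
  also have "\<dots> = (\<Sum>j\<in>J. t j * lam i (X j))"
    by (simp add: l sum.distrib sum_distrib_right distrib_left)
  also have "\<dots> = (\<Sum>j\<in>J. if j = i then t j else 0)"
    using assms by (intro sum.cong) (auto simp: lam_vertex)
  finally show ?thesis using J by simp
qed

text \<open>The column of \<open>X j - y\<close> is \<open>unit_col j\<close> minus the leading
  column, so column operations leave the unit column.\<close>

lemma phi_vertex_diff:
  assumes "set s \<subseteq> I" "set js \<subseteq> I"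
  shows "phi s y (map (\<lambda>j. X j - y) js) = idet s ((\<lambda>i. lam i y) # map unit_col js)"
proof -
  let ?c = "\<lambda>i. lam i y"
  have "phi s y (map (\<lambda>j. X j - y) js) = idet s (?c # [] @ map (\<lambda>d i. d i - ?c i) (map unit_col js))"
    unfolding phi_def
    by (rule idet_cong) (use assms in \<open>auto simp: nth_Cons dcol_def dl_vertex_diff subset_iff split: nat.split\<close>)
  also have "\<dots> = idet s (?c # [] @ map unit_col js)" by (rule idet_sub_col)
  finally show ?thesis by simp
qed

text \<open>Only points of the face on \<open>J\<close> and vectors tangent to it enter the
  hypothesis. The conclusion is therefore independence of traces, which is what the comparison of
  neighbouring simplices requires; \<open>J = I\<close> gives independence on the simplex
  itself.\<close>

lemma whitney_independent_on_face:
  assumes J: "J \<subseteq> I"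
    and sum0: "\<And>y js. y \<in> convex hull (X ` J) \<Longrightarrow> set js \<subseteq> J \<Longrightarrow> length js = k \<Longrightarrow>
      (\<Sum>q\<in>whitney_indices d k J. c q *
        (mon (fst q) y * phi (sorted_list_of_set (snd q)) y (map (\<lambda>j. X j - y) js))) = 0"
    and q: "q \<in> whitney_indices d k J"
  shows "c q = 0"
proof (rule whitney_independent_unit_cols[OF _ _ q])
  show finJ: "finite J" using J finite_I finite_subset by blast
  fix t :: "nat \<Rightarrow> real" and js :: "nat list"
  assume t: "\<And>i. i \<in> J \<Longrightarrow> 0 \<le> t i" "(\<Sum>i\<in>J. t i) = 1" and js: "set js \<subseteq> J" "length js = k"
  \<comment> \<open>The point of the face with coordinates \<open>t\<close> on \<open>J\<close>; its
    other coordinates are zero.\<close>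
  define y where "y = (\<Sum>j\<in>J. t j *\<^sub>R X j)"
  have lam: "lam i y = (if i \<in> J then t i else 0)" if "i \<in> I" for i
    unfolding y_def by (rule lam_combination[OF that J t(2)])
  have "y \<in> convex hull (X ` J)"
    unfolding y_def using finJ t by (intro convex_sum) (auto intro: hull_inc)
  then have "(\<Sum>q\<in>whitney_indices d k J. c q *
        (mon (fst q) y * phi (sorted_list_of_set (snd q)) y (map (\<lambda>j. X j - y) js))) = 0"
    by (rule sum0) (use js in auto)
  moreover have "mon (fst q) y * phi (sorted_list_of_set (snd q)) y (map (\<lambda>j. X j - y) js) =
      (\<Prod>i\<in>J. t i ^ fst q i) * idet (sorted_list_of_set (snd q)) (t # map unit_col js)"
    if "q \<in> whitney_indices d k J" for q
  proof -
    have S: "snd q \<subseteq> J" "finite (snd q)" and a: "\<And>i. i \<notin> J \<Longrightarrow> fst q i = 0"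
      using that finJ finite_subset by (auto simp: whitney_indices_def multi_indices_def)
    have "mon (fst q) y = (\<Prod>i\<in>J. lam i y ^ fst q i)"
      unfolding mon_def by (rule prod.mono_neutral_right) (use finite_I J a in auto)
    also have "\<dots> = (\<Prod>i\<in>J. t i ^ fst q i)"
      by (rule prod.cong) (use lam J in auto)
    finally have m: "mon (fst q) y = (\<Prod>i\<in>J. t i ^ fst q i)" .
    have "phi (sorted_list_of_set (snd q)) y (map (\<lambda>j. X j - y) js) =
        idet (sorted_list_of_set (snd q)) ((\<lambda>i. lam i y) # map unit_col js)"
      by (rule phi_vertex_diff) (use S J js in auto)
    also have "\<dots> = idet (sorted_list_of_set (snd q)) (t # map unit_col js)"
      by (rule idet_cong) (use S J lam in \<open>auto simp: nth_Cons subset_iff split: nat.split\<close>)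
    finally show ?thesis using m by simp
  qed
  ultimately show "(\<Sum>q\<in>whitney_indices d k J. c q * ((\<Prod>i\<in>J. t i ^ fst q i) *
      idet (sorted_list_of_set (snd q)) (t # map unit_col js))) = 0"
    by simp
qed

text \<open>The columns \<open>cs\<close> are frozen and only the remaining ones are arguments. The
  empty list gives wedge products of the d\<lambda>_i, a single column of values
  \<open>lam i y\<close> gives the Whitney form at \<open>y\<close>, and one of values
  \<open>lam i org\<close> the form frozen at the origin.\<close>

lemma alt_form_idet:
  assumes s: "set s \<subseteq> I" "length s = length cs + k"
  shows "alt_form k (\<lambda>vs. idet s (cs @ map dcol vs))"
  unfolding alt_form_def
proof (intro conjI allI impI)
  show "idet s (cs @ map dcol vs) = 0" if "length vs \<noteq> k" for vs
    using that s by (simp add: idet_def)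
  show "linear (\<lambda>v. idet s (cs @ map dcol (vs[i := v])))" if "length vs = k \<and> i < k" for vs i
  proof -
    let ?j = "length cs + i" and ?cs = "cs @ map dcol vs"
    have *: "idet s (cs @ map dcol (vs[i := v])) =
        (\<Sum>m<length s. (-1) ^ (m + ?j) * dl (s ! m) v * idet (omit m s) (omit ?j ?cs))" for v
      using idet_update_expand[of ?j ?cs s "dcol v"] that s
      by (simp add: map_update list_update_append dcol_def)
    have "linear (\<lambda>v. \<Sum>m<length s. ((-1) ^ (m + ?j) * idet (omit m s) (omit ?j ?cs)) * dl (s ! m) v)"
      by (intro linear_compose_sum ballI linear_mult_left linear_dl) (use s in auto)
    then show ?thesis unfolding * by (simp add: mult_ac)
  qed
  show "idet s (cs @ map dcol vs) = 0"
    if "length vs = k \<and> i < j \<and> j < k \<and> vs ! i = vs ! j" for vs i j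
    by (rule idet_equal_cols[of "length cs + i" _ "length cs + j"])
      (use that in \<open>auto simp: nth_append\<close>)
qed

lemma alt_form_phi:
  assumes "set s \<subseteq> I" "length s = Suc k"
  shows "alt_form k (phi s y)"
  using alt_form_idet[of s "[\<lambda>i. lam i y]" k] assms by (simp add: phi_def[abs_def])

lemma poly_deg_le_lam_mult:
  assumes "i \<in> I" "poly_deg_le r p"
  shows "poly_deg_le (Suc r) (\<lambda>y. lam i y * p y)"
proof -
  obtain l c where l: "linear l" "lam i = (\<lambda>y. l y + c)" using affine_lam assms(1) by blast
  show ?thesis unfolding l(2) by (rule poly_deg_le_affine_mult[OF assms(2) l(1)])
qed

lemma poly_deg_le_mon: "poly_deg_le (\<Sum>i\<in>I. a i) (mon a)"
proof -
  have pow: "poly_deg_le (m + r) (\<lambda>y. lam i y ^ m * p y)" if "i \<in> I" "poly_deg_le r p" for i m r p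
    by (induction m) (use that in \<open>auto simp: mult.assoc intro: poly_deg_le_lam_mult\<close>)
  have "poly_deg_le (\<Sum>i\<in>A. a i) (\<lambda>y. \<Prod>i\<in>A. lam i y ^ a i)" if "A \<subseteq> I" for A
    using finite_subset[OF that finite_I] that
    by (induction A rule: finite_induct) (auto intro: poly_deg_le_const pow)
  then show ?thesis by (simp add: mon_def[abs_def])
qed

text \<open>The leading column is split as \<lambda>(y) = \<lambda>(org) + d\<lambda>(y - org). The
  first part yields a polynomial form of degree r - 1, the second the Koszul image of the monomial
  times the wedge product of all d\<lambda>_i with i in \<open>s\<close>.\<close>

lemma mon_phi_in_trimmed_forms:
  assumes "(\<Sum>i\<in>I. a i) = r - 1" "set s \<subseteq> I" "length s = Suc k"
  shows "(\<lambda>y vs. mon a y * phi s y vs) \<in> trimmed_forms org r k"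
proof -
  define \<eta> where "\<eta> y vs = mon a y * idet s (map dcol vs)" for y vs
  define \<omega> where "\<omega> y vs = mon a y * idet s ((\<lambda>i. lam i org) # map dcol vs)" for y vs
  have deg: "poly_deg_le (r - 1) (\<lambda>y. mon a y * c)" for c
    using poly_deg_le_scale[OF poly_deg_le_mon[of a], of c] assms(1) by (simp add: mult.commute)
  have "\<eta> \<in> poly_forms (r - 1) (k + 1)"
    using alt_form_scale[OF alt_form_idet[of s "[]" "k + 1"]] assms
    by (simp add: poly_forms_def \<eta>_def[abs_def] deg del: One_nat_def)
  moreover have "\<omega> \<in> poly_forms (r - 1) k"
    using alt_form_scale[OF alt_form_idet[of s "[\<lambda>i. lam i org]" k]] assms
    by (simp add: poly_forms_def \<omega>_def[abs_def] deg del: One_nat_def)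
  moreover have "phi s y vs = idet s ((\<lambda>i. lam i org) # map dcol vs) + idet s (map dcol ((y - org) # vs))" for y vs
  proof -
    have "phi s y vs = idet s ((\<lambda>i. lam i org + dcol (y - org) i) # map dcol vs)"
      unfolding phi_def by (rule idet_cong)
        (use assms in \<open>auto simp: nth_Cons dcol_def dl_diff subset_iff split: nat.split\<close>)
    also have "\<dots> = idet s ((\<lambda>i. lam i org) # map dcol vs) + idet s (dcol (y - org) # map dcol vs)"
      using idet_update_add[of 0 "(\<lambda>i. lam i org) # map dcol vs" s "\<lambda>i. lam i org" "dcol (y - org)"]
      by simp
    finally show ?thesis by simp
  qed
  ultimately show ?thesis
    unfolding trimmed_forms_def koszul_def
    by (intro CollectI exI[of _ \<omega>] exI[of _ \<eta>]) (auto simp: \<omega>_def \<eta>_def algebra_simps)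
qed

subsection \<open>Spanning\<close>

text \<open>Homogeneity refers to the barycentric coordinates, not to the cartesian ones. Since the
  former sum to 1, these functions are all polynomials of degree at most \<open>d\<close>.\<close>

definition hom_poly :: "nat \<Rightarrow> (real ^ 'n \<Rightarrow> real) \<Rightarrow> bool" where
  "hom_poly d p \<longleftrightarrow> (\<exists>c. \<forall>y. p y = (\<Sum>a\<in>multi_indices d I. c a * mon a y))"

lemma hom_poly_add: "hom_poly d p \<Longrightarrow> hom_poly d q \<Longrightarrow> hom_poly d (\<lambda>y. p y + q y)"
  unfolding hom_poly_def
proof (elim exE)
  fix c c' assume "\<forall>y. p y = (\<Sum>a\<in>multi_indices d I. c a * mon a y)"
    "\<forall>y. q y = (\<Sum>a\<in>multi_indices d I. c' a * mon a y)"
  then show "\<exists>c. \<forall>y. p y + q y = (\<Sum>a\<in>multi_indices d I. c a * mon a y)"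
    by (intro exI[of _ "\<lambda>a. c a + c' a"]) (simp add: algebra_simps sum.distrib)
qed

lemma hom_poly_scale: "hom_poly d p \<Longrightarrow> hom_poly d (\<lambda>y. s * p y)"
  unfolding hom_poly_def
proof (elim exE)
  fix c assume "\<forall>y. p y = (\<Sum>a\<in>multi_indices d I. c a * mon a y)"
  then show "\<exists>c. \<forall>y. s * p y = (\<Sum>a\<in>multi_indices d I. c a * mon a y)"
    by (intro exI[of _ "\<lambda>a. s * c a"]) (simp add: sum_distrib_left mult.assoc)
qed

lemma hom_poly_zero: "hom_poly d (\<lambda>y. 0)"
  unfolding hom_poly_def by (intro exI[of _ "\<lambda>_. 0"]) simp

lemma hom_poly_sum:
  "(\<And>i. i \<in> A \<Longrightarrow> hom_poly d (f i)) \<Longrightarrow> hom_poly d (\<lambda>y. \<Sum>i\<in>A. f i y)"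
  by (induction A rule: infinite_finite_induct) (auto intro: hom_poly_add hom_poly_zero)

lemma hom_poly_mon: "a \<in> multi_indices d I \<Longrightarrow> hom_poly d (mon a)"
  unfolding hom_poly_def using finite_multi_indices[OF finite_I, of d]
  by (intro exI[of _ "\<lambda>b. if b = a then 1 else 0"]) (simp add: if_distrib[of "\<lambda>z. z * _"] cong: if_cong)

lemma mon_upd_Suc: "i \<in> I \<Longrightarrow> mon (a(i := Suc (a i))) y = lam i y * mon a y"
proof -
  assume i: "i \<in> I"
  have "(\<Prod>j\<in>I - {i}. lam j y ^ (a(i := Suc (a i))) j) = (\<Prod>j\<in>I - {i}. lam j y ^ a j)"
    by (rule prod.cong) auto
  then show ?thesis
    using i finite_I by (simp add: mon_def prod.remove[of I i] mult.assoc)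
qed

lemma multi_indices_upd_Suc:
  assumes "i \<in> I" "a \<in> multi_indices d I"
  shows "a(i := Suc (a i)) \<in> multi_indices (Suc d) I"
proof -
  have "(\<Sum>j\<in>I - {i}. (a(i := Suc (a i))) j) = (\<Sum>j\<in>I - {i}. a j)"
    by (rule sum.cong) auto
  then show ?thesis
    using assms finite_I by (auto simp: multi_indices_def sum.remove[of I i])
qed

lemma hom_poly_lam_mult:
  assumes "i \<in> I" "hom_poly d p"
  shows "hom_poly (Suc d) (\<lambda>y. lam i y * p y)"
proof -
  obtain c where c: "\<And>y. p y = (\<Sum>a\<in>multi_indices d I. c a * mon a y)"
    using assms(2) unfolding hom_poly_def by blast
  have eq: "(\<lambda>y. lam i y * p y) = (\<lambda>y. \<Sum>a\<in>multi_indices d I. c a * mon (a(i := Suc (a i))) y)"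
    unfolding c mon_upd_Suc[OF assms(1)] by (simp add: sum_distrib_left algebra_simps)
  show ?thesis unfolding eq
    by (intro hom_poly_sum hom_poly_scale hom_poly_mon multi_indices_upd_Suc assms(1))
qed

lemma hom_poly_coord_mult:
  assumes "hom_poly d p"
  shows "hom_poly (Suc d) (\<lambda>y. y $ l * p y)"
proof -
  have eq: "(\<lambda>y. y $ l * p y) = (\<lambda>y. \<Sum>i\<in>I. X i $ l * (lam i y * p y))"
  proof
    fix y
    have "y $ l = (\<Sum>i\<in>I. lam i y * X i $ l)"
      by (subst sum_lam_vertex[of y, symmetric]) (simp add: sum_component)
    then show "y $ l * p y = (\<Sum>i\<in>I. X i $ l * (lam i y * p y))"
      by (simp add: sum_distrib_left sum_distrib_right mult_ac)
  qed
  show ?thesis unfolding eq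
    by (intro hom_poly_sum hom_poly_scale hom_poly_lam_mult assms)
qed

text \<open>Multiplication by 1 = \<Sum>\<lambda>_i raises the homogeneous degree without changing
  the function.\<close>

lemma hom_poly_Suc:
  assumes "hom_poly d p"
  shows "hom_poly (Suc d) p"
proof -
  have eq: "p = (\<lambda>y. \<Sum>i\<in>I. lam i y * p y)"
    by (simp add: sum_distrib_right[symmetric] sum_lam)
  show ?thesis by (subst eq) (intro hom_poly_sum hom_poly_lam_mult assms)
qed

lemma hom_poly_mono: "hom_poly d p \<Longrightarrow> d \<le> d' \<Longrightarrow> hom_poly d' p"
  by (induction d') (auto simp: le_Suc_eq intro: hom_poly_Suc)

lemma poly_deg_le_imp_hom_poly:
  assumes "poly_deg_le d p"
  shows "hom_poly d p"
proof -
  have one: "hom_poly 0 (\<lambda>y. 1)"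
  proof -
    have "mon (\<lambda>_. 0) = (\<lambda>y. 1)" by (simp add: mon_def[abs_def])
    then show ?thesis using hom_poly_mon[of "\<lambda>_. 0" 0] by (simp add: multi_indices_def)
  qed
  have pow: "hom_poly (m + r) (\<lambda>y. y $ l ^ m * p y)" if "hom_poly r p" for l m r p
    by (induction m) (use that in \<open>auto simp: mult.assoc intro: hom_poly_coord_mult\<close>)
  have "hom_poly (\<Sum>l\<in>L. a l) (\<lambda>y. \<Prod>l\<in>L. (y $ l) ^ a l)" for L and a :: "'n \<Rightarrow> nat"
    using finite[of L] by (induction L rule: finite_induct) (auto intro: one pow)
  then have m: "hom_poly d (\<lambda>y. \<Prod>l\<in>UNIV. (y $ l) ^ a l)" if "(\<Sum>l\<in>UNIV. a l) \<le> d" for a :: "'n \<Rightarrow> nat"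
    using hom_poly_mono that by blast
  obtain c where c: "p = (\<lambda>x. \<Sum>a | (\<Sum>i\<in>UNIV. a i) \<le> d. c a * (\<Prod>i\<in>UNIV. (x $ i) ^ a i))"
    using assms unfolding poly_deg_le_def by blast
  show ?thesis unfolding c by (intro hom_poly_sum hom_poly_scale m) auto
qed

text \<open>Described by explicit coefficients, because the global argument has to compare the
  coefficients from one simplex to another.\<close>

definition whitney_span :: "nat \<Rightarrow> nat \<Rightarrow> 'n diff_form set" where
  "whitney_span d k = {\<omega>. \<exists>c. \<forall>y vs. \<omega> y vs =
     (\<Sum>q\<in>whitney_indices d k I. c q * (mon (fst q) y * phi (sorted_list_of_set (snd q)) y vs))}"

lemma whitney_span_add:
  assumes "\<omega> \<in> whitney_span d k" "\<eta> \<in> whitney_span d k"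
  shows "(\<lambda>y vs. \<omega> y vs + \<eta> y vs) \<in> whitney_span d k"
proof -
  obtain c c' where
    "\<And>y vs. \<omega> y vs = (\<Sum>q\<in>whitney_indices d k I. c q * (mon (fst q) y * phi (sorted_list_of_set (snd q)) y vs))"
    "\<And>y vs. \<eta> y vs = (\<Sum>q\<in>whitney_indices d k I. c' q * (mon (fst q) y * phi (sorted_list_of_set (snd q)) y vs))"
    using assms unfolding whitney_span_def by blast
  then show ?thesis unfolding whitney_span_def
    by (intro CollectI exI[of _ "\<lambda>q. c q + c' q"]) (simp add: algebra_simps sum.distrib)
qed

lemma whitney_span_scale:
  assumes "\<omega> \<in> whitney_span d k"
  shows "(\<lambda>y vs. s * \<omega> y vs) \<in> whitney_span d k"
proof -
  obtain c where
    "\<And>y vs. \<omega> y vs = (\<Sum>q\<in>whitney_indices d k I. c q * (mon (fst q) y * phi (sorted_list_of_set (snd q)) y vs))"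
    using assms unfolding whitney_span_def by blast
  then show ?thesis unfolding whitney_span_def
    by (intro CollectI exI[of _ "\<lambda>q. s * c q"]) (simp add: sum_distrib_left mult.assoc)
qed

lemma whitney_span_zero: "(\<lambda>y vs. 0) \<in> whitney_span d k"
  unfolding whitney_span_def by (intro CollectI exI[of _ "\<lambda>_. 0"]) simp

lemma whitney_span_sum:
  "(\<And>i. i \<in> A \<Longrightarrow> f i \<in> whitney_span d k) \<Longrightarrow> (\<lambda>y vs. \<Sum>i\<in>A. f i y vs) \<in> whitney_span d k"
  by (induction A rule: infinite_finite_induct) (auto intro: whitney_span_add whitney_span_zero)

lemma whitney_span_base:
  assumes "(a, S) \<in> whitney_indices d k I"
  shows "(\<lambda>y vs. mon a y * phi (sorted_list_of_set S) y vs) \<in> whitney_span d k"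
  unfolding whitney_span_def using finite_whitney_indices[OF finite_I, of d k] assms
  by (intro CollectI exI[of _ "\<lambda>q. if q = (a, S) then 1 else 0"])
    (simp add: if_distrib[of "\<lambda>z. z * _"] cong: if_cong)

lemma phi_length: "length s \<noteq> Suc (length vs) \<Longrightarrow> phi s y vs = 0"
  by (simp add: phi_def idet_def)

text \<open>The matrix with the column of barycentric coordinates repeated is singular; expanding its
  determinant gives the linear relation between the forms \<open>\<lambda>\<^sub>j \<phi>\<^sub>\<sigma>\<close>.\<close>

lemma lam_phi_relation:
  assumes "length s = Suc k"
  shows "lam i y * phi s y vs =
    (\<Sum>j<Suc k. (-1) ^ j * (lam (s ! j) y * phi (i # omit j s) y vs))"
proof (cases "length vs = k")
  case True
  let ?c = "\<lambda>i. lam i y"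
  have "0 = idet (i # s) (?c # ?c # map dcol vs)"
    by (rule idet_equal_cols[of 0 _ 1, symmetric]) auto
  also have "\<dots> = (\<Sum>j<Suc (Suc k). (-1) ^ j * ?c ((i # s) ! j) * phi (omit j (i # s)) y vs)"
    unfolding phi_def by (subst idet_laplace_col) (use assms True in auto)
  also have "\<dots> = lam i y * phi s y vs
      - (\<Sum>j<Suc k. (-1) ^ j * (lam (s ! j) y * phi (i # omit j s) y vs))"
    by (subst sum.lessThan_Suc_shift) (simp add: omit_Cons_0 omit_Cons_Suc sum_negf algebra_simps)
  finally show ?thesis by simp
next
  case False
  then show ?thesis using assms by (simp add: phi_length length_omit)
qed

text \<open>A single exchange suffices, with no recursion. If \<open>i\<close> is the least index in
  the support of \<open>a\<close> and lies below \<open>Min S\<close>, one factor \<lambda>_i is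
  traded by the linear relation. Every resulting set contains \<open>i\<close> as its minimum, and
  the new exponents still vanish below \<open>i\<close>.\<close>

lemma mon_phi_in_whitney_span:
  assumes a: "a \<in> multi_indices d I" and S: "S \<subseteq> I" "card S = Suc k"
  shows "(\<lambda>y vs. mon a y * phi (sorted_list_of_set S) y vs) \<in> whitney_span d k"
proof (cases "\<forall>i<Min S. a i = 0")
  case True
  then show ?thesis using assms by (intro whitney_span_base) (auto simp: whitney_indices_def)
next
  case False
  have fS: "finite S" using S finite_I finite_subset by blast
  have neS: "S \<noteq> {}" using S by auto
  define i where "i = (LEAST i. a i > 0)"
  have i: "a i > 0" unfolding i_def by (rule LeastI_ex) (use False in auto)
  have least: "a j = 0" if "j < i" for j using that not_less_Least[of j "\<lambda>i. a i > 0"] by (auto simp: i_def)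
  have iI: "i \<in> I" using i a by (auto simp: multi_indices_def)
  have iS: "i < Min S" using False least by (metis linorder_neqE_nat less_trans)
  then have iS': "i < j" if "j \<in> S" for j using fS that by (meson Min_le less_le_trans)
  \<comment> \<open>The monomial with the factor \<lambda>_i removed; each exchanged term supplies a
    factor \<lambda> with label \<open>s ! j\<close> instead, which restores degree d.\<close>
  define b where "b = a(i := a i - 1)"
  define s where "s = sorted_list_of_set S"
  have s: "length s = Suc k" "set s = S" "distinct s" "sorted s" using fS S by (auto simp: s_def)
  have b: "b(i := Suc (b i)) = a" using i by (auto simp: b_def)
  have bI: "b \<in> multi_indices (d - 1) I" and d: "d > 0"
  proof -
    have "(\<Sum>j\<in>I - {i}. b j) = (\<Sum>j\<in>I - {i}. a j)" by (rule sum.cong) (auto simp: b_def)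
    then show "b \<in> multi_indices (d - 1) I" "d > 0"
      using a i iI finite_I by (auto simp: multi_indices_def sum.remove[of I i] b_def)
  qed
  have exchange: "(\<lambda>y vs. mon (b(s ! j := Suc (b (s ! j)))) y * phi (i # omit j s) y vs) \<in> whitney_span d k"
    if j: "j < Suc k" for j
  proof -
    let ?b = "b(s ! j := Suc (b (s ! j)))"
    let ?S = "insert i (S - {s ! j})"
    have sj: "s ! j \<in> S" using j s nth_mem by metis
    have "set (omit j s) = S - {s ! j}" "distinct (omit j s)" "sorted (omit j s)"
    proof -
      have sp: "s = take j s @ s ! j # drop (Suc j) s" using j s by (simp add: id_take_nth_drop)
      have "distinct (take j s @ s ! j # drop (Suc j) s)" using s sp by metis
      moreover have "sorted (take j s @ s ! j # drop (Suc j) s)" using s sp by metis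
      moreover have "S = set (take j s @ s ! j # drop (Suc j) s)" using s sp by metis
      ultimately show "set (omit j s) = S - {s ! j}" "distinct (omit j s)" "sorted (omit j s)"
        by (auto simp: omit_def sorted_append)
    qed
    then have "sorted (i # omit j s)" "distinct (i # omit j s)" "set (i # omit j s) = ?S"
      using iS' by (auto intro: less_imp_le)
    then have list: "i # omit j s = sorted_list_of_set ?S"
      by (metis sorted_list_of_set.idem_if_sorted_distinct)
    have "(?b, ?S) \<in> whitney_indices d k I"
    proof -
      have "Min ?S = i" by (rule Min_eqI) (use fS iS' in \<open>auto intro: less_imp_le\<close>)
      moreover have "card ?S = Suc k" using sj fS S iS' by (auto simp: card_insert_if)
      moreover have "?b \<in> multi_indices d I"
        using multi_indices_upd_Suc[OF _ bI, of "s ! j"] d sj S by auto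
      moreover have "?b m = 0" if "m < i" for m using that least[of m] iS'[OF sj] by (auto simp: b_def)
      ultimately show ?thesis using iI S by (auto simp: whitney_indices_def)
    qed
    then show ?thesis unfolding list by (rule whitney_span_base)
  qed
  have eq: "(\<lambda>y vs. mon a y * phi s y vs) = (\<lambda>y vs. \<Sum>j<Suc k. (-1) ^ j *
      (mon (b(s ! j := Suc (b (s ! j)))) y * phi (i # omit j s) y vs))"
  proof (intro ext)
    fix y vs
    have "mon a y * phi s y vs = mon b y * (lam i y * phi s y vs)"
      using mon_upd_Suc[OF iI, of b y] b by simp
    also have "\<dots> = (\<Sum>j<Suc k. (-1) ^ j * ((lam (s ! j) y * mon b y) * phi (i # omit j s) y vs))"
      by (subst lam_phi_relation[OF s(1)]) (simp add: sum_distrib_left algebra_simps)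
    also have "\<dots> = (\<Sum>j<Suc k. (-1) ^ j *
      (mon (b(s ! j := Suc (b (s ! j)))) y * phi (i # omit j s) y vs))"
    proof (rule sum.cong[OF refl])
      fix j assume "j \<in> {..<Suc k}"
      then have "s ! j \<in> I" using s S nth_mem by (metis lessThan_iff subsetD)
      then show "(-1) ^ j * ((lam (s ! j) y * mon b y) * phi (i # omit j s) y vs) =
          (-1) ^ j * (mon (b(s ! j := Suc (b (s ! j)))) y * phi (i # omit j s) y vs)"
        by (simp only: mon_upd_Suc)
    qed
    finally show "mon a y * phi s y vs = (\<Sum>j<Suc k. (-1) ^ j *
      (mon (b(s ! j := Suc (b (s ! j)))) y * phi (i # omit j s) y vs))" .
  qed
  show ?thesis unfolding s_def[symmetric] eq
    by (intro whitney_span_sum whitney_span_scale exchange) auto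
qed

text \<open>Repeated labels give zero and distinct ones are sorted up to sign; after that the
  polynomial is expanded into barycentric monomials of degree \<open>d\<close>.\<close>

lemma poly_phi_in_whitney_span:
  assumes p: "poly_deg_le d p" and s: "set s \<subseteq> I" "length s = Suc k"
  shows "(\<lambda>y vs. p y * phi s y vs) \<in> whitney_span d k"
proof (cases "distinct s")
  case True
  obtain c where c: "\<And>y. p y = (\<Sum>a\<in>multi_indices d I. c a * mon a y)"
    using poly_deg_le_imp_hom_poly[OF p] unfolding hom_poly_def by blast
  have "(\<lambda>y vs. p y * phi (sorted_list_of_set (set s)) y vs) =
      (\<lambda>y vs. \<Sum>a\<in>multi_indices d I. c a * (mon a y * phi (sorted_list_of_set (set s)) y vs))"
    by (simp add: c sum_distrib_right mult.assoc)
  also have "\<dots> \<in> whitney_span d k"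
    by (intro whitney_span_sum whitney_span_scale mon_phi_in_whitney_span)
      (use s True in \<open>auto simp: distinct_card\<close>)
  finally have "(\<lambda>y vs. p y * phi ([] @ sort s) y vs) \<in> whitney_span d k"
    using True sorted_list_of_set_sort_remdups[of s] by (simp add: distinct_remdups_id)
  then have "(\<lambda>y vs. p y * phi ([] @ s) y vs) \<in> whitney_span d k"
  proof (rule adjacent_swap_invariant_sort[rotated])
    fix q u v q'
    assume "(\<lambda>y vs. p y * phi (q @ u # v # q') y vs) \<in> whitney_span d k"
    from whitney_span_scale[OF this, of "-1"]
    show "(\<lambda>y vs. p y * phi (q @ v # u # q') y vs) \<in> whitney_span d k"
      by (simp add: phi_def idet_swap_rows[of q v u])
  qed
  then show ?thesis by simp
next
  case False
  then show ?thesis by (simp add: phi_def idet_not_distinct whitney_span_zero)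
qed

text \<open>The wedge product is the sum of the Whitney forms with one further label prepended, by
  \<Sum>\<lambda>_i = 1 and \<Sum>d\<lambda>_i = 0. The degree of the coefficient does not
  grow.\<close>

lemma poly_wedge_in_whitney_span:
  assumes p: "poly_deg_le d p" and s: "set s \<subseteq> I" "length s = k"
  shows "(\<lambda>y vs. p y * idet s (map dcol vs)) \<in> whitney_span d k"
proof -
  have eq: "(\<lambda>y vs. p y * idet s (map dcol vs)) = (\<lambda>y vs. \<Sum>i\<in>I. p y * phi (i # s) y vs)"
  proof (intro ext)
    fix y vs
    have "(\<Sum>i\<in>I. phi (i # s) y vs) = idet s (map dcol vs)"
      unfolding phi_def by (rule idet_sum_first_row)
        (auto simp: finite_I sum_lam dcol_def sum_dl)
    then show "p y * idet s (map dcol vs) = (\<Sum>i\<in>I. p y * phi (i # s) y vs)"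
      by (simp add: sum_distrib_left[symmetric])
  qed
  show ?thesis unfolding eq
    by (intro whitney_span_sum poly_phi_in_whitney_span p) (use s in auto)
qed

text \<open>The d\<lambda>_j with j other than \<open>i0\<close> are the dual basis of the edge
  vectors at \<open>i0\<close>. The difference of both sides is alternating and vanishes on
  increasing lists of edge vectors.\<close>

lemma alt_form_expand:
  assumes a: "alt_form k a" and i0: "i0 \<in> I"
  shows "a vs = (\<Sum>S | S \<subseteq> I - {i0} \<and> card S = k.
    a (map (\<lambda>j. X j - X i0) (sorted_list_of_set S)) * idet (sorted_list_of_set S) (map dcol vs))"
proof -
  define J where "J = I - {i0}"
  define b where "b j = X j - X i0" for j
  have J: "finite J" "J \<subseteq> I" using finite_I by (auto simp: J_def)
  have fin: "finite {S. S \<subseteq> J \<and> card S = k}" using J by simp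
  have unit: "idet s (map dcol (map b js)) = idet s (map unit_col js)" if "set s \<subseteq> J" "set js \<subseteq> J" for s js
  proof (rule idet_cong)
    fix i j assume "i \<in> set s" "j < length (map dcol (map b js))"
    then have "i \<in> J" "js ! j \<in> J" "j < length js" using that by (auto simp: subset_iff)
    then show "(map dcol (map b js) ! j) i = (map unit_col js ! j) i"
      using i0 by (auto simp: dcol_def b_def J_def dl_diff lam_vertex unit_col_def)
  qed simp
  define B where "B vs = a vs + (-1) * (\<Sum>S | S \<subseteq> J \<and> card S = k.
    a (map b (sorted_list_of_set S)) * idet (sorted_list_of_set S) (map dcol vs))" for vs
  have "B vs = 0"
  proof (rule alt_form_eq_zero[where b = b and J = J])
    show "alt_form k B"
      unfolding B_def
    proof (intro alt_form_add alt_form_scale alt_form_sum a)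
      fix S assume S: "S \<in> {S. S \<subseteq> J \<and> card S = k}"
      then have "finite S" using J finite_subset by blast
      then show "alt_form k (\<lambda>vs. idet (sorted_list_of_set S) (map dcol vs))"
        using alt_form_idet[of "sorted_list_of_set S" "[]" k] S J by auto
    qed
    show "span (b ` J) = UNIV"
    proof (rule antisym)
      show "UNIV \<subseteq> span (b ` J)"
      proof
        fix v
        \<comment> \<open>The subtracted multiple of \<open>X i0\<close> is zero; it turns vertices
          into edge vectors.\<close>
        have "v = (\<Sum>i\<in>I. dl i v *\<^sub>R X i) - (\<Sum>i\<in>I. dl i v) *\<^sub>R X i0"
          by (simp add: sum_dl sum_dl_vertex)
        also have "\<dots> = (\<Sum>i\<in>I. dl i v *\<^sub>R b i)"
          by (simp add: b_def scaleR_diff_right sum_subtractf scaleR_sum_left)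
        also have "\<dots> = (\<Sum>i\<in>J. dl i v *\<^sub>R b i)"
          by (rule sum.mono_neutral_right) (use finite_I in \<open>auto simp: J_def b_def\<close>)
        also have "\<dots> \<in> span (b ` J)" by (intro span_sum span_scale span_base) auto
        finally show "v \<in> span (b ` J)" .
      qed
    qed simp
    fix R assume R: "R \<subseteq> J" "card R = k"
    have fR: "finite S" if "S \<subseteq> J" for S using that J finite_subset by blast
    have "(\<Sum>S | S \<subseteq> J \<and> card S = k. a (map b (sorted_list_of_set S)) *
        idet (sorted_list_of_set S) (map dcol (map b (sorted_list_of_set R)))) =
      (\<Sum>S | S \<subseteq> J \<and> card S = k. if S = R then a (map b (sorted_list_of_set R)) else 0)"
    proof (rule sum.cong[OF refl])
      fix S assume "S \<in> {S. S \<subseteq> J \<and> card S = k}"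
      then have S: "S \<subseteq> J" "card S = k" by auto
      have "idet (sorted_list_of_set S) (map dcol (map b (sorted_list_of_set R))) =
          idet (sorted_list_of_set S) (map unit_col (sorted_list_of_set R))"
        by (rule unit) (use S R fR in auto)
      also have "\<dots> = (if S = R then 1 else 0)"
      proof (cases "S = R")
        case False
        have "\<not> R \<subseteq> S" using False card_subset_eq[of S R] S R fR by auto
        then show ?thesis using False idet_unit_cols_neq S R fR by simp
      qed (simp add: idet_unit_cols_self)
      finally show "a (map b (sorted_list_of_set S)) *
          idet (sorted_list_of_set S) (map dcol (map b (sorted_list_of_set R))) =
          (if S = R then a (map b (sorted_list_of_set R)) else 0)" by simp
    qed
    then show "B (map b (sorted_list_of_set R)) = 0"
      using fin R by (simp add: B_def)
  qed (rule J)
  then show ?thesis by (simp add: B_def J_def b_def[abs_def])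
qed

lemma poly_forms_in_whitney_span:
  assumes "\<omega> \<in> poly_forms d k"
  shows "\<omega> \<in> whitney_span d k"
proof -
  obtain i0 where i0: "i0 \<in> I" using nonempty_I by blast
  have alt: "alt_form k (\<omega> y)" and deg: "poly_deg_le d (\<lambda>y. \<omega> y vs)" for y vs
    using assms by (auto simp: poly_forms_def)
  have eq: "\<omega> = (\<lambda>y vs. \<Sum>S | S \<subseteq> I - {i0} \<and> card S = k.
      \<omega> y (map (\<lambda>j. X j - X i0) (sorted_list_of_set S)) * idet (sorted_list_of_set S) (map dcol vs))"
    using alt_form_expand[OF alt i0] by (intro ext)
  show ?thesis
  proof (subst eq, intro whitney_span_sum poly_wedge_in_whitney_span deg)
    fix S assume S: "S \<in> {S. S \<subseteq> I - {i0} \<and> card S = k}"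
    then have "finite S" using finite_I finite_subset[of S I] by auto
    then show "set (sorted_list_of_set S) \<subseteq> I" "length (sorted_list_of_set S) = k" using S by auto
  qed
qed

text \<open>Contraction with \<open>y - org\<close> makes the leading column \<lambda>(y) -
  \<lambda>(org). The first summand gives a Whitney form; expanding the second along its constant
  column gives wedge products of k covectors with the same polynomial coefficients.\<close>

lemma koszul_in_whitney_span:
  assumes "\<eta> \<in> poly_forms d (Suc k)"
  shows "koszul org \<eta> \<in> whitney_span d k"
proof -
  obtain i0 where i0: "i0 \<in> I" using nonempty_I by blast
  have alt: "alt_form (Suc k) (\<eta> y)" and deg: "poly_deg_le d (\<lambda>y. \<eta> y vs)" for y vs
    using assms by (auto simp: poly_forms_def)
  define \<A> where "\<A> = {S. S \<subseteq> I - {i0} \<and> card S = Suc k}"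
  define e where "e S y = \<eta> y (map (\<lambda>j. X j - X i0) (sorted_list_of_set S))" for S y
  have S: "set (sorted_list_of_set S) \<subseteq> I" "length (sorted_list_of_set S) = Suc k" if "S \<in> \<A>" for S
  proof -
    have S: "S \<subseteq> I" "card S = Suc k" using that by (auto simp: \<A>_def)
    moreover have "finite S" using S finite_I finite_subset by blast
    ultimately show "set (sorted_list_of_set S) \<subseteq> I" "length (sorted_list_of_set S) = Suc k" by auto
  qed
  have eq: "koszul org \<eta> = (\<lambda>y vs. \<Sum>S\<in>\<A>. e S y * phi (sorted_list_of_set S) y vs +
      (-1) * (\<Sum>m<Suc k. ((-1) ^ m * lam (sorted_list_of_set S ! m) org) *
        (e S y * idet (omit m (sorted_list_of_set S)) (map dcol vs))))"
  proof (intro ext)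
    fix y vs
    have "koszul org \<eta> y vs = (\<Sum>S\<in>\<A>. e S y * idet (sorted_list_of_set S) (map dcol ((y - org) # vs)))"
      unfolding koszul_def \<A>_def e_def by (rule alt_form_expand[OF alt i0])
    also have "\<dots> = (\<Sum>S\<in>\<A>. e S y * phi (sorted_list_of_set S) y vs +
      (-1) * (\<Sum>m<Suc k. ((-1) ^ m * lam (sorted_list_of_set S ! m) org) *
        (e S y * idet (omit m (sorted_list_of_set S)) (map dcol vs))))"
    proof (rule sum.cong[OF refl])
      fix S assume "S \<in> \<A>"
      note S = S[OF this]
      let ?s = "sorted_list_of_set S"
      have "idet ?s (map dcol ((y - org) # vs)) =
          idet ?s ((\<lambda>i. lam i y + (-1) * lam i org) # map dcol vs)"
        by (rule idet_cong) (use S in \<open>auto simp: nth_Cons dcol_def dl_diff subset_iff split: nat.split\<close>)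
      \<comment> \<open>The zero column is a placeholder that the update at position 0
        overwrites.\<close>
      also have "\<dots> = phi ?s y vs + (-1) * idet ?s ((\<lambda>i. lam i org) # map dcol vs)"
        using idet_update_add[of 0 "(\<lambda>i. 0) # map dcol vs" ?s "\<lambda>i. lam i y" "\<lambda>i. (-1) * lam i org"]
          idet_update_scale[of 0 "(\<lambda>i. 0) # map dcol vs" ?s "-1" "\<lambda>i. lam i org"]
        by (simp add: phi_def)
      also have "idet ?s ((\<lambda>i. lam i org) # map dcol vs) =
          (\<Sum>m<Suc k. ((-1) ^ m * lam (?s ! m) org) * idet (omit m ?s) (map dcol vs))"
      proof (cases "length vs = k")
        case True
        then show ?thesis using S by (subst idet_laplace_col) auto
      next
        case False
        then show ?thesis using S by (simp add: idet_def length_omit)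
      qed
      finally have P: "idet ?s (map dcol ((y - org) # vs)) = phi ?s y vs + (-1) *
        (\<Sum>m<Suc k. ((-1) ^ m * lam (?s ! m) org) * idet (omit m ?s) (map dcol vs))" .
      show "e S y * idet ?s (map dcol ((y - org) # vs)) = e S y * phi ?s y vs +
        (-1) * (\<Sum>m<Suc k. ((-1) ^ m * lam (?s ! m) org) * (e S y * idet (omit m ?s) (map dcol vs)))"
        unfolding P by (simp only: distrib_left sum_distrib_left mult_ac)
    qed
    finally show "koszul org \<eta> y vs = (\<Sum>S\<in>\<A>. e S y * phi (sorted_list_of_set S) y vs +
      (-1) * (\<Sum>m<Suc k. ((-1) ^ m * lam (sorted_list_of_set S ! m) org) *
        (e S y * idet (omit m (sorted_list_of_set S)) (map dcol vs))))" .
  qed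
  have e: "poly_deg_le d (e S)" for S unfolding e_def[abs_def] by (rule deg)
  show ?thesis unfolding eq
  proof (intro whitney_span_sum whitney_span_add whitney_span_scale
      poly_phi_in_whitney_span poly_wedge_in_whitney_span e)
    fix S m assume "S \<in> \<A>" "m \<in> {..<Suc k}"
    then show "set (omit m (sorted_list_of_set S)) \<subseteq> I" "length (omit m (sorted_list_of_set S)) = k"
      using S[of S] set_omit[of m "sorted_list_of_set S"] by (auto simp: length_omit)
  qed (use S in auto)
qed

lemma trimmed_forms_in_whitney_span:
  assumes "\<omega> \<in> trimmed_forms org r k"
  shows "\<omega> \<in> whitney_span (r - 1) k"
proof -
  obtain \<alpha> \<eta> where "\<omega> = (\<lambda>x vs. \<alpha> x vs + koszul org \<eta> x vs)"
    "\<alpha> \<in> poly_forms (r - 1) k" "\<eta> \<in> poly_forms (r - 1) (Suc k)"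
    using assms unfolding trimmed_forms_def by auto
  then show ?thesis
    by (simp only: whitney_span_add koszul_in_whitney_span poly_forms_in_whitney_span)
qed

section \<open>Continuity of the local forms\<close>

lemma continuous_lam: "i \<in> I \<Longrightarrow> continuous_on UNIV (lam i)"
proof -
  assume "i \<in> I"
  then obtain l c where l: "linear l" "lam i = (\<lambda>y. l y + c)" using affine_lam by blast
  have "continuous_on UNIV l"
    using l by (intro linear_continuous_on) (simp add: linear_linear)
  then show ?thesis unfolding l(2) by (intro continuous_on_add continuous_on_const)
qed

lemma continuous_mon: "continuous_on UNIV (mon a)"
  unfolding mon_def[abs_def] by (intro continuous_intros continuous_lam)

lemma continuous_phi:
  assumes "set s \<subseteq> I"
  shows "continuous_on UNIV (\<lambda>y. phi s y vs)"
proof (cases "length s = Suc (length vs)")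
  case True
  then have "(\<lambda>y. phi s y vs) =
      (\<lambda>y. \<Sum>i<length s. (-1) ^ i * lam (s ! i) y * idet (omit i s) (map dcol vs))"
    unfolding phi_def by (intro ext) (subst idet_laplace_col, auto)
  moreover have "continuous_on UNIV \<dots>"
    using assms by (intro continuous_intros continuous_lam) auto
  ultimately show ?thesis by (simp only:)
qed (simp add: phi_length)

end

section \<open>Barycentric coordinates on a mesh\<close>

lemma affine_function_eq:
  fixes l l' :: "real ^ 'n::finite \<Rightarrow> real"
  assumes "linear l" "linear l'" "affine hull A = UNIV"
    and "\<And>y. y \<in> A \<Longrightarrow> l y + c = l' y + c'"
  shows "l y + c = l' y + c'"
proof -
  have "affine {y. l y + c = l' y + c'}"
    unfolding affine_def
  proof (intro ballI allI impI CollectI)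
    fix y z and u v :: real
    assume y: "y \<in> {y. l y + c = l' y + c'}" and z: "z \<in> {y. l y + c = l' y + c'}" and uv: "u + v = 1"
    have *: "h (u *\<^sub>R y + v *\<^sub>R z) + d = u * (h y + d) + v * (h z + d)"
      if "linear h" for h :: "real ^ 'n \<Rightarrow> real" and d
    proof -
      have "u * d + v * d = d" using uv by (simp flip: distrib_right)
      then show ?thesis using that by (simp add: linear_add linear_cmul distrib_left)
    qed
    show "l (u *\<^sub>R y + v *\<^sub>R z) + c = l' (u *\<^sub>R y + v *\<^sub>R z) + c'"
      using y z by (simp add: * assms)
  qed
  then have "affine hull A \<subseteq> {y. l y + c = l' y + c'}"
    using assms(4) by (intro hull_minimal) auto
  then show ?thesis using assms(3) by auto
qed

text \<open>The values \<open>h\<close> are arbitrary: unit values make the barycentric coordinates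
  well defined, and uniqueness for general values yields the reproduction of affine
  functions.\<close>

lemma affine_interpolation:
  fixes X :: "nat \<Rightarrow> real ^ 'n::finite" and h :: "nat \<Rightarrow> real"
  assumes inj: "inj_on X I" and ind: "\<not> affine_dependent (X ` I)" and "card I = Suc CARD('n)"
  shows "\<exists>!g. (\<exists>l c. linear l \<and> g = (\<lambda>y. l y + c)) \<and> (\<forall>j\<in>I. g (X j) = h j)"
proof (rule ex_ex1I)
  obtain i0 where i0: "i0 \<in> I" using assms(3) by fastforce
  \<comment> \<open>With the vertex \<open>i0\<close> moved to the origin, the other vertices are
    linearly independent, so a linear map may be prescribed on them.\<close>
  let ?B = "(\<lambda>v. - X i0 + v) ` (X ` I - {X i0})"
  have "independent ?B" using ind i0 by (subst affine_dependent_iff_dependent2[symmetric]) auto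
  then obtain l where l: "linear l"
    "\<And>b. b \<in> ?B \<Longrightarrow> l b = (h (the_inv_into I X (X i0 + b)) - h i0)"
    using linear_independent_extend[of ?B "\<lambda>b. h (the_inv_into I X (X i0 + b)) - h i0"]
    by blast
  have *: "l (X j - X i0) = h j - h i0" if "j \<in> I" for j
  proof (cases "j = i0")
    case True
    then show ?thesis using l(1) by (simp add: linear_0)
  next
    case False
    then have "X j - X i0 \<in> ?B" using that i0 inj by (auto simp: inj_on_def)
    from l(2)[OF this] show ?thesis using that inj by (simp add: the_inv_into_f_f)
  qed
  show "\<exists>g. (\<exists>l c. linear l \<and> g = (\<lambda>y. l y + c)) \<and> (\<forall>j\<in>I. g (X j) = h j)"
  proof (rule exI[of _ "\<lambda>y. l y + (h i0 - l (X i0))"], intro conjI ballI)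
    show "\<exists>l' c. linear l' \<and> (\<lambda>y. l y + (h i0 - l (X i0))) = (\<lambda>y. l' y + c)"
      using l(1) by blast
    show "l (X j) + (h i0 - l (X i0)) = h j" if "j \<in> I" for j
      using *[OF that] linear_diff[OF l(1), of "X j" "X i0"] by simp
  qed
next
  have "card (X ` I) = Suc CARD('n)" using inj assms(3) by (simp add: card_image)
  then have hull: "affine hull (X ` I) = UNIV"
    using aff_dim_affine_independent[OF ind] by (intro affine_hull_UNIV) simp
  fix g g'
  assume "(\<exists>l c. linear l \<and> g = (\<lambda>y. l y + c)) \<and> (\<forall>j\<in>I. g (X j) = h j)"
    "(\<exists>l c. linear l \<and> g' = (\<lambda>y. l y + c)) \<and> (\<forall>j\<in>I. g' (X j) = h j)"
  then obtain l c l' c' where l: "linear l" "linear l'" and g: "g = (\<lambda>y. l y + c)" "g' = (\<lambda>y. l' y + c')"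
    and eq: "\<And>j. j \<in> I \<Longrightarrow> g (X j) = g' (X j)"
    by (metis (no_types, lifting))
  have "l y + c = l' y + c'" for y
    by (rule affine_function_eq[OF l hull]) (use eq in \<open>auto simp: g\<close>)
  then show "g = g'" by (auto simp: g)
qed

locale simplicial_mesh =
  fixes \<Omega> :: "(real ^ 'n::finite) set" and \<T> :: "(real ^ 'n) set set"
    and x :: "nat \<Rightarrow> real ^ 'n" and N :: nat
  assumes domain: "bounded_polyhedral_domain \<Omega>"
    and mesh: "simplicial_triangulation \<T> \<Omega>"
    and numbering: "bij_betw x {0..N} (mesh_vertices \<T>)"
begin

abbreviation V :: "(real ^ 'n) set \<Rightarrow> nat set" where
  "V f \<equiv> vertex_indices x N f"

abbreviation lam :: "(real ^ 'n) set \<Rightarrow> nat \<Rightarrow> real ^ 'n \<Rightarrow> real" where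
  "lam T \<equiv> barycentric x N T"

section \<open>Vertices and faces of the mesh\<close>

lemma finite_mesh: "finite \<T>"
  using mesh by (simp add: simplicial_triangulation_def triangulation_def)

lemma finite_V: "finite (V f)"
  by (simp add: vertex_indices_def)

lemma inj_on_x: "inj_on x {0..N}"
  using numbering by (simp add: bij_betw_def)

lemma V_subset: "V f \<subseteq> {0..N}"
  by (auto simp: vertex_indices_def)

lemma inj_on_V: "inj_on x (V f)"
  using inj_on_x V_subset inj_on_subset by blast

lemma mesh_simplex:
  assumes "T \<in> \<T>"
  obtains C where "finite C" "\<not> affine_dependent C" "card C = Suc CARD('n)" "T = convex hull C"
proof -
  have "int CARD('n) simplex T" using mesh assms by (auto simp: simplicial_triangulation_def)
  then show ?thesis using that by (auto simp: simplex)
qed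

lemma mesh_convex_compact:
  assumes "T \<in> \<T>"
  shows "convex T" "compact T" "T \<noteq> {}"
proof -
  obtain C where C: "finite C" "card C = Suc CARD('n)" "T = convex hull C"
    using mesh_simplex[OF assms] by metis
  then show "convex T" "compact T" by (auto simp: finite_imp_compact_convex_hull)
  show "T \<noteq> {}" using C by auto
qed

lemma face_vertices:
  assumes "T \<in> \<T>" "g face_of T"
  shows "x ` V g = {v. v extreme_point_of g}"
proof -
  have "v \<in> x ` {0..N}" if "v extreme_point_of g" for v
  proof -
    have "v \<in> mesh_vertices \<T>"
      using extreme_point_of_face[OF assms(2), of v] that assms(1) by (auto simp: mesh_vertices_def)
    then show ?thesis using numbering by (simp add: bij_betw_def)
  qed
  then have "v \<in> x ` V g" if "v extreme_point_of g" for v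
    using that unfolding vertex_indices_def image_iff by fastforce
  then show ?thesis by (auto simp: vertex_indices_def)
qed

lemma face_hull:
  assumes "T \<in> \<T>" "g face_of T"
  shows "g = convex hull (x ` V g)"
  unfolding face_vertices[OF assms]
  using mesh_convex_compact[OF assms(1)] assms(2)
  by (intro Krein_Milman_Minkowski) (auto intro: face_of_imp_compact face_of_imp_convex)

lemma mesh_vertex_set:
  assumes "T \<in> \<T>"
  shows "\<not> affine_dependent (x ` V T)" "card (V T) = Suc CARD('n)" "T = convex hull (x ` V T)"
proof -
  obtain C where C: "\<not> affine_dependent C" "card C = Suc CARD('n)" "T = convex hull C"
    using mesh_simplex[OF assms] by metis
  have T: "T face_of T" using mesh_convex_compact[OF assms] by (simp add: face_of_refl)
  have V: "x ` V T = C"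
    unfolding face_vertices[OF assms T] using C
    by (auto simp: extreme_point_of_convex_hull_affine_independent)
  then show "\<not> affine_dependent (x ` V T)" "card (V T) = Suc CARD('n)" "T = convex hull (x ` V T)"
    using C V card_image[OF inj_on_V[of T]] by simp_all
qed

lemma V_face_subset: "g face_of T \<Longrightarrow> V g \<subseteq> V T"
  by (auto simp: vertex_indices_def extreme_point_of_face)

text \<open>\<open>f\<close> is a face of some \<open>T'\<close>, hence of the common face
  \<open>T \<inter> T'\<close>, hence of \<open>T\<close>. Thus the inclusion used in the
  definitions really expresses being a face.\<close>

lemma subset_imp_face:
  assumes "T \<in> \<T>" "f \<in> mesh_faces \<T>" "f \<subseteq> T"
  shows "f face_of T"
proof -
  obtain T' where T': "T' \<in> \<T>" "f face_of T'" using assms(2) by (auto simp: mesh_faces_def)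
  have I: "T \<inter> T' face_of T" "T \<inter> T' face_of T'"
    using mesh T'(1) assms(1) unfolding simplicial_triangulation_def triangulation_def
    by (simp, metis Int_commute)
  have "f face_of T \<inter> T'"
    by (rule face_of_subset[OF T'(2)]) (use assms(3) T'(2) in \<open>auto dest: face_of_imp_subset\<close>)
  then show ?thesis using I(1) face_of_trans by blast
qed

lemma mesh_subset_faces: "T \<in> \<T> \<Longrightarrow> T \<in> mesh_faces \<T>"
  using mesh_convex_compact[of T] face_of_refl[of T] unfolding mesh_faces_def by blast

lemma mesh_face_hull: "f \<in> mesh_faces \<T> \<Longrightarrow> f = convex hull (x ` V f)"
  unfolding mesh_faces_def using face_hull by blast

text \<open>Translates the geometry of mesh faces into inclusions of index sets; all later incidence
  arguments take place there.\<close>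

lemma subset_iff_V:
  assumes "f \<in> mesh_faces \<T>" "g \<in> mesh_faces \<T>"
  shows "f \<subseteq> g \<longleftrightarrow> V f \<subseteq> V g"
proof
  assume "V f \<subseteq> V g"
  then have "convex hull (x ` V f) \<subseteq> convex hull (x ` V g)" by (intro hull_mono image_mono)
  then show "f \<subseteq> g" using mesh_face_hull assms by metis
next
  assume "f \<subseteq> g"
  moreover obtain T where T: "T \<in> \<T>" "g face_of T" using assms(2) by (auto simp: mesh_faces_def)
  ultimately have "f face_of T"
    using subset_imp_face[OF T(1) assms(1)] face_of_imp_subset[OF T(2)] by blast
  then have "f face_of g" using face_of_face[OF T(2)] \<open>f \<subseteq> g\<close> by blast
  then show "V f \<subseteq> V g" by (rule V_face_subset)
qed

text \<open>Every nonempty set of vertices of a simplex spans a face. This supplies the face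
  carrying a given pair (\<alpha>, \<sigma>) and the face shared by two simplices; the dimension
  formula places the latter in the range of the trace condition.\<close>

lemma face_of_vertices:
  assumes "T \<in> \<T>" "J \<subseteq> V T" "J \<noteq> {}"
  shows "convex hull (x ` J) \<in> mesh_faces \<T>" "V (convex hull (x ` J)) = J"
    "aff_dim (convex hull (x ` J)) = int (card J) - 1"
proof -
  note T = mesh_vertex_set[OF assms(1)]
  have ind: "\<not> affine_dependent (x ` J)"
    using T(1) affine_independent_subset[of "x ` V T" "x ` J"] assms(2) by blast
  have face: "convex hull (x ` J) face_of T"
    by (subst T(3), rule face_of_convex_hull_affine_independent[OF T(1), THEN iffD2])
      (use assms(2) in blast)
  then show "convex hull (x ` J) \<in> mesh_faces \<T>"
    using assms by (auto simp: mesh_faces_def)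
  have "x ` V (convex hull (x ` J)) = x ` J"
    unfolding face_vertices[OF assms(1) face]
    by (auto simp: extreme_point_of_convex_hull_affine_independent[OF ind])
  then show "V (convex hull (x ` J)) = J"
    by (rule inj_on_image_eq_iff[OF inj_on_x V_subset order_trans[OF assms(2) V_subset], THEN iffD1])
  have "card (x ` J) = card J"
    by (rule card_image[OF inj_on_subset[OF inj_on_V assms(2)]])
  then show "aff_dim (convex hull (x ` J)) = int (card J) - 1"
    using aff_dim_affine_independent[OF ind] by (simp add: aff_dim_convex_hull)
qed

section \<open>Barycentric coordinates of a mesh simplex\<close>

lemma barycentric_ex1:
  fixes h :: "nat \<Rightarrow> real"
  assumes "T \<in> \<T>"
  shows "\<exists>!g. (\<exists>l c. linear l \<and> g = (\<lambda>y. l y + c)) \<and> (\<forall>j\<in>V T. g (x j) = h j)"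
  by (rule affine_interpolation[OF inj_on_V mesh_vertex_set(1)[OF assms] mesh_vertex_set(2)[OF assms]])

lemma barycentric_props:
  assumes "T \<in> \<T>"
  shows "\<exists>l c. linear l \<and> lam T i = (\<lambda>y. l y + c)"
    "\<And>j. j \<in> V T \<Longrightarrow> lam T i (x j) = (if i = j then 1 else 0)"
proof -
  have "(\<exists>l c. linear l \<and> lam T i = (\<lambda>y. l y + c)) \<and>
      (\<forall>j\<in>V T. lam T i (x j) = (if i = j then 1 else 0))"
    unfolding barycentric_def by (rule theI'[OF barycentric_ex1[OF assms]])
  then show "\<exists>l c. linear l \<and> lam T i = (\<lambda>y. l y + c)"
    "\<And>j. j \<in> V T \<Longrightarrow> lam T i (x j) = (if i = j then 1 else 0)"
    by blast+
qed

text \<open>Both sides are affine with equal vertex values, so uniqueness applies. The constant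
  function 1 gives \<Sum>\<lambda>_i = 1, and the coordinate functionals give the representation of
  \<open>y\<close> by the vertices.\<close>

lemma affine_eq_sum_lam:
  assumes "T \<in> \<T>" "linear l"
  shows "(\<Sum>i\<in>V T. lam T i y * (l (x i) + c)) = l y + c"
proof -
  have "\<exists>l' c'. linear l' \<and> (\<lambda>y. \<Sum>i\<in>A. lam T i y * g i) = (\<lambda>y. l' y + c')"
    if "finite A" for A and g :: "nat \<Rightarrow> real"
    using that
  proof (induction A rule: finite_induct)
    case empty
    show ?case by (intro exI[of _ "\<lambda>_. 0"] exI[of _ 0]) (simp add: linear_zero)
  next
    case (insert i A)
    obtain l1 c1 where 1: "linear l1" "\<And>y. (\<Sum>i\<in>A. lam T i y * g i) = l1 y + c1"
      using insert.IH by metis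
    obtain l2 c2 where 2: "linear l2" "lam T i = (\<lambda>y. l2 y + c2)"
      using barycentric_props(1)[OF assms(1)] by blast
    show ?case
      using insert.hyps 1 2
      by (intro exI[of _ "\<lambda>y. g i * l2 y + l1 y"] exI[of _ "g i * c2 + c1"])
        (auto intro!: linear_compose_add linear_mult_left simp: algebra_simps)
  qed
  from this[OF finite_V[of T], of "\<lambda>i. l (x i) + c"]
  have 1: "\<exists>l' c'. linear l' \<and> (\<lambda>y. \<Sum>i\<in>V T. lam T i y * (l (x i) + c)) = (\<lambda>y. l' y + c')" .
  have 2: "(\<Sum>i\<in>V T. lam T i (x j) * (l (x i) + c)) = l (x j) + c" if "j \<in> V T" for j
    using that finite_V[of T] barycentric_props(2)[OF assms(1) that]
    by (simp add: if_distrib[of "\<lambda>z. z * _"] cong: if_cong)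
  have "(\<lambda>y. \<Sum>i\<in>V T. lam T i y * (l (x i) + c)) = (\<lambda>y. l y + c)"
    using barycentric_ex1[OF assms(1), of "\<lambda>j. l (x j) + c"] 1 2 assms(2) by blast
  then show ?thesis by metis
qed

lemma barycentric_coords_mesh:
  assumes "T \<in> \<T>"
  shows "barycentric_coords (V T) x (lam T)"
proof
  show "finite (V T)" by (rule finite_V)
  show "V T \<noteq> {}" using mesh_vertex_set(2)[OF assms] by auto
  show "\<exists>l c. linear l \<and> lam T i = (\<lambda>y. l y + c)" for i
    by (rule barycentric_props(1)[OF assms])
  show "lam T i (x j) = (if i = j then 1 else 0)" if "j \<in> V T" for i j
    by (rule barycentric_props(2)[OF assms that])
  show "(\<Sum>i\<in>V T. lam T i y) = 1" for y
    using affine_eq_sum_lam[OF assms linear_zero, of y 1] by simp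
  show "(\<Sum>i\<in>V T. lam T i y *\<^sub>R x i) = y" for y
  proof (rule Finite_Cartesian_Product.vec_eq_iff[THEN iffD2], rule allI)
    fix m
    have "linear (\<lambda>y::real ^ 'n. y $ m)" by (simp add: linear_iff)
    from affine_eq_sum_lam[OF assms this, of y 0]
    show "(\<Sum>i\<in>V T. lam T i y *\<^sub>R x i) $ m = y $ m" by (simp add: sum_component)
  qed
qed

abbreviation phi :: "(real ^ 'n) set \<Rightarrow> nat list \<Rightarrow> 'n diff_form" where
  "phi T \<equiv> barycentric_coords.phi (lam T)"

abbreviation mon :: "(real ^ 'n) set \<Rightarrow> (nat \<Rightarrow> nat) \<Rightarrow> real ^ 'n \<Rightarrow> real" where
  "mon T \<equiv> barycentric_coords.mon (V T) (lam T)"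

abbreviation dl :: "(real ^ 'n) set \<Rightarrow> nat \<Rightarrow> real ^ 'n \<Rightarrow> real" where
  "dl T \<equiv> barycentric_coords.dl (lam T)"

abbreviation dcol :: "(real ^ 'n) set \<Rightarrow> real ^ 'n \<Rightarrow> nat \<Rightarrow> real" where
  "dcol T \<equiv> barycentric_coords.dcol (lam T)"

lemma frechet_barycentric:
  assumes "T \<in> \<T>"
  shows "frechet_derivative (lam T i) (at y) = dl T i"
proof -
  interpret B: barycentric_coords "V T" x "lam T" by (rule barycentric_coords_mesh[OF assms])
  obtain l c where l: "linear l" "lam T i = (\<lambda>y. l y + c)"
    using barycentric_props(1)[OF assms] by blast
  have "(lam T i has_derivative l) (at y)"
    unfolding l(2) using l(1)
    by (auto intro!: has_derivative_add_const linear_imp_has_derivative)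
  then have "frechet_derivative (lam T i) (at y) = l" by (rule frechet_derivative_at[symmetric])
  also have "l = dl T i" using l by (auto simp: B.dl_def[abs_def] linear_0)
  finally show ?thesis .
qed

text \<open>The alternating sum is the Laplace expansion along the leading column: leaving out the
  covector of index \<open>i\<close> deletes row \<open>i\<close>. If the number of arguments is not
  \<open>k\<close>, both sides vanish.\<close>

lemma whitney_form_eq_phi:
  assumes "T \<in> \<T>"
  shows "whitney_form x N T k \<sigma> y vs = phi T (map \<sigma> [0..<Suc k]) y vs"
proof -
  interpret B: barycentric_coords "V T" x "lam T" by (rule barycentric_coords_mesh[OF assms])
  let ?s = "map \<sigma> [0..<Suc k]"
  have filt: "filter (\<lambda>j. j \<noteq> i) [0..<Suc k] = omit i [0..<Suc k]" if "i \<le> k" for i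
  proof -
    have "[0..<Suc k] = [0..<i] @ i # [Suc i..<Suc k]"
      using that upt_add_eq_append[of 0 i "Suc k - i"] by (simp add: upt_conv_Cons del: upt_Suc)
    moreover have "filter (\<lambda>j. j \<noteq> i) [0..<i] = [0..<i]" "filter (\<lambda>j. j \<noteq> i) [Suc i..<Suc k] = [Suc i..<Suc k]"
      by (auto simp: filter_id_conv simp del: upt_Suc)
    ultimately show ?thesis by (simp add: omit_def del: upt_Suc)
  qed
  have wedge: "wedge (map (\<lambda>j. frechet_derivative (lam T (\<sigma> j)) (at y)) (filter (\<lambda>j. j \<noteq> i) [0..<Suc k])) vs
      = idet (omit i ?s) (map B.dcol vs)" if "i \<le> k" for i
  proof -
    have *: "map (\<lambda>j. frechet_derivative (lam T (\<sigma> j)) (at y)) (filter (\<lambda>j. j \<noteq> i) [0..<Suc k])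
        = map (B.dl) (omit i ?s)"
      unfolding filt[OF that] frechet_barycentric[OF assms] map_omit by (simp add: comp_def)
    have dcol_eq: "B.dcol = (\<lambda>v i. B.dl i v)" by (auto simp: B.dcol_def fun_eq_iff)
    show ?thesis unfolding * dcol_eq
    proof (cases "length vs = length (omit i ?s)")
      case True
      then show "wedge (map B.dl (omit i ?s)) vs = idet (omit i ?s) (map (\<lambda>v i. B.dl i v) vs)"
        by (rule wedge_conv_idet)
    qed (simp add: wedge_def idet_def)
  qed
  have "whitney_form x N T k \<sigma> y vs =
      (\<Sum>i<Suc k. (- 1) ^ i * lam T (?s ! i) y * idet (omit i ?s) (map B.dcol vs))"
    unfolding whitney_form_def
    by (rule sum.cong) (auto simp: wedge nth_map_upt simp del: upt_Suc)
  also have "\<dots> = B.phi ?s y vs"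
  proof (cases "length vs = k")
    case True
    then show ?thesis unfolding B.phi_def by (subst idet_laplace_col) (auto simp del: upt_Suc)
  next
    case False
    have "idet (omit i ?s) (map B.dcol vs) = 0" if "i < Suc k" for i
      using False that by (simp add: idet_def length_omit del: upt_Suc)
    then show ?thesis using False by (simp add: B.phi_length del: upt_Suc)
  qed
  finally show ?thesis .
qed

subsection \<open>Traces on faces\<close>

text \<open>The convex combination of the vertices in \<open>J\<close> that represents
  \<open>y\<close> does not refer to a simplex, and every simplex around the face reads its
  coordinates from it. Stating this with one \<open>t\<close> for all simplices yields vanishing and
  agreement together.\<close>

lemma lam_on_face:
  assumes "T \<in> \<T>" "J \<subseteq> V T" "y \<in> convex hull (x ` J)"
  shows "\<exists>t. \<forall>T'\<in>\<T>. J \<subseteq> V T' \<longrightarrow> (\<forall>i\<in>V T'. lam T' i y = (if i \<in> J then t i else 0))"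
proof -
  have finJ: "finite J" by (rule finite_subset[OF assms(2) finite_V])
  have inj: "inj_on x J" by (rule inj_on_subset[OF inj_on_V assms(2)])
  obtain u where u: "sum u (x ` J) = 1" "(\<Sum>v\<in>x ` J. u v *\<^sub>R v) = y"
    using assms(3) unfolding convex_hull_finite[OF finite_imageI[OF finJ]] by blast
  have t: "(\<Sum>j\<in>J. u (x j)) = 1" "(\<Sum>j\<in>J. u (x j) *\<^sub>R x j) = y"
    using u inj by (simp_all add: sum.reindex)
  show ?thesis
  proof (intro exI ballI impI)
    fix T' i assume "T' \<in> \<T>" "J \<subseteq> V T'" "i \<in> V T'"
    then show "lam T' i y = (if i \<in> J then u (x i) else 0)"
      using barycentric_coords.lam_combination[OF barycentric_coords_mesh, of T' i J] t by metis
  qed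
qed

lemma lam_face_zero:
  assumes "T \<in> \<T>" "J \<subseteq> V T" "y \<in> convex hull (x ` J)" "i \<in> V T" "i \<notin> J"
  shows "lam T i y = 0"
  using lam_on_face[OF assms(1-3)] assms by auto

lemma lam_face_eq:
  assumes "T \<in> \<T>" "T' \<in> \<T>" "J \<subseteq> V T" "J \<subseteq> V T'" "y \<in> convex hull (x ` J)" "i \<in> J"
  shows "lam T i y = lam T' i y"
  using lam_on_face[OF assms(1,3,5)] assms by (metis subsetD)

text \<open>Tangent vectors are combinations of differences of points of the face, and \<lambda>_i
  vanishes at those points.\<close>

lemma dl_face_zero:
  assumes "T \<in> \<T>" "J \<subseteq> V T" "v \<in> tangent_space (convex hull (x ` J))" "i \<in> V T" "i \<notin> J"
  shows "dl T i v = 0"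
proof -
  interpret B: barycentric_coords "V T" x "lam T" by (rule barycentric_coords_mesh[OF assms(1)])
  show ?thesis
    using assms(3) unfolding tangent_space_def
    by (rule linear_eq_0_on_span[OF B.linear_dl[OF assms(4)], rotated])
      (use assms in \<open>auto simp: B.dl_diff lam_face_zero\<close>)
qed

lemma dl_face_eq:
  assumes "T \<in> \<T>" "T' \<in> \<T>" "J \<subseteq> V T" "J \<subseteq> V T'" "v \<in> tangent_space (convex hull (x ` J))" "i \<in> J"
  shows "dl T i v = dl T' i v"
proof -
  interpret T: barycentric_coords "V T" x "lam T" by (rule barycentric_coords_mesh[OF assms(1)])
  interpret T': barycentric_coords "V T'" x "lam T'" by (rule barycentric_coords_mesh[OF assms(2)])
  have i: "i \<in> V T" "i \<in> V T'" using assms by auto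
  show ?thesis
    using assms(5) unfolding tangent_space_def
    by (rule linear_eq_on[OF T.linear_dl[OF i(1)] T'.linear_dl[OF i(2)]])
      (use assms i in \<open>auto simp: T.dl_diff T'.dl_diff lam_face_eq[of T T' J]\<close>)
qed

text \<open>An index off the face either contributes a vanishing factor \<lambda>_i to the monomial,
  or makes row \<open>i\<close> of the determinant zero, because both \<lambda>_i and d\<lambda>_i
  vanish along the face.\<close>

lemma mon_phi_trace_zero:
  assumes "T \<in> \<T>" "J \<subseteq> V T" "y \<in> convex hull (x ` J)"
    and "set vs \<subseteq> tangent_space (convex hull (x ` J))"
    and "S \<subseteq> V T" "i \<in> V T - J" "a i > 0 \<or> i \<in> S"
  shows "mon T a y * phi T (sorted_list_of_set S) y vs = 0"
proof -
  interpret B: barycentric_coords "V T" x "lam T" by (rule barycentric_coords_mesh[OF assms(1)])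
  have i: "i \<in> V T" "i \<notin> J" using assms by auto
  note z = lam_face_zero[OF assms(1-3) i]
  show ?thesis
  proof (cases "a i > 0")
    case True
    then have "B.mon a y = 0" unfolding B.mon_def using z i finite_V[of T] by (auto intro!: prod_zero)
    then show ?thesis by simp
  next
    case False
    have "finite S" using assms(5) finite_V finite_subset by blast
    then have "B.phi (sorted_list_of_set S) y vs = 0"
      unfolding B.phi_def
      by (intro idet_zero_row[of i]) (use False assms z dl_face_zero[OF assms(1,2) _ i] in \<open>auto simp: B.dcol_def\<close>)
    then show ?thesis by simp
  qed
qed

lemma mon_phi_trace_eq:
  assumes "T \<in> \<T>" "T' \<in> \<T>" "J \<subseteq> V T" "J \<subseteq> V T'" "y \<in> convex hull (x ` J)"
    and "set vs \<subseteq> tangent_space (convex hull (x ` J))"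
    and "S \<subseteq> J" "\<And>i. i \<notin> J \<Longrightarrow> a i = 0"
  shows "mon T a y * phi T (sorted_list_of_set S) y vs = mon T' a y * phi T' (sorted_list_of_set S) y vs"
proof -
  interpret T: barycentric_coords "V T" x "lam T" by (rule barycentric_coords_mesh[OF assms(1)])
  interpret T': barycentric_coords "V T'" x "lam T'" by (rule barycentric_coords_mesh[OF assms(2)])
  have "T.mon a y = (\<Prod>i\<in>J. lam T i y ^ a i)"
    unfolding T.mon_def by (rule prod.mono_neutral_right) (use assms finite_V in auto)
  moreover have "T'.mon a y = (\<Prod>i\<in>J. lam T' i y ^ a i)"
    unfolding T'.mon_def by (rule prod.mono_neutral_right) (use assms finite_V in auto)
  moreover have "(\<Prod>i\<in>J. lam T i y ^ a i) = (\<Prod>i\<in>J. lam T' i y ^ a i)"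
    by (rule prod.cong) (use lam_face_eq[OF assms(1-5)] in auto)
  moreover have "T.phi (sorted_list_of_set S) y vs = T'.phi (sorted_list_of_set S) y vs"
    unfolding T.phi_def T'.phi_def
  proof (rule idet_cong)
    have finS: "finite S" using assms(3,7) finite_V[of T] by (meson finite_subset)
    fix i j assume "i \<in> set (sorted_list_of_set S)" and j: "j < length ((\<lambda>i. lam T i y) # map T.dcol vs)"
    then have i: "i \<in> J" using finS assms(7) by auto
    show "(((\<lambda>i. lam T i y) # map T.dcol vs) ! j) i = (((\<lambda>i. lam T' i y) # map T'.dcol vs) ! j) i"
    proof (cases j)
      case 0
      then show ?thesis using lam_face_eq[OF assms(1-5) i] by simp
    next
      case (Suc m)
      then have "vs ! m \<in> tangent_space (convex hull (x ` J))" using assms(6) j by auto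
      from dl_face_eq[OF assms(1-4) this i] show ?thesis
        using Suc j by (simp add: T.dcol_def T'.dcol_def)
    qed
  qed simp
  ultimately show ?thesis by simp
qed

subsection \<open>Index triples\<close>

text \<open>The face is dropped because it is the hull of the vertices in the support of \<alpha>
  and the range of \<sigma>. The result is a pair independent of any simplex, so one coefficient
  function on codes serves the whole mesh.\<close>

definition code :: "(real ^ 'n) set \<times> (nat \<Rightarrow> nat) \<times> (nat \<Rightarrow> nat) \<Rightarrow> nat \<Rightarrow> (nat \<Rightarrow> nat) \<times> nat set" where
  "code q k = (case q of (f, \<alpha>, \<sigma>) \<Rightarrow> ((\<lambda>i. if i \<in> V f then \<alpha> i else 0), \<sigma> ` {0..k}))"

lemma strict_mono_sorted_list:
  assumes "strict_mono_on {0..k} (\<sigma> :: nat \<Rightarrow> nat)"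
  shows "map \<sigma> [0..<Suc k] = sorted_list_of_set (\<sigma> ` {0..k})"
proof -
  have "sorted_wrt (\<lambda>i j. \<sigma> i < \<sigma> j) [0..<Suc k]"
    by (rule sorted_wrt_mono_rel[OF _ sorted_wrt_upt])
      (use assms in \<open>auto simp: strict_mono_on_def simp del: upt_Suc\<close>)
  then have "sorted (map \<sigma> [0..<Suc k])" "distinct (map \<sigma> [0..<Suc k])"
    by (simp_all only: sorted_wrt_map[symmetric] strict_sorted_iff)
  moreover have "set (map \<sigma> [0..<Suc k]) = \<sigma> ` {0..k}" by (simp add: atLeastLessThanSuc_atLeastAtMost del: upt_Suc)
  ultimately show ?thesis by (metis sorted_list_of_set.idem_if_sorted_distinct)
qed

lemma omega_indicesD:
  assumes "(f, \<alpha>, \<sigma>) \<in> omega_indices x N \<T> r k"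
  shows "f \<in> mesh_faces \<T>" "fst (code (f, \<alpha>, \<sigma>) k) \<in> multi_indices (r - 1) (V f)"
    "\<sigma> ` {0..k} \<subseteq> V f" "card (\<sigma> ` {0..k}) = Suc k"
    "map \<sigma> [0..<Suc k] = sorted_list_of_set (\<sigma> ` {0..k})"
    "V f = {i. fst (code (f, \<alpha>, \<sigma>) k) i > 0} \<union> \<sigma> ` {0..k}"
proof -
  show "f \<in> mesh_faces \<T>" "\<sigma> ` {0..k} \<subseteq> V f"
    using assms by (auto simp: omega_indices_def)
  show "fst (code (f, \<alpha>, \<sigma>) k) \<in> multi_indices (r - 1) (V f)"
    using assms by (auto simp: omega_indices_def code_def multi_indices_def)
  have \<sigma>: "strict_mono_on {0..k} \<sigma>" using assms by (auto simp: omega_indices_def)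
  then show "card (\<sigma> ` {0..k}) = Suc k" by (simp add: card_image strict_mono_on_imp_inj_on)
  show "map \<sigma> [0..<Suc k] = sorted_list_of_set (\<sigma> ` {0..k})" by (rule strict_mono_sorted_list[OF \<sigma>])
  show "V f = {i. fst (code (f, \<alpha>, \<sigma>) k) i > 0} \<union> \<sigma> ` {0..k}"
    using assms by (auto simp: omega_indices_def code_def split: if_splits)
qed

lemma code_inj: "inj_on (\<lambda>q. code q k) (omega_indices x N \<T> r k)"
proof (rule inj_onI)
  fix q q' assume q: "q \<in> omega_indices x N \<T> r k" "q' \<in> omega_indices x N \<T> r k" "code q k = code q' k"
  obtain f \<alpha> \<sigma> f' \<alpha>' \<sigma>' where qq: "q = (f, \<alpha>, \<sigma>)" "q' = (f', \<alpha>', \<sigma>')" by (metis prod_cases3)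
  note D = omega_indicesD[OF q(1)[unfolded qq]] and D' = omega_indicesD[OF q(2)[unfolded qq]]
  have c: "fst (code (f, \<alpha>, \<sigma>) k) = fst (code (f', \<alpha>', \<sigma>') k)" "\<sigma> ` {0..k} = \<sigma>' ` {0..k}"
    using q(3) by (auto simp: qq code_def)
  have V: "V f = V f'" using D(6) D'(6) c by simp
  then have "f = f'" using mesh_face_hull D(1) D'(1) by metis
  moreover have "\<alpha> = \<alpha>'"
  proof
    fix i
    have "\<alpha> \<in> extensional (V f)" "\<alpha>' \<in> extensional (V f)"
      using q V by (auto simp: qq omega_indices_def PiE_def)
    then show "\<alpha> i = \<alpha>' i"
      using fun_cong[OF c(1), of i] V by (cases "i \<in> V f") (auto simp: code_def extensional_def)
  qed
  moreover have "\<sigma> = \<sigma>'"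
  proof
    fix i
    have "\<sigma> \<in> extensional {0..k}" "\<sigma>' \<in> extensional {0..k}"
      using q by (auto simp: qq omega_indices_def PiE_def)
    moreover have "map \<sigma> [0..<Suc k] = map \<sigma>' [0..<Suc k]" using D(5) D'(5) c(2) by simp
    ultimately show "\<sigma> i = \<sigma>' i"
      by (cases "i \<le> k") (auto simp: extensional_def atLeastLessThanSuc_atLeastAtMost simp del: upt_Suc)
  qed
  ultimately show "q = q'" by (simp add: qq)
qed

text \<open>For the triples whose face lies in \<open>g\<close>, the covering condition on
  (\<alpha>, \<sigma>) lets the face be recovered from the code. This makes the global index set
  restrict to the local one on each simplex.\<close>

lemma code_bij:
  assumes "g \<in> mesh_faces \<T>"
  shows "bij_betw (\<lambda>q. code q k) {q \<in> basis_indices x N \<T> r k. fst q \<subseteq> g} (whitney_indices (r - 1) k (V g))"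
proof (rule bij_betw_imageI)
  show "inj_on (\<lambda>q. code q k) {q \<in> basis_indices x N \<T> r k. fst q \<subseteq> g}"
    by (rule inj_on_subset[OF code_inj]) (auto simp: basis_indices_def)
  show "(\<lambda>q. code q k) ` {q \<in> basis_indices x N \<T> r k. fst q \<subseteq> g} = whitney_indices (r - 1) k (V g)"
  proof (intro equalityI subsetI)
    fix p assume "p \<in> (\<lambda>q. code q k) ` {q \<in> basis_indices x N \<T> r k. fst q \<subseteq> g}"
    then obtain f \<alpha> \<sigma> where q: "(f, \<alpha>, \<sigma>) \<in> basis_indices x N \<T> r k" "f \<subseteq> g" "p = code (f, \<alpha>, \<sigma>) k"
      by auto
    then have q': "(f, \<alpha>, \<sigma>) \<in> omega_indices x N \<T> r k" by (simp add: basis_indices_def)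
    note D = omega_indicesD[OF q']
    have V: "V f \<subseteq> V g" using q(2) subset_iff_V[OF D(1) assms] by simp
    have "(\<Sum>i\<in>V g. fst p i) = (\<Sum>i\<in>V f. fst p i)"
      by (rule sum.mono_neutral_right) (use V finite_V D(2) q(3) in \<open>auto simp: multi_indices_def\<close>)
    then have "fst p \<in> multi_indices (r - 1) (V g)"
      using D(2) V q(3) by (auto simp: multi_indices_def)
    moreover have "snd p = \<sigma> ` {0..k}" by (simp add: q(3) code_def)
    then have "snd p \<subseteq> V g" "card (snd p) = Suc k"
      using order_trans[OF D(3) V] D(4) by simp_all
    moreover have min: "fst p i = 0" if "i < Min (snd p)" for i
      using q that by (auto simp: basis_indices_def code_def)
    ultimately show "p \<in> whitney_indices (r - 1) k (V g)"
      by (simp add: whitney_indices_def split_beta)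
  next
    fix p assume p: "p \<in> whitney_indices (r - 1) k (V g)"
    obtain a S where aS: "p = (a, S)" by (cases p)
    have a: "\<And>i. i \<notin> V g \<Longrightarrow> a i = 0" "(\<Sum>i\<in>V g. a i) = r - 1"
      and S: "S \<subseteq> V g" "card S = Suc k" and min: "\<And>i. i < Min S \<Longrightarrow> a i = 0"
      using p by (auto simp: aS whitney_indices_def multi_indices_def)
    have finS: "finite S" using S(2) card_ge_0_finite[of S] by simp
    \<comment> \<open>The vertex set that the covering condition forces on the face.\<close>
    define J where "J = {i. a i > 0} \<union> S"
    have "i \<in> V g" if "a i > 0" for i
      using a(1)[of i] that by (cases "i \<in> V g") auto
    then have J: "J \<subseteq> V g" using S by (auto simp: J_def)
    have "S \<noteq> {}" using S(2) by auto
    then have neJ: "J \<noteq> {}" by (auto simp: J_def)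
    obtain T where T: "T \<in> \<T>" "g face_of T" using assms by (auto simp: mesh_faces_def)
    define f where "f = convex hull (x ` J)"
    have f: "f \<in> mesh_faces \<T>" "V f = J"
      using face_of_vertices[OF T(1), of J] J neJ V_face_subset[OF T(2)] by (auto simp: f_def)
    have fg: "f \<subseteq> g" using subset_iff_V[OF f(1) assms] f(2) J by simp
    define s where "s = sorted_list_of_set S"
    have s: "length s = Suc k" "set s = S" "sorted_wrt (<) s"
      using S finS by (auto simp: s_def)
    define \<sigma> where "\<sigma> = restrict (\<lambda>j. s ! j) {0..k}"
    have \<sigma>: "\<sigma> ` {0..k} = S"
    proof -
      have "\<sigma> ` {0..k} = (!) s ` {0..<length s}"
        using s(1) by (simp add: \<sigma>_def atLeastLessThanSuc_atLeastAtMost)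
      then show ?thesis by (subst s(2)[symmetric]) (auto simp: set_conv_nth)
    qed
    have "strict_mono_on {0..k} \<sigma>"
      using s by (auto simp: \<sigma>_def strict_mono_on_def sorted_wrt_nth_less)
    moreover have "(\<Sum>i\<in>J. a i) = r - 1"
      using a(2) by (subst sum.mono_neutral_left[of "V g"]) (use J finite_V in \<open>auto simp: J_def\<close>)
    ultimately have "(f, restrict a J, \<sigma>) \<in> omega_indices x N \<T> r k"
      using f \<sigma> by (auto simp: omega_indices_def J_def \<sigma>_def)
    then have "(f, restrict a J, \<sigma>) \<in> basis_indices x N \<T> r k"
      using f(2) \<sigma> min by (auto simp: basis_indices_def)
    moreover have "code (f, restrict a J, \<sigma>) k = p"
      using f(2) \<sigma> by (auto simp: code_def aS J_def fun_eq_iff)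
    ultimately show "p \<in> (\<lambda>q. code q k) ` {q \<in> basis_indices x N \<T> r k. fst q \<subseteq> g}"
      using fg by (intro image_eqI[of _ _ "(f, restrict a J, \<sigma>)"]) auto
  qed
qed

end

section \<open>Classes of forms up to null sets\<close>

lemma restricts_to_add:
  "restricts_to W S p \<Longrightarrow> restricts_to W' S p' \<Longrightarrow> restricts_to (W + W') S (\<lambda>y vs. p y vs + p' y vs)"
  by transfer (erule (1) eventually_elim2, auto)

lemma restricts_to_scale:
  "restricts_to W S p \<Longrightarrow> restricts_to (c *\<^sub>R W) S (\<lambda>y vs. c * p y vs)"
  by transfer (erule eventually_mono, auto)

lemma restricts_to_zero: "restricts_to 0 S (\<lambda>y vs. 0)"
  by transfer simp

lemma restricts_to_sum:
  "(\<And>q. q \<in> A \<Longrightarrow> restricts_to (W q) S (p q)) \<Longrightarrow>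
    restricts_to (\<Sum>q\<in>A. W q) S (\<lambda>y vs. \<Sum>q\<in>A. p q y vs)"
  by (induction A rule: infinite_finite_induct) (auto intro: restricts_to_zero restricts_to_add)

lemma restricts_to_unique:
  "restricts_to W S p \<Longrightarrow> restricts_to W S p' \<Longrightarrow> AE y in lebesgue. y \<in> S \<longrightarrow> p y = p' y"
  by transfer (erule (1) eventually_elim2, auto)

lemma ae_form_eqI:
  assumes "finite \<S>" "\<Union>\<S> = UNIV"
    and "\<And>S. S \<in> \<S> \<Longrightarrow> restricts_to W S (p S)" "\<And>S. S \<in> \<S> \<Longrightarrow> restricts_to W' S (p S)"
  shows "W = W'"
  using assms
proof transfer
  fix \<S> and W p W' :: "_ \<Rightarrow> _"
  assume \<S>: "finite \<S>" "\<Union>\<S> = UNIV"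
    and *: "\<And>S. S \<in> \<S> \<Longrightarrow> AE y in lebesgue. y \<in> S \<longrightarrow> W y = p S y"
      "\<And>S. S \<in> \<S> \<Longrightarrow> AE y in lebesgue. y \<in> S \<longrightarrow> W' y = p S y"
  have "AE y in lebesgue. y \<in> S \<longrightarrow> W y = W' y" if "S \<in> \<S>" for S
    using *(1)[OF that] *(2)[OF that] by eventually_elim auto
  then have "AE y in lebesgue. \<forall>S\<in>\<S>. y \<in> S \<longrightarrow> W y = W' y"
    by (intro eventually_ball_finite[OF \<S>(1)] ballI)
  then show "AE y in lebesgue. W y = W' y"
    by (rule eventually_mono) (use \<S>(2) in blast)
qed

lemma AE_not_in_negligible: "negligible S \<Longrightarrow> AE y in lebesgue. y \<notin> S"
  by (simp add: negligible_iff_null_sets AE_not_in)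

text \<open>The set of disagreement inside the interior is open and null, hence empty. A convex set
  with nonempty interior lies in the closure of that interior, so the equality reaches the
  boundary.\<close>

lemma restricts_to_continuous_eq:
  fixes T :: "(real ^ 'n::finite) set"
  assumes "restricts_to W T p" "restricts_to W T p'" "convex T" "interior T \<noteq> {}"
    and "continuous_on UNIV (\<lambda>y. p y vs)" "continuous_on UNIV (\<lambda>y. p' y vs)" "y \<in> T"
  shows "p y vs = p' y vs"
proof -
  let ?Z = "{y. p y vs = p' y vs}"
  have closed: "closed ?Z" by (rule closed_Collect_eq[OF assms(5,6)])
  have "AE y in lebesgue. y \<in> T \<longrightarrow> p y = p' y" by (rule restricts_to_unique[OF assms(1,2)])
  then have "AE y in lebesgue. y \<notin> interior T - ?Z"
    by (rule eventually_mono) (use interior_subset[of T] in auto)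
  moreover have op: "open (interior T - ?Z)" using closed by blast
  ultimately have "negligible (interior T - ?Z)"
    unfolding negligible_iff_null_sets
    by (subst AE_iff_null_sets) (auto intro!: borel_open sets_completionI_sets)
  then have "interior T \<subseteq> ?Z" using op open_not_negligible by blast
  then have "closure (interior T) \<subseteq> ?Z" using closed by (rule closure_minimal)
  moreover have "T \<subseteq> closure (interior T)"
    using convex_closure_interior[OF assms(3,4)] closure_subset by blast
  ultimately show ?thesis using assms(7) by blast
qed

text \<open>Independence of the image set does not detect equal members with different indices. The
  coefficient criterion excludes them as well, through the relation with coefficients 1 and
  -1.\<close>

lemma independent_family:
  fixes f :: "'i \<Rightarrow> 'a::real_vector"
  assumes "finite A" and zero: "\<And>c a. (\<Sum>a\<in>A. c a *\<^sub>R f a) = 0 \<Longrightarrow> a \<in> A \<Longrightarrow> c a = 0"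
  shows "inj_on f A \<and> independent (f ` A)"
proof
  show inj: "inj_on f A"
  proof (rule inj_onI, rule ccontr)
    fix a b assume ab: "a \<in> A" "b \<in> A" "f a = f b" "a \<noteq> b"
    let ?c = "\<lambda>i. (if i = a then 1 else 0) - (if i = b then 1 else 0 :: real)"
    have "(\<Sum>i\<in>A. ?c i *\<^sub>R f i) = (\<Sum>i\<in>A. if i = a then f a else 0) - (\<Sum>i\<in>A. if i = b then f b else 0)"
      unfolding sum_subtractf[symmetric] by (rule sum.cong) auto
    also have "\<dots> = 0" using ab assms(1) by simp
    finally show False using zero[of ?c a] ab by simp
  qed
  show "independent (f ` A)"
  proof
    assume "dependent (f ` A)"
    then obtain u v where u: "v \<in> f ` A" "u v \<noteq> 0" "(\<Sum>v\<in>f ` A. u v *\<^sub>R v) = 0"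
      using dependent_finite[of "f ` A"] assms(1) by auto
    then have "(\<Sum>a\<in>A. u (f a) *\<^sub>R f a) = 0" using inj by (simp add: sum.reindex)
    then show False using zero[of "\<lambda>a. u (f a)"] u by auto
  qed
qed

section \<open>Closure of the spaces under linear combinations\<close>

lemma poly_forms_add:
  "\<omega> \<in> poly_forms r k \<Longrightarrow> \<eta> \<in> poly_forms r k \<Longrightarrow> (\<lambda>x vs. \<omega> x vs + \<eta> x vs) \<in> poly_forms r k"
  by (auto simp: poly_forms_def intro: alt_form_add poly_deg_le_add)

lemma poly_forms_scale: "\<omega> \<in> poly_forms r k \<Longrightarrow> (\<lambda>x vs. c * \<omega> x vs) \<in> poly_forms r k"
  by (auto simp: poly_forms_def intro: alt_form_scale poly_deg_le_scale)

lemma poly_forms_zero: "(\<lambda>x vs. 0) \<in> poly_forms r k"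
  by (auto simp: poly_forms_def intro: alt_form_zero poly_deg_le_zero)

lemma trimmed_forms_add:
  assumes "\<omega> \<in> trimmed_forms org r k" "\<omega>' \<in> trimmed_forms org r k"
  shows "(\<lambda>x vs. \<omega> x vs + \<omega>' x vs) \<in> trimmed_forms org r k"
proof -
  obtain a \<eta> a' \<eta>' where
    "\<omega> = (\<lambda>x vs. a x vs + koszul org \<eta> x vs)" "a \<in> poly_forms (r - 1) k" "\<eta> \<in> poly_forms (r - 1) (k + 1)"
    "\<omega>' = (\<lambda>x vs. a' x vs + koszul org \<eta>' x vs)" "a' \<in> poly_forms (r - 1) k" "\<eta>' \<in> poly_forms (r - 1) (k + 1)"
    using assms unfolding trimmed_forms_def by blast
  then show ?thesis unfolding trimmed_forms_def
    by (intro CollectI exI[of _ "\<lambda>x vs. a x vs + a' x vs"] exI[of _ "\<lambda>x vs. \<eta> x vs + \<eta>' x vs"])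
      (auto simp: koszul_def fun_eq_iff intro: poly_forms_add)
qed

lemma trimmed_forms_scale:
  assumes "\<omega> \<in> trimmed_forms org r k"
  shows "(\<lambda>x vs. c * \<omega> x vs) \<in> trimmed_forms org r k"
proof -
  obtain a \<eta> where
    "\<omega> = (\<lambda>x vs. a x vs + koszul org \<eta> x vs)" "a \<in> poly_forms (r - 1) k" "\<eta> \<in> poly_forms (r - 1) (k + 1)"
    using assms unfolding trimmed_forms_def by blast
  then show ?thesis unfolding trimmed_forms_def
    by (intro CollectI exI[of _ "\<lambda>x vs. c * a x vs"] exI[of _ "\<lambda>x vs. c * \<eta> x vs"])
      (auto simp: koszul_def fun_eq_iff distrib_left intro: poly_forms_scale)
qed

lemma trimmed_forms_zero: "(\<lambda>x vs. 0) \<in> trimmed_forms org r k"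
  unfolding trimmed_forms_def koszul_def
  by (intro CollectI exI[of _ "\<lambda>x vs. 0"]) (auto intro: poly_forms_zero)

lemma L2_forms_add:
  assumes "W \<in> L2_forms \<Omega> k" "W' \<in> L2_forms \<Omega> k"
  shows "W + W' \<in> L2_forms \<Omega> k"
proof -
  obtain \<omega> \<omega>' where W: "W = abs_ae_form \<omega>" "W' = abs_ae_form \<omega>'"
    and alt: "\<And>x. alt_form k (\<omega> x)" "\<And>x. alt_form k (\<omega>' x)"
    and out: "\<And>x. x \<notin> \<Omega> \<Longrightarrow> \<omega> x = (\<lambda>vs. 0)" "\<And>x. x \<notin> \<Omega> \<Longrightarrow> \<omega>' x = (\<lambda>vs. 0)"
    and m: "\<And>vs. (\<lambda>x. \<omega> x vs) \<in> borel_measurable lebesgue" "\<And>vs. (\<lambda>x. \<omega>' x vs) \<in> borel_measurable lebesgue"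
    and i: "\<And>vs. integrable lebesgue (\<lambda>x. (\<omega> x vs)\<^sup>2)" "\<And>vs. integrable lebesgue (\<lambda>x. (\<omega>' x vs)\<^sup>2)"
    using assms unfolding L2_forms_def by blast
  have "integrable lebesgue (\<lambda>x. (\<omega> x vs + \<omega>' x vs)\<^sup>2)" for vs
  proof (rule Bochner_Integration.integrable_bound)
    show "integrable lebesgue (\<lambda>x. 2 * (\<omega> x vs)\<^sup>2 + 2 * (\<omega>' x vs)\<^sup>2)" using i by simp
    show "(\<lambda>x. (\<omega> x vs + \<omega>' x vs)\<^sup>2) \<in> borel_measurable lebesgue" using m by measurable
    have "(a + b)\<^sup>2 \<le> 2 * a\<^sup>2 + 2 * b\<^sup>2" for a b :: real
      using zero_le_power2[of "a - b"] by (simp add: power2_eq_square algebra_simps)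
    then show "AE x in lebesgue. norm ((\<omega> x vs + \<omega>' x vs)\<^sup>2) \<le> norm (2 * (\<omega> x vs)\<^sup>2 + 2 * (\<omega>' x vs)\<^sup>2)"
      by simp
  qed
  then show ?thesis unfolding L2_forms_def W plus_ae_form.abs_eq using alt out m
    by (intro imageI CollectI) (auto intro: alt_form_add)
qed

lemma L2_forms_scale:
  assumes "W \<in> L2_forms \<Omega> k"
  shows "c *\<^sub>R W \<in> L2_forms \<Omega> k"
proof -
  obtain \<omega> where W: "W = abs_ae_form \<omega>"
    and "\<And>x. alt_form k (\<omega> x)" "\<And>x. x \<notin> \<Omega> \<Longrightarrow> \<omega> x = (\<lambda>vs. 0)"
      "\<And>vs. (\<lambda>x. \<omega> x vs) \<in> borel_measurable lebesgue"
      "\<And>vs. integrable lebesgue (\<lambda>x. (\<omega> x vs)\<^sup>2)"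
    using assms unfolding L2_forms_def by blast
  then show ?thesis unfolding L2_forms_def W scaleR_ae_form.abs_eq
    by (intro imageI CollectI) (auto simp: power_mult_distrib intro: alt_form_scale)
qed

lemma L2_forms_zero: "0 \<in> L2_forms \<Omega> k"
  unfolding L2_forms_def zero_ae_form_def
  by (intro imageI CollectI) (auto intro: alt_form_zero)

lemma L2_forms_outside:
  assumes "W \<in> L2_forms \<Omega> k"
  shows "restricts_to W (- \<Omega>) (\<lambda>y vs. 0)"
  using assms unfolding L2_forms_def by (auto simp: restricts_to.abs_eq)

lemma trimmed_spaceI:
  fixes W :: "'n::finite ae_form"
  assumes "W \<in> L2_forms \<Omega> k"
    and "\<And>T. T \<in> \<T> \<Longrightarrow> p T \<in> trimmed_forms org r k" "\<And>T. T \<in> \<T> \<Longrightarrow> restricts_to W T (p T)"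
    and "\<And>f T T'. f \<in> mesh_faces \<T> \<Longrightarrow> int k \<le> aff_dim f \<Longrightarrow> aff_dim f \<le> int CARD('n) - 1 \<Longrightarrow>
      T \<in> \<T> \<Longrightarrow> T' \<in> \<T> \<Longrightarrow> f \<subseteq> T \<Longrightarrow> f \<subseteq> T' \<Longrightarrow> same_trace k f (p T) (p T')"
  shows "W \<in> trimmed_space org \<Omega> \<T> r k"
  unfolding trimmed_space_def using assms by (intro CollectI conjI exI[of _ p]) simp_all

lemma trimmed_spaceE:
  fixes W :: "'n::finite ae_form"
  assumes "W \<in> trimmed_space org \<Omega> \<T> r k"
  obtains p where "W \<in> L2_forms \<Omega> k"
    and "\<And>T. T \<in> \<T> \<Longrightarrow> p T \<in> trimmed_forms org r k" "\<And>T. T \<in> \<T> \<Longrightarrow> restricts_to W T (p T)"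
    and "\<And>f T T'. f \<in> mesh_faces \<T> \<Longrightarrow> int k \<le> aff_dim f \<Longrightarrow> aff_dim f \<le> int CARD('n) - 1 \<Longrightarrow>
      T \<in> \<T> \<Longrightarrow> T' \<in> \<T> \<Longrightarrow> f \<subseteq> T \<Longrightarrow> f \<subseteq> T' \<Longrightarrow> same_trace k f (p T) (p T')"
proof -
  from assms obtain p where "W \<in> L2_forms \<Omega> k"
    "\<forall>T\<in>\<T>. p T \<in> trimmed_forms org r k \<and> restricts_to W T (p T)"
    "\<forall>f\<in>mesh_faces \<T>. int k \<le> aff_dim f \<and> aff_dim f \<le> int CARD('n) - 1 \<longrightarrow>
      (\<forall>T\<in>\<T>. \<forall>T'\<in>\<T>. f \<subseteq> T \<and> f \<subseteq> T' \<longrightarrow> same_trace k f (p T) (p T'))"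
    unfolding trimmed_space_def by (elim CollectE conjE exE)
  then show ?thesis by (intro that[of p]) simp_all
qed

lemma subspace_trimmed_space: "subspace (trimmed_space org \<Omega> \<T> r k)"
  unfolding subspace_def
proof (intro conjI ballI allI)
  show "0 \<in> trimmed_space org \<Omega> \<T> r k"
    by (rule trimmed_spaceI[where p = "\<lambda>T y vs. 0"])
      (simp_all add: same_trace_def L2_forms_zero trimmed_forms_zero restricts_to_zero)
next
  fix W W' assume W: "W \<in> trimmed_space org \<Omega> \<T> r k" and W': "W' \<in> trimmed_space org \<Omega> \<T> r k"
  obtain p where p: "W \<in> L2_forms \<Omega> k" "\<And>T. T \<in> \<T> \<Longrightarrow> p T \<in> trimmed_forms org r k"
    "\<And>T. T \<in> \<T> \<Longrightarrow> restricts_to W T (p T)"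
    "\<And>f T T'. f \<in> mesh_faces \<T> \<Longrightarrow> int k \<le> aff_dim f \<Longrightarrow> aff_dim f \<le> int CARD('a) - 1 \<Longrightarrow>
      T \<in> \<T> \<Longrightarrow> T' \<in> \<T> \<Longrightarrow> f \<subseteq> T \<Longrightarrow> f \<subseteq> T' \<Longrightarrow> same_trace k f (p T) (p T')"
    by (rule trimmed_spaceE[OF W]) (rule that)
  obtain p' where p': "W' \<in> L2_forms \<Omega> k" "\<And>T. T \<in> \<T> \<Longrightarrow> p' T \<in> trimmed_forms org r k"
    "\<And>T. T \<in> \<T> \<Longrightarrow> restricts_to W' T (p' T)"
    "\<And>f T T'. f \<in> mesh_faces \<T> \<Longrightarrow> int k \<le> aff_dim f \<Longrightarrow> aff_dim f \<le> int CARD('a) - 1 \<Longrightarrow>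
      T \<in> \<T> \<Longrightarrow> T' \<in> \<T> \<Longrightarrow> f \<subseteq> T \<Longrightarrow> f \<subseteq> T' \<Longrightarrow> same_trace k f (p' T) (p' T')"
    by (rule trimmed_spaceE[OF W']) (rule that)
  have add: "same_trace k f (\<lambda>y vs. p T y vs + p' T y vs) (\<lambda>y vs. p T' y vs + p' T' y vs)"
    if "same_trace k f (p T) (p T')" "same_trace k f (p' T) (p' T')" for f T T'
    using that by (simp add: same_trace_def)
  show "W + W' \<in> trimmed_space org \<Omega> \<T> r k"
    by (rule trimmed_spaceI[where p = "\<lambda>T y vs. p T y vs + p' T y vs"])
      (rule L2_forms_add trimmed_forms_add restricts_to_add add p p' | assumption)+
next
  fix W c assume W: "W \<in> trimmed_space org \<Omega> \<T> r k"
  obtain p where p: "W \<in> L2_forms \<Omega> k" "\<And>T. T \<in> \<T> \<Longrightarrow> p T \<in> trimmed_forms org r k"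
    "\<And>T. T \<in> \<T> \<Longrightarrow> restricts_to W T (p T)"
    "\<And>f T T'. f \<in> mesh_faces \<T> \<Longrightarrow> int k \<le> aff_dim f \<Longrightarrow> aff_dim f \<le> int CARD('a) - 1 \<Longrightarrow>
      T \<in> \<T> \<Longrightarrow> T' \<in> \<T> \<Longrightarrow> f \<subseteq> T \<Longrightarrow> f \<subseteq> T' \<Longrightarrow> same_trace k f (p T) (p T')"
    by (rule trimmed_spaceE[OF W]) (rule that)
  have scale: "same_trace k f (\<lambda>y vs. c * p T y vs) (\<lambda>y vs. c * p T' y vs)"
    if "same_trace k f (p T) (p T')" for f T T'
    using that by (simp add: same_trace_def)
  show "c *\<^sub>R W \<in> trimmed_space org \<Omega> \<T> r k"
    by (rule trimmed_spaceI[where p = "\<lambda>T y vs. c * p T y vs"])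
      (rule L2_forms_scale trimmed_forms_scale restricts_to_scale scale p | assumption)+
qed

section \<open>Null sets, interiors and square integrability on the mesh\<close>

context simplicial_mesh
begin

text \<open>An open subset of the frontier misses the open set \<Omega>, hence also its closure, so
  it is empty. The polytopes covering the frontier are therefore convex sets without interior, and
  such sets are null.\<close>

lemma negligible_frontier_domain: "negligible (frontier \<Omega>)"
proof -
  obtain \<F> where \<F>: "finite \<F>" "\<And>P. P \<in> \<F> \<Longrightarrow> polytope P" "frontier \<Omega> = \<Union>\<F>" and op: "open \<Omega>"
    using domain unfolding bounded_polyhedral_domain_def by blast
  have "interior (frontier \<Omega>) \<inter> closure \<Omega> = {}"
    using op open_Int_closure_eq_empty[of "interior (frontier \<Omega>)" \<Omega>] interior_subset[of "frontier \<Omega>"]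
    by (auto simp: frontier_def interior_open)
  then have "interior (frontier \<Omega>) = {}"
    using interior_subset[of "frontier \<Omega>"] by (auto simp: frontier_def)
  have "negligible P" if "P \<in> \<F>" for P
  proof -
    have "interior P \<subseteq> interior (frontier \<Omega>)" using \<F>(3) that by (intro interior_mono) auto
    then show ?thesis
      using negligible_convex_interior[OF polytope_imp_convex[OF \<F>(2)[OF that]]]
        \<open>interior (frontier \<Omega>) = {}\<close> by auto
  qed
  then show ?thesis unfolding \<F>(3) using \<F>(1) by (intro negligible_Union) auto
qed

lemma mesh_cover: "\<Union>(insert (- \<Omega>) \<T>) = UNIV"
  using mesh closure_subset[of \<Omega>] by (auto simp: simplicial_triangulation_def)

text \<open>Otherwise the whole space would be bounded. This keeps the outer piece
  \<open>- \<Omega>\<close> apart from the simplices when forms are assigned to the pieces of the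
  cover.\<close>

lemma mesh_ne_complement: "T \<in> \<T> \<Longrightarrow> T \<noteq> - \<Omega>"
proof
  assume T: "T \<in> \<T>" "T = - \<Omega>"
  have "bounded (T \<union> \<Omega>)"
    using domain mesh_convex_compact(2)[OF T(1)] by (auto simp: bounded_polyhedral_domain_def compact_imp_bounded)
  then show False using T(2) by simp
qed

lemma interior_disjoint:
  assumes "T \<in> \<T>" "T' \<in> \<T>" "y \<in> interior T" "y \<in> interior T'"
  shows "T = T'"
proof -
  have I: "T \<inter> T' face_of T" "T' \<inter> T face_of T'"
    using mesh assms unfolding simplicial_triangulation_def triangulation_def by auto
  have y: "y \<in> T" "y \<in> T'" using assms interior_subset by blast+
  have "T \<inter> T' = T" "T' \<inter> T = T'"
    using face_of_disjoint_interior[OF I(1)] face_of_disjoint_interior[OF I(2)] assms(3,4) y by blast+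
  then show ?thesis by blast
qed

lemma interior_mesh_nonempty:
  assumes "T \<in> \<T>"
  shows "interior T \<noteq> {}"
proof -
  have "aff_dim T = int CARD('n)"
    using mesh assms aff_dim_simplex unfolding simplicial_triangulation_def by blast
  then show ?thesis
    using interior_rel_interior_gen[of T] rel_interior_eq_empty[of T] mesh_convex_compact[OF assms] by simp
qed

lemma restricts_to_piecewise_form:
  assumes T: "T \<in> \<T>"
  shows "restricts_to (piecewise_form \<T> p) T (p T)"
  unfolding piecewise_form_def restricts_to.abs_eq
proof -
  have "AE y in lebesgue. y \<notin> frontier T"
    using negligible_convex_frontier mesh_convex_compact(1)[OF T] by (intro AE_not_in_negligible) auto
  then show "AE y in lebesgue. y \<in> T \<longrightarrow> (\<lambda>vs. \<Sum>T | T \<in> \<T> \<and> y \<in> interior T. p T y vs) = p T y"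
  proof (rule eventually_mono, intro impI)
    fix y assume "y \<notin> frontier T" "y \<in> T"
    then have "y \<in> interior T" using closure_subset by (auto simp: frontier_def)
    then have "{T. T \<in> \<T> \<and> y \<in> interior T} = {T}" using T interior_disjoint by blast
    then show "(\<lambda>vs. \<Sum>T | T \<in> \<T> \<and> y \<in> interior T. p T y vs) = p T y" by simp
  qed
qed

lemma piecewise_form_in_L2_forms:
  assumes alt: "\<And>T y. T \<in> \<T> \<Longrightarrow> alt_form k (p T y)"
    and cont: "\<And>T vs. T \<in> \<T> \<Longrightarrow> continuous_on UNIV (\<lambda>y. p T y vs)"
  shows "piecewise_form \<T> p \<in> L2_forms \<Omega> k"
proof -
  \<comment> \<open>A representative for \<open>L2_forms\<close> has to vanish at every point
    outside \<Omega>. The interior of a simplex may meet the frontier of \<Omega>, for instance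
    along a slit, so the indicator includes \<Omega>; only values on a null set change.\<close>
  define \<omega> where "\<omega> y vs = (\<Sum>T\<in>\<T>. indicator (interior T \<inter> \<Omega>) y * p T y vs)" for y vs
  have op: "open \<Omega>" and bd: "bounded \<Omega>" using domain by (auto simp: bounded_polyhedral_domain_def)
  have eq: "\<omega> y vs = (\<Sum>T | T \<in> \<T> \<and> y \<in> interior T. p T y vs)" if "y \<in> \<Omega>" for y vs
    unfolding \<omega>_def sum.inter_filter[OF finite_mesh]
    by (rule sum.cong) (use that in \<open>auto simp: indicator_def\<close>)
  have out: "\<omega> y = (\<lambda>vs. 0)" if "y \<notin> \<Omega>" for y
    using that by (auto simp: \<omega>_def)
  have "AE y in lebesgue. \<omega> y = (\<lambda>vs. \<Sum>T | T \<in> \<T> \<and> y \<in> interior T. p T y vs)"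
    using AE_not_in_negligible[OF negligible_frontier_domain]
  proof (rule eventually_mono)
    fix y assume y: "y \<notin> frontier \<Omega>"
    show "\<omega> y = (\<lambda>vs. \<Sum>T | T \<in> \<T> \<and> y \<in> interior T. p T y vs)"
    proof (cases "y \<in> \<Omega>")
      case True
      then show ?thesis using eq by auto
    next
      case False
      then have "y \<notin> closure \<Omega>" using y op by (auto simp: frontier_def interior_open)
      then have "y \<notin> interior T" if "T \<in> \<T>" for T
        using mesh that interior_subset[of T] by (auto simp: simplicial_triangulation_def)
      then have "{T. T \<in> \<T> \<and> y \<in> interior T} = {}" by blast
      then show ?thesis by (simp only: out[OF False] sum.empty)
    qed
  qed
  then have W: "piecewise_form \<T> p = abs_ae_form \<omega>"
    unfolding piecewise_form_def by (intro ae_form.abs_eq_iff[THEN iffD2]) (auto elim: eventually_mono)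
  have meas: "(\<lambda>y. \<omega> y vs) \<in> borel_measurable lebesgue" for vs
  proof -
    have "(\<lambda>y. p T y vs) \<in> borel_measurable lebesgue" if "T \<in> \<T>" for T
      using borel_measurable_continuous_onI[OF cont[OF that]] by (simp add: measurable_completion)
    moreover have "interior T \<inter> \<Omega> \<in> sets lebesgue" for T
      using op by (auto intro!: borel_open sets_completionI_sets)
    ultimately show ?thesis unfolding \<omega>_def
      by (intro borel_measurable_sum borel_measurable_times borel_measurable_indicator) auto
  qed
  have int: "integrable lebesgue (\<lambda>y. (\<omega> y vs)\<^sup>2)" for vs
  proof -
    \<comment> \<open>Square integrability comes from a uniform bound: the forms are continuous and
      the closure of \<Omega> is compact.\<close>
    have "\<exists>M. \<forall>y\<in>closure \<Omega>. \<bar>p T y vs\<bar> \<le> M" if "T \<in> \<T>" for T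
    proof -
      have "compact ((\<lambda>y. p T y vs) ` closure \<Omega>)"
        using bd by (intro compact_continuous_image continuous_on_subset[OF cont[OF that]]) auto
      then show ?thesis using compact_imp_bounded bounded_real by (metis imageI)
    qed
    then obtain M where M: "\<And>T y. T \<in> \<T> \<Longrightarrow> y \<in> closure \<Omega> \<Longrightarrow> \<bar>p T y vs\<bar> \<le> M T" by metis
    have bound: "\<bar>\<omega> y vs\<bar> \<le> (\<Sum>T\<in>\<T>. \<bar>M T\<bar>) * indicator \<Omega> y" for y
    proof (cases "y \<in> \<Omega>")
      case True
      have "\<bar>\<omega> y vs\<bar> \<le> (\<Sum>T\<in>\<T>. \<bar>indicator (interior T \<inter> \<Omega>) y * p T y vs\<bar>)"
        unfolding \<omega>_def by (rule sum_abs)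
      also have "\<dots> \<le> (\<Sum>T\<in>\<T>. \<bar>M T\<bar>)"
      proof (rule sum_mono)
        fix T assume "T \<in> \<T>"
        then have "\<bar>p T y vs\<bar> \<le> \<bar>M T\<bar>" using M[of T y] True closure_subset[of \<Omega>] by fastforce
        then show "\<bar>indicator (interior T \<inter> \<Omega>) y * p T y vs\<bar> \<le> \<bar>M T\<bar>"
          by (auto simp: indicator_def)
      qed
      finally show ?thesis using True by simp
    qed (simp add: out)
    show ?thesis
    proof (rule Bochner_Integration.integrable_bound)
      have "emeasure lebesgue \<Omega> < \<infinity>"
        using emeasure_bounded_finite[OF bd] op by simp
      then show "integrable lebesgue (\<lambda>y. (\<Sum>T\<in>\<T>. \<bar>M T\<bar>)\<^sup>2 * indicator \<Omega> y)"
        using op by (intro integrable_mult_right integrable_real_indicator) auto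
      show "(\<lambda>y. (\<omega> y vs)\<^sup>2) \<in> borel_measurable lebesgue" using meas by measurable
      have "(\<omega> y vs)\<^sup>2 \<le> (\<Sum>T\<in>\<T>. \<bar>M T\<bar>)\<^sup>2 * indicator \<Omega> y" for y
        using power_mono[OF bound[of y], of 2]
        by (auto simp: power_mult_distrib indicator_def split: if_splits)
      then show "AE y in lebesgue. norm ((\<omega> y vs)\<^sup>2) \<le> norm ((\<Sum>T\<in>\<T>. \<bar>M T\<bar>)\<^sup>2 * indicator \<Omega> y)"
        by simp
    qed
  qed
  have "alt_form k (\<omega> y)" for y
    unfolding \<omega>_def by (intro alt_form_sum alt_form_scale alt)
  then show ?thesis unfolding W L2_forms_def using out meas int by (intro imageI CollectI) auto
qed

subsection \<open>The global basis\<close>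

text \<open>The restriction of \<open>omega_form\<close> to \<open>T\<close>, rewritten through the
  code so that the results on one simplex apply.\<close>

definition local_form :: "nat \<Rightarrow> (real ^ 'n) set \<times> (nat \<Rightarrow> nat) \<times> (nat \<Rightarrow> nat) \<Rightarrow> (real ^ 'n) set \<Rightarrow> 'n diff_form" where
  "local_form k q T y vs =
    (if fst q \<subseteq> T then mon T (fst (code q k)) y * phi T (sorted_list_of_set (snd (code q k))) y vs else 0)"

lemma omega_form_eq_piecewise:
  assumes "q \<in> omega_indices x N \<T> r k"
  shows "omega_form x N \<T> k q = piecewise_form \<T> (local_form k q)"
proof -
  obtain f \<alpha> \<sigma> where q: "q = (f, \<alpha>, \<sigma>)" by (metis prod_cases3)
  note D = omega_indicesD[OF assms[unfolded q]]
  have *: "(if f \<subseteq> T then (\<Prod>i\<in>V f. lam T i y ^ \<alpha> i) * whitney_form x N T k \<sigma> y vs else 0)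
      = local_form k q T y vs" if T: "T \<in> \<T>" for T y vs
  proof (cases "f \<subseteq> T")
    case True
    interpret B: barycentric_coords "V T" x "lam T" by (rule barycentric_coords_mesh[OF T])
    have "V f \<subseteq> V T" using subset_iff_V[OF D(1) mesh_subset_faces[OF T]] True by simp
    then have "B.mon (fst (code q k)) y = (\<Prod>i\<in>V f. lam T i y ^ fst (code q k) i)"
      unfolding B.mon_def
      by (intro prod.mono_neutral_right) (use finite_V in \<open>auto simp: q code_def\<close>)
    also have "\<dots> = (\<Prod>i\<in>V f. lam T i y ^ \<alpha> i)"
      by (rule prod.cong) (auto simp: q code_def)
    finally have "B.mon (fst (code q k)) y = (\<Prod>i\<in>V f. lam T i y ^ \<alpha> i)" .
    moreover have "snd (code q k) = \<sigma> ` {0..k}" by (simp add: q code_def)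
    ultimately show ?thesis
      using True whitney_form_eq_phi[OF T] D(5) by (simp add: local_form_def q del: upt_Suc)
  qed (simp add: local_form_def q)
  show ?thesis
    unfolding q omega_form_def piecewise_form_def prod.case
    by (intro arg_cong[of _ _ abs_ae_form] ext sum.cong) (auto simp: *[unfolded q])
qed

lemma local_form_code:
  assumes "q \<in> omega_indices x N \<T> r k" "T \<in> \<T>" "fst q \<subseteq> T"
  shows "fst (code q k) \<in> multi_indices (r - 1) (V T)" "snd (code q k) \<subseteq> V T"
    "card (snd (code q k)) = Suc k"
proof -
  obtain f \<alpha> \<sigma> where q: "q = (f, \<alpha>, \<sigma>)" by (metis prod_cases3)
  note D = omega_indicesD[OF assms(1)[unfolded q]]
  have V: "V f \<subseteq> V T" using subset_iff_V[OF D(1) mesh_subset_faces[OF assms(2)]] assms(3) q by simp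
  have "(\<Sum>i\<in>V T. fst (code q k) i) = (\<Sum>i\<in>V f. fst (code q k) i)"
    by (rule sum.mono_neutral_right) (use V finite_V D(2) q in \<open>auto simp: multi_indices_def\<close>)
  then show "fst (code q k) \<in> multi_indices (r - 1) (V T)"
    using D(2) V q by (auto simp: multi_indices_def)
  have c: "snd (code q k) = \<sigma> ` {0..k}" by (simp add: q code_def)
  show "snd (code q k) \<subseteq> V T" unfolding c using D(3) V by (rule order_trans)
  show "card (snd (code q k)) = Suc k" unfolding c by (rule D(4))
qed

lemma local_form_props:
  assumes q: "q \<in> omega_indices x N \<T> r k" and T: "T \<in> \<T>"
  shows "local_form k q T \<in> trimmed_forms org r k" "alt_form k (local_form k q T y)"
    "continuous_on UNIV (\<lambda>y. local_form k q T y vs)"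
proof -
  interpret B: barycentric_coords "V T" x "lam T" by (rule barycentric_coords_mesh[OF T])
  let ?a = "fst (code q k)" and ?s = "sorted_list_of_set (snd (code q k))"
  have "local_form k q T \<in> trimmed_forms org r k \<and> alt_form k (local_form k q T y) \<and>
    continuous_on UNIV (\<lambda>y. local_form k q T y vs)"
  proof (cases "fst q \<subseteq> T")
    case True
    note c = local_form_code[OF q T True]
    have "finite (snd (code q k))" using c(2) finite_V finite_subset by blast
    then have s: "set ?s \<subseteq> V T" "length ?s = Suc k" using c by auto
    have "local_form k q T = (\<lambda>y vs. B.mon ?a y * B.phi ?s y vs)"
      using True by (auto simp: local_form_def fun_eq_iff)
    then show ?thesis
      using B.mon_phi_in_trimmed_forms[OF _ s, of ?a r org] c(1)
        alt_form_scale[OF B.alt_form_phi[OF s]]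
        continuous_on_mult[OF B.continuous_mon B.continuous_phi[OF s(1)]]
      by (auto simp: multi_indices_def)
  next
    case False
    then have "local_form k q T = (\<lambda>y vs. 0)" by (auto simp: local_form_def fun_eq_iff)
    then show ?thesis by (auto simp: trimmed_forms_zero alt_form_zero)
  qed
  then show "local_form k q T \<in> trimmed_forms org r k" "alt_form k (local_form k q T y)"
    "continuous_on UNIV (\<lambda>y. local_form k q T y vs)" by auto
qed

text \<open>If the face of \<open>q\<close> lies in \<open>g\<close>, both simplices contain it and
  the form on \<open>g\<close> depends only on coordinates of \<open>g\<close>. Otherwise some
  vertex of that face is off \<open>g\<close>, and the trace is zero from either side, whether or
  not the simplex contains the face.\<close>

lemma local_form_same_trace:
  assumes q: "q \<in> omega_indices x N \<T> r k" and T: "T \<in> \<T>" "T' \<in> \<T>"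
    and g: "g \<in> mesh_faces \<T>" "g \<subseteq> T" "g \<subseteq> T'"
  shows "same_trace k g (local_form k q T) (local_form k q T')"
  unfolding same_trace_def
proof (intro ballI allI impI)
  fix y vs assume y: "y \<in> g" and vs: "length vs = k \<and> set vs \<subseteq> tangent_space g"
  obtain f \<alpha> \<sigma> where qf: "q = (f, \<alpha>, \<sigma>)" by (metis prod_cases3)
  note D = omega_indicesD[OF q[unfolded qf]]
  have hull: "g = convex hull (x ` V g)" by (rule mesh_face_hull[OF g(1)])
  have y': "y \<in> convex hull (x ` V g)" using y hull by simp
  have vs': "set vs \<subseteq> tangent_space (convex hull (x ` V g))" using vs hull by simp
  have Vg: "V g \<subseteq> V T" if "T \<in> \<T>" "g \<subseteq> T" for T
    using subset_iff_V[OF g(1) mesh_subset_faces[OF that(1)]] that(2) by simp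
  show "local_form k q T y vs = local_form k q T' y vs"
  proof (cases "f \<subseteq> g")
    case True
    then have Vf: "V f \<subseteq> V g" using subset_iff_V[OF D(1) g(1)] by simp
    have "mon T (fst (code q k)) y * phi T (sorted_list_of_set (snd (code q k))) y vs =
        mon T' (fst (code q k)) y * phi T' (sorted_list_of_set (snd (code q k))) y vs"
    proof (rule mon_phi_trace_eq[OF T Vg[OF T(1) g(2)] Vg[OF T(2) g(3)] y' vs'])
      show "snd (code q k) \<subseteq> V g" using D(3) Vf by (auto simp: qf code_def)
      show "fst (code q k) i = 0" if "i \<notin> V g" for i using that Vf by (auto simp: qf code_def)
    qed
    then show ?thesis using True g by (auto simp: local_form_def qf)
  next
    case False
    have zero: "local_form k q T y vs = 0" if T: "T \<in> \<T>" "g \<subseteq> T" for T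
    proof (cases "f \<subseteq> T")
      case True
      have "\<not> V f \<subseteq> V g" using False subset_iff_V[OF D(1) g(1)] by simp
      then obtain i where i: "i \<in> V f" "i \<notin> V g" by blast
      have "i \<in> V T" using i(1) subset_iff_V[OF D(1) mesh_subset_faces[OF T(1)]] True by blast
      moreover have "fst (code q k) i > 0 \<or> i \<in> snd (code q k)"
        using i(1) by (subst (asm) D(6)) (auto simp: qf code_def)
      ultimately have "mon T (fst (code q k)) y * phi T (sorted_list_of_set (snd (code q k))) y vs = 0"
        using mon_phi_trace_zero[OF T(1) Vg[OF T] y' vs'] local_form_code(2)[OF q T(1)] i True
        by (auto simp: qf)
      then show ?thesis by (simp add: local_form_def)
    qed (simp add: local_form_def qf)
    show ?thesis using zero[OF T(1) g(2)] zero[OF T(2) g(3)] by simp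
  qed
qed

lemma omega_form_in_trimmed_space:
  assumes q: "q \<in> omega_indices x N \<T> r k"
  shows "omega_form x N \<T> k q \<in> trimmed_space org \<Omega> \<T> r k"
  unfolding omega_form_eq_piecewise[OF q]
proof (rule trimmed_spaceI[where p = "local_form k q"])
  show "piecewise_form \<T> (local_form k q) \<in> L2_forms \<Omega> k"
    by (intro piecewise_form_in_L2_forms local_form_props[OF q])
qed (use local_form_props(1)[OF q] restricts_to_piecewise_form local_form_same_trace[OF q] in auto)

lemma omega_form_outside:
  assumes "q \<in> omega_indices x N \<T> r k"
  shows "restricts_to (omega_form x N \<T> k q) (- \<Omega>) (\<lambda>y vs. 0)"
\<comment> \<open>Only membership in \<open>L2_forms\<close> is extracted, so the origin is a
  dummy.\<close>
proof (rule trimmed_spaceE[OF omega_form_in_trimmed_space[OF assms, of undefined]])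
  assume "omega_form x N \<T> k q \<in> L2_forms \<Omega> k"
  then show ?thesis by (rule L2_forms_outside)
qed

lemma basis_subset_omega: "basis_indices x N \<T> r k \<subseteq> omega_indices x N \<T> r k"
  by (auto simp: basis_indices_def)

lemma finite_basis_indices: "finite (basis_indices x N \<T> r k)"
proof -
  have "basis_indices x N \<T> r k \<subseteq> (\<Union>T\<in>\<T>. {q \<in> basis_indices x N \<T> r k. fst q \<subseteq> T})"
  proof
    fix q assume q: "q \<in> basis_indices x N \<T> r k"
    then have "fst q \<in> mesh_faces \<T>" by (auto simp: basis_indices_def omega_indices_def)
    then obtain T where "T \<in> \<T>" "fst q \<subseteq> T"
      by (auto simp: mesh_faces_def dest: face_of_imp_subset)
    then show "q \<in> (\<Union>T\<in>\<T>. {q \<in> basis_indices x N \<T> r k. fst q \<subseteq> T})" using q by blast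
  qed
  moreover have "finite {q \<in> basis_indices x N \<T> r k. fst q \<subseteq> T}" if "T \<in> \<T>" for T
    using bij_betw_finite[OF code_bij[OF mesh_subset_faces[OF that]]]
      finite_whitney_indices[OF finite_V] by blast
  ultimately show ?thesis using finite_mesh by (auto intro: finite_subset)
qed

text \<open>Triples whose face is not contained in \<open>T\<close> contribute zero there, and the
  codes of the others run through the reduced pairs of \<open>T\<close>.\<close>

lemma local_sum_reindex:
  assumes "T \<in> \<T>"
  shows "(\<Sum>q\<in>basis_indices x N \<T> r k. c (code q k) * local_form k q T y vs) =
    (\<Sum>p\<in>whitney_indices (r - 1) k (V T). c p * (mon T (fst p) y * phi T (sorted_list_of_set (snd p)) y vs))"
proof -
  let ?B = "{q \<in> basis_indices x N \<T> r k. fst q \<subseteq> T}"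
  have "(\<Sum>q\<in>basis_indices x N \<T> r k. c (code q k) * local_form k q T y vs) =
      (\<Sum>q\<in>?B. c (code q k) * local_form k q T y vs)"
    by (rule sum.mono_neutral_right) (auto simp: finite_basis_indices local_form_def)
  also have "\<dots> = (\<Sum>q\<in>?B. c (code q k) * (mon T (fst (code q k)) y *
      phi T (sorted_list_of_set (snd (code q k))) y vs))"
    by (rule sum.cong) (auto simp: local_form_def)
  also have "\<dots> = (\<Sum>p\<in>whitney_indices (r - 1) k (V T). c p * (mon T (fst p) y * phi T (sorted_list_of_set (snd p)) y vs))"
    by (rule sum.reindex_bij_betw[OF code_bij[OF mesh_subset_faces[OF assms]]])
  finally show ?thesis .
qed

lemma restricts_to_omega_sum:
  assumes "T \<in> \<T>"
  shows "restricts_to (\<Sum>q\<in>basis_indices x N \<T> r k. c q *\<^sub>R omega_form x N \<T> k q) T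
    (\<lambda>y vs. \<Sum>q\<in>basis_indices x N \<T> r k. c q * local_form k q T y vs)"
proof (intro restricts_to_sum restricts_to_scale)
  fix q assume "q \<in> basis_indices x N \<T> r k"
  then have "q \<in> omega_indices x N \<T> r k" using basis_subset_omega by blast
  then show "restricts_to (omega_form x N \<T> k q) T (local_form k q T)"
    using omega_form_eq_piecewise restricts_to_piecewise_form[OF assms] by metis
qed

lemma omega_basis_independent:
  "inj_on (omega_form x N \<T> k) (basis_indices x N \<T> r k) \<and>
   independent (omega_form x N \<T> k ` basis_indices x N \<T> r k)"
proof (rule independent_family[OF finite_basis_indices])
  let ?B = "basis_indices x N \<T> r k"
  fix c q
  assume sum0: "(\<Sum>q\<in>?B. c q *\<^sub>R omega_form x N \<T> k q) = 0" and q: "q \<in> ?B"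
  have "fst q \<in> mesh_faces \<T>" using q by (auto simp: basis_indices_def omega_indices_def)
  then obtain T where T: "T \<in> \<T>" "fst q \<subseteq> T"
    by (auto simp: mesh_faces_def dest: face_of_imp_subset)
  interpret B: barycentric_coords "V T" x "lam T" by (rule barycentric_coords_mesh[OF T(1)])
  \<comment> \<open>The coefficients are moved from triples to codes, the form in which independence
    on a single simplex applies.\<close>
  define d where "d p = c (the_inv_into ?B (\<lambda>q. code q k) p)" for p
  have inj: "inj_on (\<lambda>q. code q k) ?B" by (rule inj_on_subset[OF code_inj basis_subset_omega])
  have d: "d (code q k) = c q" if "q \<in> ?B" for q
    unfolding d_def using the_inv_into_f_f[OF inj that] by simp
  have "d (code q k) = 0"
  proof (rule B.whitney_independent_on_face[OF subset_refl])
    show "code q k \<in> whitney_indices (r - 1) k (V T)"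
      using bij_betwE[OF code_bij[OF mesh_subset_faces[OF T(1)]]] q T(2) by blast
    fix y js assume y: "y \<in> convex hull (x ` V T)"
    let ?vs = "map (\<lambda>j. x j - y) js"
    \<comment> \<open>The relation holds for classes; continuity makes it an identity at every point
      of \<open>T\<close>.\<close>
    have "(\<Sum>q\<in>?B. c q * local_form k q T y ?vs) = 0"
    proof (rule restricts_to_continuous_eq[where p' = "\<lambda>y vs. 0" and vs = ?vs,
          OF restricts_to_omega_sum[where c = c and r = r and k = k, OF T(1)]])
      show "restricts_to (\<Sum>q\<in>?B. c q *\<^sub>R omega_form x N \<T> k q) T (\<lambda>y vs. 0)"
        unfolding sum0 by (rule restricts_to_zero)
      show "convex T" "interior T \<noteq> {}"
        using mesh_convex_compact[OF T(1)] interior_mesh_nonempty[OF T(1)] by auto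
      show "y \<in> T" using y mesh_vertex_set(3)[OF T(1)] by simp
      show "continuous_on UNIV (\<lambda>y. \<Sum>q\<in>?B. c q * local_form k q T y ?vs)"
        by (intro continuous_intros local_form_props(3)[OF _ T(1)]) (use basis_subset_omega in blast)
    qed simp
    then have "(\<Sum>q\<in>?B. d (code q k) * local_form k q T y ?vs) = 0"
      by (simp add: d cong: sum.cong)
    then show "(\<Sum>p\<in>whitney_indices (r - 1) k (V T). d p *
        (B.mon (fst p) y * B.phi (sorted_list_of_set (snd p)) y ?vs)) = 0"
      unfolding local_sum_reindex[OF T(1)] .
  qed
  then show "c q = 0" using d[OF q] by simp
qed

text \<open>Every reduced pair of \<open>T\<close> that is not a reduced pair of \<open>J\<close>
  involves a vertex off the face, and its trace is zero.\<close>

lemma trace_sum: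
  assumes T: "T \<in> \<T>" and J: "J \<subseteq> V T" and y: "y \<in> convex hull (x ` J)"
    and vs: "set vs \<subseteq> tangent_space (convex hull (x ` J))"
  shows "(\<Sum>p\<in>whitney_indices d k (V T). c p * (mon T (fst p) y * phi T (sorted_list_of_set (snd p)) y vs)) =
    (\<Sum>p\<in>whitney_indices d k J. c p * (mon T (fst p) y * phi T (sorted_list_of_set (snd p)) y vs))"
proof (rule sum.mono_neutral_right)
  show "finite (whitney_indices d k (V T))" by (rule finite_whitney_indices[OF finite_V])
  have sum: "(\<Sum>i\<in>V T. a i) = (\<Sum>i\<in>J. a i)" if "\<And>i. i \<notin> J \<Longrightarrow> a i = 0" for a :: "nat \<Rightarrow> nat"
    by (rule sum.mono_neutral_right) (use that J finite_V in auto)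
  show "whitney_indices d k J \<subseteq> whitney_indices d k (V T)"
    using J sum by (auto simp: whitney_indices_def multi_indices_def)
  show "\<forall>p\<in>whitney_indices d k (V T) - whitney_indices d k J.
      c p * (mon T (fst p) y * phi T (sorted_list_of_set (snd p)) y vs) = 0"
  proof
    fix p assume p: "p \<in> whitney_indices d k (V T) - whitney_indices d k J"
    obtain a S where aS: "p = (a, S)" by (cases p)
    have "\<exists>i. i \<in> V T - J \<and> (a i > 0 \<or> i \<in> S)"
    proof (rule ccontr)
      assume no: "\<not> ?thesis"
      then have "a i = 0" if "i \<notin> J" for i
        using that p by (cases "i \<in> V T") (auto simp: aS whitney_indices_def multi_indices_def)
      moreover have "S \<subseteq> J" using no p by (auto simp: aS whitney_indices_def)
      ultimately have "p \<in> whitney_indices d k J"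
        using p sum[of a] by (auto simp: aS whitney_indices_def multi_indices_def)
      then show False using p by simp
    qed
    then obtain i where i: "i \<in> V T - J" "a i > 0 \<or> i \<in> S" by blast
    have "S \<subseteq> V T" using p by (auto simp: aS whitney_indices_def)
    from mon_phi_trace_zero[where a = a and i = i and S = S, OF T J y vs this i]
    show "c p * (mon T (fst p) y * phi T (sorted_list_of_set (snd p)) y vs) = 0" by (simp add: aS)
  qed
qed

lemma trimmed_space_subset_span:
  assumes "W \<in> trimmed_space org \<Omega> \<T> r k"
  shows "W \<in> span (omega_form x N \<T> k ` basis_indices x N \<T> r k)"
proof -
  let ?B = "basis_indices x N \<T> r k"
  let ?I = "\<lambda>J. whitney_indices (r - 1) k J"
  obtain p where L2: "W \<in> L2_forms \<Omega> k"
    and p: "\<And>T. T \<in> \<T> \<Longrightarrow> p T \<in> trimmed_forms org r k" "\<And>T. T \<in> \<T> \<Longrightarrow> restricts_to W T (p T)"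
    and tr: "\<And>f T T'. f \<in> mesh_faces \<T> \<Longrightarrow> int k \<le> aff_dim f \<Longrightarrow> aff_dim f \<le> int CARD('n) - 1 \<Longrightarrow>
      T \<in> \<T> \<Longrightarrow> T' \<in> \<T> \<Longrightarrow> f \<subseteq> T \<Longrightarrow> f \<subseteq> T' \<Longrightarrow> same_trace k f (p T) (p T')"
    by (rule trimmed_spaceE[OF assms]) (rule that)
  have "\<forall>T\<in>\<T>. \<exists>c. \<forall>y vs. p T y vs =
      (\<Sum>q\<in>?I (V T). c q * (mon T (fst q) y * phi T (sorted_list_of_set (snd q)) y vs))"
  proof
    fix T assume T: "T \<in> \<T>"
    interpret B: barycentric_coords "V T" x "lam T" by (rule barycentric_coords_mesh[OF T])
    show "\<exists>c. \<forall>y vs. p T y vs =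
      (\<Sum>q\<in>?I (V T). c q * (mon T (fst q) y * phi T (sorted_list_of_set (snd q)) y vs))"
      using B.trimmed_forms_in_whitney_span[OF p(1)[OF T]] unfolding B.whitney_span_def by (rule CollectD)
  qed
  then obtain c where "\<forall>T\<in>\<T>. \<forall>y vs. p T y vs =
      (\<Sum>q\<in>?I (V T). c T q * (mon T (fst q) y * phi T (sorted_list_of_set (snd q)) y vs))"
    by (rule bchoice[THEN exE])
  note c = this[rule_format]
  \<comment> \<open>The local expansions are glued here: a pair reduced on both simplices is
    supported on their common vertices, and independence of the traces on the common face identifies
    its two coefficients.\<close>
  have consistent: "c T q = c T' q"
    if T: "T \<in> \<T>" "T' \<in> \<T>" and q: "q \<in> ?I (V T)" "q \<in> ?I (V T')" for T T' q
  proof (cases "T = T'")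
    case False
    define J where "J = V T \<inter> V T'"
    define g where "g = convex hull (x ` J)"
    have J: "J \<subseteq> V T" "J \<subseteq> V T'" by (auto simp: J_def)
    have finJ: "finite J" using J(1) finite_V finite_subset by blast
    have qJ: "q \<in> ?I J"
    proof -
      obtain a S where aS: "q = (a, S)" by (cases q)
      have "(\<Sum>i\<in>V T. a i) = (\<Sum>i\<in>J. a i)"
        by (rule sum.mono_neutral_right)
          (use q finite_V in \<open>auto simp: J_def aS whitney_indices_def multi_indices_def\<close>)
      then show ?thesis using q by (auto simp: J_def aS whitney_indices_def multi_indices_def)
    qed
    have S: "snd q \<subseteq> J" "card (snd q) = Suc k" using qJ by (auto simp: whitney_indices_def)
    then have neJ: "J \<noteq> {}" by auto
    \<comment> \<open>The set of the pair already has k + 1 elements, so the common face has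
      dimension at least k. The upper bound n - 1 comes from \<open>J \<noteq> V T\<close>, since
      simplices with equal vertex sets coincide.\<close>
    have cardJ: "Suc k \<le> card J" using card_mono[OF finJ S(1)] S(2) by simp
    have "J \<noteq> V T"
    proof
      assume "J = V T"
      then have "V T \<subseteq> V T'" by (auto simp: J_def)
      then have "V T = V T'"
        using mesh_vertex_set(2)[OF T(1)] mesh_vertex_set(2)[OF T(2)] finite_V card_subset_eq by metis
      then show False using False mesh_vertex_set(3) T by metis
    qed
    then have "card J < Suc CARD('n)"
      using psubset_card_mono[OF finite_V[of T], of J] J(1) mesh_vertex_set(2)[OF T(1)] by auto
    note g = face_of_vertices[OF T(1) J(1) neJ, folded g_def]
    have gT: "g \<subseteq> T" "g \<subseteq> T'"
      using subset_iff_V[OF g(1) mesh_subset_faces[OF T(1)]] subset_iff_V[OF g(1) mesh_subset_faces[OF T(2)]]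
        g(2) J by auto
    have trace: "same_trace k g (p T) (p T')"
      using cardJ \<open>card J < Suc CARD('n)\<close> g(3) by (intro tr g(1) T gT) auto
    interpret B: barycentric_coords "V T" x "lam T" by (rule barycentric_coords_mesh[OF T(1)])
    have "c T q - c T' q = 0"
    proof (rule B.whitney_independent_on_face[OF J(1) _ qJ])
      fix y js assume y: "y \<in> convex hull (x ` J)" and js: "set js \<subseteq> J" "length js = k"
      let ?vs = "map (\<lambda>j. x j - y) js"
      \<comment> \<open>A vertex of the face minus a point of the face is tangent to it.\<close>
      have vs: "set ?vs \<subseteq> tangent_space (convex hull (x ` J))"
        using y js by (auto simp: tangent_space_def intro!: span_base hull_inc)
      have "(\<Sum>q\<in>?I J. c T q * (mon T (fst q) y * phi T (sorted_list_of_set (snd q)) y ?vs)) = p T y ?vs"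
        unfolding c[OF T(1)] by (rule trace_sum[OF T(1) J(1) y vs, symmetric])
      also have "\<dots> = p T' y ?vs"
        using trace y vs js unfolding same_trace_def g_def by auto
      also have "\<dots> = (\<Sum>q\<in>?I J. c T' q * (mon T' (fst q) y * phi T' (sorted_list_of_set (snd q)) y ?vs))"
        unfolding c[OF T(2)] by (rule trace_sum[OF T(2) J(2) y vs])
      also have "\<dots> = (\<Sum>q\<in>?I J. c T' q * (mon T (fst q) y * phi T (sorted_list_of_set (snd q)) y ?vs))"
      proof (rule sum.cong[OF refl])
        fix q assume "q \<in> ?I J"
        then have "snd q \<subseteq> J" "\<And>i. i \<notin> J \<Longrightarrow> fst q i = 0"
          by (auto simp: whitney_indices_def multi_indices_def)
        then show "c T' q * (mon T' (fst q) y * phi T' (sorted_list_of_set (snd q)) y ?vs) =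
            c T' q * (mon T (fst q) y * phi T (sorted_list_of_set (snd q)) y ?vs)"
          using mon_phi_trace_eq[OF T J y vs, of "snd q" "fst q"] by simp
      qed
      finally show "(\<Sum>q\<in>?I J. (c T q - c T' q) *
          (B.mon (fst q) y * B.phi (sorted_list_of_set (snd q)) y ?vs)) = 0"
        by (simp add: left_diff_distrib sum_subtractf)
    qed
    then show ?thesis by simp
  qed simp
  \<comment> \<open>By consistency the chosen simplex does not matter. The choice is arbitrary for
    pairs that belong to no simplex, and \<open>e\<close> is evaluated only at codes of basis
    triples.\<close>
  define e where "e q = c (SOME T. T \<in> \<T> \<and> q \<in> ?I (V T)) q" for q
  have e: "e q = c T q" if "T \<in> \<T>" "q \<in> ?I (V T)" for T q
    unfolding e_def using someI[of "\<lambda>T. T \<in> \<T> \<and> q \<in> ?I (V T)" T] that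
    by (intro consistent) auto
  define W' where "W' = (\<Sum>q\<in>?B. e (code q k) *\<^sub>R omega_form x N \<T> k q)"
  \<comment> \<open>Classes live on the whole space, so agreement is checked on every simplex and
    also on \<open>- \<Omega>\<close>, where both sides are zero.\<close>
  have "W = W'"
  proof (rule ae_form_eqI[where p = "\<lambda>S. if S = - \<Omega> then (\<lambda>y vs. 0) else p S", OF _ mesh_cover])
    show "finite (insert (- \<Omega>) \<T>)" using finite_mesh by simp
    show "restricts_to W S (if S = - \<Omega> then (\<lambda>y vs. 0) else p S)" if "S \<in> insert (- \<Omega>) \<T>" for S
      using that L2_forms_outside[OF L2] p(2) by auto
    have "restricts_to W' (- \<Omega>) (\<lambda>y vs. \<Sum>q\<in>?B. e (code q k) * 0)"
      unfolding W'_def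
      by (intro restricts_to_sum restricts_to_scale omega_form_outside) (use basis_subset_omega in blast)
    moreover have "restricts_to W' T (p T)" if T: "T \<in> \<T>" for T
    proof -
      have "p T = (\<lambda>y vs. \<Sum>q\<in>?B. e (code q k) * local_form k q T y vs)"
        unfolding local_sum_reindex[OF T] using e[OF T] by (auto simp: c[OF T] fun_eq_iff intro!: sum.cong)
      then show ?thesis using restricts_to_omega_sum[OF T] by (simp add: W'_def)
    qed
    ultimately show "restricts_to W' S (if S = - \<Omega> then (\<lambda>y vs. 0) else p S)"
      if "S \<in> insert (- \<Omega>) \<T>" for S
      using that mesh_ne_complement by auto
  qed
  then show ?thesis unfolding W'_def by (simp only: span_sum span_scale span_base imageI)
qed

end

theorem mainTheorem6:
  fixes \<Omega> :: "(real ^ 'n::finite) set" and \<T> :: "(real ^ 'n) set set"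
    and x :: "nat \<Rightarrow> real ^ 'n" and org :: "real ^ 'n" and N r k :: nat
  assumes "bounded_polyhedral_domain \<Omega>"
    and "simplicial_triangulation \<T> \<Omega>"
    and "bij_betw x {0..N} (mesh_vertices \<T>)"
    and "r \<ge> 1" and "k \<le> CARD('n)"
  shows "omega_form x N \<T> k ` omega_indices x N \<T> r k \<subseteq> trimmed_space org \<Omega> \<T> r k \<and>
         span (omega_form x N \<T> k ` omega_indices x N \<T> r k) = trimmed_space org \<Omega> \<T> r k \<and>
         (inj_on (omega_form x N \<T> k) (basis_indices x N \<T> r k) \<and>
          independent (omega_form x N \<T> k ` basis_indices x N \<T> r k) \<and>
          span (omega_form x N \<T> k ` basis_indices x N \<T> r k) = trimmed_space org \<Omega> \<T> r k)"
proof -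
  interpret simplicial_mesh \<Omega> \<T> x N by standard (rule assms)+
  let ?F = "omega_form x N \<T> k"
  have sub: "?F ` omega_indices x N \<T> r k \<subseteq> trimmed_space org \<Omega> \<T> r k"
    using omega_form_in_trimmed_space by blast
  \<comment> \<open>The three inclusions form a cycle through both spans and the trimmed space, so
    all three coincide.\<close>
  have "span (?F ` omega_indices x N \<T> r k) \<subseteq> trimmed_space org \<Omega> \<T> r k"
    by (rule span_minimal[OF sub subspace_trimmed_space])
  moreover have "trimmed_space org \<Omega> \<T> r k \<subseteq> span (?F ` basis_indices x N \<T> r k)"
    using trimmed_space_subset_span by blast
  moreover have "span (?F ` basis_indices x N \<T> r k) \<subseteq> span (?F ` omega_indices x N \<T> r k)"
    by (intro span_mono image_mono basis_subset_omega)
  ultimately show ?thesis using sub omega_basis_independent by blast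
qed

end
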